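(* Let $K$ be a field, let $A=K[a_1,\dots,a_m]$ be trivially graded, let $P=A[x_1,\dots,x_k]$ be positively $\mathbb{Z}$-graded, let $R=P/I$ be a positive $A$-algebra, and let $\Gamma=(\gamma_1,\dots,\gamma_m)$ be a point in $K^m$. (a) We have $$d_{\Gamma_0}-m\ \le\ d_{F_\Gamma}$$ and $$d_{F_\Gamma}=\dim_K\bigl(\operatorname{Cot}_{\langle X\rangle/I_\Gamma}(K[X]/I_\Gamma)\bigr)-\operatorname{ecod}(R_{F_\Gamma})$$ $$=\dim_K\bigl(\operatorname{Cot}_{\mathfrak{m}_{\Gamma_0}}(R)\bigr)-m-\operatorname{ecod}(R_{F_\Gamma})$$ $$=d_{\Gamma_0}+\operatorname{ecod}(R_{\Gamma_0})-m-\operatorname{ecod}(R_{F_\Gamma}).$$ (b) We have $0\le\operatorname{ecod}(R_{F_\Gamma})\le\operatorname{ecod}(R_{\Gamma_0})$.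
   Context: $A=K[a_1,\dots,a_m]$ is a polynomial ring over the field $K$, and $P=A[x_1,\dots,x_k]$ is graded by $\deg(a_i)=0$ and $\deg(x_j)=w_j$, with positive integers $w_j$; $W=(w_1,\dots,w_k)$, $X=\{x_1,\dots,x_k\}$, $K[X]=K[x_1,\dots,x_k]$. A positive $A$-algebra is a ring $R=P/I$ where $I$ is a $W$-homogeneous ideal of $P$ with $I\cap A=\{0\}$ (hence $I\subseteq\langle x_1,\dots,x_k\rangle$). For $\Gamma=(\gamma_1,\dots,\gamma_m)\in K^m$: the zero point over $\Gamma$ is $\Gamma_0=(\gamma_1,\dots,\gamma_m,0,\dots,0)$, with maximal ideal $\mathfrak{M}_{\Gamma_0}=\langle a_1-\gamma_1,\dots,a_m-\gamma_m,x_1,\dots,x_k\rangle$ of $P$; $R_{\Gamma_0}$ is the localization of $R$ at $\mathfrak{M}_{\Gamma_0}/I$, $\mathfrak{m}_{\Gamma_0}$ is its maximal ideal and $d_{\Gamma_0}$ its Krull dimension; $I_\Gamma\subseteq K[X]$ is the image of $I$ under $P\to K[X]$, $a_i\mapsto\gamma_i$, $x_j\mapsto x_j$, and $K[X]/I_\Gamma$ is the coordinate ring of the fiber $F_\Gamma$ over $\Gamma$ of the morphism $\Theta:\operatorname{Spec}(R)\to\operatorname{Spec}(A)$ induced by $A\to R$; $R_{F_\Gamma}$ is the localization of $K[X]/I_\Gamma$ at $\langle X\rangle/I_\Gamma$ and $d_{F_\Gamma}$ is its Krull dimension. For a $K$-algebra $S$ and a maximal ideal $\mathfrak{m}$ with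 residue field $K$, the cotangent space is $\operatorname{Cot}_{\mathfrak m}(S)=\mathfrak{m}/\mathfrak{m}^2$; $\operatorname{Cot}_{\mathfrak{m}_{\Gamma_0}}(R)$ means $\mathfrak{m}_{\Gamma_0}/\mathfrak{m}_{\Gamma_0}^2$. For a local $K$-algebra $(S,\mathfrak{m})$ with $S/\mathfrak{m}=K$, the embedding codimension is $\operatorname{ecod}(S)=\dim_K(\mathfrak{m}/\mathfrak{m}^2)-\dim(S)$. *)

theory Defs
  imports
    "HOL-Algebra.QuotRing"
    "HOL-Algebra.Ideal_Product"
    "HOL-Library.Poly_Mapping"
    "HOL-Library.Extended_Real"
    "Jordan_Normal_Form.VS_Connect"
begin

section \<open>Krull dimension, localization, cotangent spaces\<close>

text \<open>The supremum is taken in the extended reals, so that infinite dimension and the zero ring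
  (dimension \<open>-\<infinity>\<close>) are not assigned spurious finite values.\<close>

definition krull_dim :: "('a, 'b) ring_scheme \<Rightarrow> ereal" where
  "krull_dim R = Sup {ereal (real n) | n. \<exists>p :: nat \<Rightarrow> 'a set.
     (\<forall>i\<le>n. primeideal (p i) R) \<and> (\<forall>i<n. p i \<subset> p (Suc i))}"

definition loc_frac :: "('a, 'b) ring_scheme \<Rightarrow> 'a set \<Rightarrow> 'a \<Rightarrow> 'a \<Rightarrow> ('a \<times> 'a) set" where
  "loc_frac R S r s = {(r', s'). r' \<in> carrier R \<and> s' \<in> S \<and>
     (\<exists>t\<in>S. t \<otimes>\<^bsub>R\<^esub> (r \<otimes>\<^bsub>R\<^esub> s') = t \<otimes>\<^bsub>R\<^esub> (r' \<otimes>\<^bsub>R\<^esub> s))}"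

definition localization :: "('a, 'b) ring_scheme \<Rightarrow> 'a set \<Rightarrow> ('a \<times> 'a) set ring" where
  "localization R S = \<lparr>
     carrier = {loc_frac R S r s | r s. r \<in> carrier R \<and> s \<in> S},
     mult = (\<lambda>X Y. \<Union>(r, s)\<in>X. \<Union>(r', s')\<in>Y. loc_frac R S (r \<otimes>\<^bsub>R\<^esub> r') (s \<otimes>\<^bsub>R\<^esub> s')),
     one = loc_frac R S \<one>\<^bsub>R\<^esub> \<one>\<^bsub>R\<^esub>,
     zero = loc_frac R S \<zero>\<^bsub>R\<^esub> \<one>\<^bsub>R\<^esub>,
     add = (\<lambda>X Y. \<Union>(r, s)\<in>X. \<Union>(r', s')\<in>Y.
              loc_frac R S ((r \<otimes>\<^bsub>R\<^esub> s') \<oplus>\<^bsub>R\<^esub> (r' \<otimes>\<^bsub>R\<^esub> s)) (s \<otimes>\<^bsub>R\<^esub> s'))\<rparr>"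

definition localization_at :: "('a, 'b) ring_scheme \<Rightarrow> 'a set \<Rightarrow> ('a \<times> 'a) set ring" where
  "localization_at R M = localization R (carrier R - M)"

definition loc_map :: "('a, 'b) ring_scheme \<Rightarrow> 'a set \<Rightarrow> 'a \<Rightarrow> ('a \<times> 'a) set" where
  "loc_map R M r = loc_frac R (carrier R - M) r \<one>\<^bsub>R\<^esub>"

text \<open>The maximal ideal of a local ring.\<close>

definition max_ideal :: "('a, 'b) ring_scheme \<Rightarrow> 'a set" where
  "max_ideal S = (THE M. maximalideal M S)"

text \<open>A \<open>K\<close>-algebra is given by a ring \<open>S\<close> and its structure map \<open>\<phi>\<close> from \<open>K\<close>. The cotangent space
  \<open>M/M\<^sup>2\<close> is a \<open>K\<close>-vector space; the record fields \<open>mult\<close> and \<open>one\<close> play no role in that and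
  are inherited from \<open>S/M\<^sup>2\<close>.\<close>

definition cotangent_space ::
  "('k \<Rightarrow> 'a) \<Rightarrow> ('a, 'b) ring_scheme \<Rightarrow> 'a set \<Rightarrow> ('k, 'a set) module" where
  "cotangent_space \<phi> S M = (let Q = ideal_prod S M M in
     \<lparr>carrier = (\<lambda>x. Q +>\<^bsub>S\<^esub> x) ` M,
      mult = rcoset_mult S Q,
      one = Q +>\<^bsub>S\<^esub> \<one>\<^bsub>S\<^esub>,
      zero = Q,
      add = set_add S,
      smult = (\<lambda>c X. \<Union>x\<in>X. Q +>\<^bsub>S\<^esub> (\<phi> c \<otimes>\<^bsub>S\<^esub> x))\<rparr>)"

definition cot_dim :: "('k::field \<Rightarrow> 'a) \<Rightarrow> ('a, 'b) ring_scheme \<Rightarrow> 'a set \<Rightarrow> nat" where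
  "cot_dim \<phi> S M = vectorspace.dim (class_ring :: 'k ring) (cotangent_space \<phi> S M)"

definition ecod :: "('k::field \<Rightarrow> 'a) \<Rightarrow> ('a, 'b) ring_scheme \<Rightarrow> ereal" where
  "ecod \<phi> S = ereal (real (cot_dim \<phi> S (max_ideal S))) - krull_dim S"


section \<open>Polynomial rings\<close>

text \<open>\<open>mpoly_ring n C\<close> is the polynomial ring in the variables with index \<open>< n\<close> over the
  subring \<open>C\<close> of \<open>'a\<close>.\<close>

type_synonym 'a mpoly = "(nat \<Rightarrow>\<^sub>0 nat) \<Rightarrow>\<^sub>0 'a"

definition mpoly_ring :: "nat \<Rightarrow> 'a::comm_ring_1 set \<Rightarrow> 'a mpoly ring" where
  "mpoly_ring n C =
     \<lparr>carrier = {p. \<forall>t\<in>Poly_Mapping.keys p.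
                      Poly_Mapping.keys t \<subseteq> {..<n} \<and> Poly_Mapping.lookup p t \<in> C},
      mult = (*), one = 1, zero = 0, add = (+)\<rparr>"

definition const :: "'a::comm_ring_1 \<Rightarrow> 'a mpoly" where
  "const c = Poly_Mapping.single 0 c"

definition var :: "nat \<Rightarrow> 'a::comm_ring_1 mpoly" where
  "var i = Poly_Mapping.single (Poly_Mapping.single i 1) 1"

definition eval_at :: "(nat \<Rightarrow> 'a) \<Rightarrow> 'a::comm_ring_1 mpoly \<Rightarrow> 'a" where
  "eval_at \<gamma> f = (\<Sum>t\<in>Poly_Mapping.keys f.
     Poly_Mapping.lookup f t * (\<Prod>i\<in>Poly_Mapping.keys t. \<gamma> i ^ Poly_Mapping.lookup t i))"

text \<open>\<open>K[a\<^sub>1,\<dots>,a\<^sub>m]\<close>, \<open>K[a\<^sub>1,\<dots>,a\<^sub>m][x\<^sub>1,\<dots>,x\<^sub>k]\<close> and \<open>K[x\<^sub>1,\<dots>,x\<^sub>k]\<close>, with indices shifted to start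
  at \<open>0\<close>. In \<open>P_ring\<close>, the indeterminate \<open>a\<^sub>i\<close> is \<open>const (var i)\<close> and \<open>x\<^sub>j\<close> is \<open>var j\<close>.\<close>

definition A_ring :: "nat \<Rightarrow> 'k::field mpoly ring" where
  "A_ring m = mpoly_ring m UNIV"

definition P_ring :: "nat \<Rightarrow> nat \<Rightarrow> 'k::field mpoly mpoly ring" where
  "P_ring m k = mpoly_ring k (carrier (A_ring m))"

definition KX_ring :: "nat \<Rightarrow> 'k::field mpoly ring" where
  "KX_ring k = mpoly_ring k UNIV"


section \<open>Positive algebras\<close>

definition weight :: "(nat \<Rightarrow> nat) \<Rightarrow> (nat \<Rightarrow>\<^sub>0 nat) \<Rightarrow> nat" where
  "weight w t = (\<Sum>j\<in>Poly_Mapping.keys t. w j * Poly_Mapping.lookup t j)"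

definition hom_component :: "(nat \<Rightarrow> nat) \<Rightarrow> nat \<Rightarrow> 'a::comm_ring_1 mpoly \<Rightarrow> 'a mpoly" where
  "hom_component w d p = (\<Sum>t\<in>{t \<in> Poly_Mapping.keys p. weight w t = d}.
     Poly_Mapping.single t (Poly_Mapping.lookup p t))"

text \<open>An ideal is homogeneous if it is a graded submodule, i.e. contains the homogeneous
  components of its elements. Coefficients from \<open>A\<close> have degree \<open>0\<close>.\<close>

definition homogeneous_ideal :: "nat \<Rightarrow> nat \<Rightarrow> (nat \<Rightarrow> nat) \<Rightarrow> 'k::field mpoly mpoly set \<Rightarrow> bool" where
  "homogeneous_ideal m k w I \<longleftrightarrow>
     ideal I (P_ring m k) \<and> (\<forall>p\<in>I. \<forall>d. hom_component w d p \<in> I)"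

text \<open>\<open>P/I\<close> is a positive \<open>A\<close>-algebra; \<open>A\<close> is embedded in \<open>P\<close> via \<open>const\<close>.\<close>

definition defines_positive_algebra ::
  "nat \<Rightarrow> nat \<Rightarrow> (nat \<Rightarrow> nat) \<Rightarrow> 'k::field mpoly mpoly set \<Rightarrow> bool" where
  "defines_positive_algebra m k w I \<longleftrightarrow>
     homogeneous_ideal m k w I \<and> I \<inter> const ` carrier (A_ring m) = {0}"

definition R_ring :: "nat \<Rightarrow> nat \<Rightarrow> 'k::field mpoly mpoly set \<Rightarrow> 'k mpoly mpoly set ring" where
  "R_ring m k I = P_ring m k Quot I"

definition R_scalar :: "nat \<Rightarrow> nat \<Rightarrow> 'k::field mpoly mpoly set \<Rightarrow> 'k \<Rightarrow> 'k mpoly mpoly set" where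
  "R_scalar m k I c = I +>\<^bsub>P_ring m k\<^esub> const (const c)"


section \<open>The local ring at a zero point\<close>

definition zero_point_ideal :: "nat \<Rightarrow> nat \<Rightarrow> (nat \<Rightarrow> 'k) \<Rightarrow> 'k::field mpoly mpoly set" where
  "zero_point_ideal m k \<gamma> =
     Idl\<^bsub>P_ring m k\<^esub> ((\<lambda>i. const (var i - const (\<gamma> i))) ` {..<m} \<union> var ` {..<k})"

definition zero_point_ideal_mod ::
  "nat \<Rightarrow> nat \<Rightarrow> 'k::field mpoly mpoly set \<Rightarrow> (nat \<Rightarrow> 'k) \<Rightarrow> 'k mpoly mpoly set set" where
  "zero_point_ideal_mod m k I \<gamma> = (\<lambda>p. I +>\<^bsub>P_ring m k\<^esub> p) ` zero_point_ideal m k \<gamma>"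

definition R_zero ::
  "nat \<Rightarrow> nat \<Rightarrow> 'k::field mpoly mpoly set \<Rightarrow> (nat \<Rightarrow> 'k) \<Rightarrow>
     ('k mpoly mpoly set \<times> 'k mpoly mpoly set) set ring" where
  "R_zero m k I \<gamma> = localization_at (R_ring m k I) (zero_point_ideal_mod m k I \<gamma>)"

definition R_zero_scalar ::
  "nat \<Rightarrow> nat \<Rightarrow> 'k::field mpoly mpoly set \<Rightarrow> (nat \<Rightarrow> 'k) \<Rightarrow>
     'k \<Rightarrow> ('k mpoly mpoly set \<times> 'k mpoly mpoly set) set" where
  "R_zero_scalar m k I \<gamma> c =
     loc_map (R_ring m k I) (zero_point_ideal_mod m k I \<gamma>) (R_scalar m k I c)"


section \<open>The fiber over a point\<close>

text \<open>Substituting \<open>\<gamma>\<close> for the \<open>a\<^sub>i\<close> acts on the coefficients of a polynomial in the \<open>x\<^sub>j\<close>.\<close>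

definition specialize :: "(nat \<Rightarrow> 'k) \<Rightarrow> 'k::field mpoly mpoly \<Rightarrow> 'k mpoly" where
  "specialize \<gamma> p = Poly_Mapping.map (eval_at \<gamma>) p"

definition fiber_ideal :: "'k::field mpoly mpoly set \<Rightarrow> (nat \<Rightarrow> 'k) \<Rightarrow> 'k mpoly set" where
  "fiber_ideal I \<gamma> = specialize \<gamma> ` I"

definition fiber_ring ::
  "nat \<Rightarrow> 'k::field mpoly mpoly set \<Rightarrow> (nat \<Rightarrow> 'k) \<Rightarrow> 'k mpoly set ring" where
  "fiber_ring k I \<gamma> = KX_ring k Quot fiber_ideal I \<gamma>"

definition fiber_scalar ::
  "nat \<Rightarrow> 'k::field mpoly mpoly set \<Rightarrow> (nat \<Rightarrow> 'k) \<Rightarrow> 'k \<Rightarrow> 'k mpoly set" where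
  "fiber_scalar k I \<gamma> c = fiber_ideal I \<gamma> +>\<^bsub>KX_ring k\<^esub> const c"

text \<open>The ideal \<open>\<langle>X\<rangle>/I\<^sub>\<Gamma>\<close> of \<open>K[X]/I\<^sub>\<Gamma>\<close>.\<close>

definition fiber_origin ::
  "nat \<Rightarrow> 'k::field mpoly mpoly set \<Rightarrow> (nat \<Rightarrow> 'k) \<Rightarrow> 'k mpoly set set" where
  "fiber_origin k I \<gamma> =
     (\<lambda>p. fiber_ideal I \<gamma> +>\<^bsub>KX_ring k\<^esub> p) ` (Idl\<^bsub>KX_ring k\<^esub> (var ` {..<k}))"

definition R_fiber ::
  "nat \<Rightarrow> 'k::field mpoly mpoly set \<Rightarrow> (nat \<Rightarrow> 'k) \<Rightarrow> ('k mpoly set \<times> 'k mpoly set) set ring" where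
  "R_fiber k I \<gamma> = localization_at (fiber_ring k I \<gamma>) (fiber_origin k I \<gamma>)"

definition R_fiber_scalar ::
  "nat \<Rightarrow> 'k::field mpoly mpoly set \<Rightarrow> (nat \<Rightarrow> 'k) \<Rightarrow> 'k \<Rightarrow> ('k mpoly set \<times> 'k mpoly set) set" where
  "R_fiber_scalar k I \<gamma> c =
     loc_map (fiber_ring k I \<gamma>) (fiber_origin k I \<gamma>) (fiber_scalar k I \<gamma> c)"

end

theory Submission
  imports Defs "HOL-Algebra.Ring_Divisibility"
begin

text \<open>Let \<open>P = A[x\<^sub>1,\<dots>,x\<^sub>k]\<close>, let \<open>M\<close> be the maximal ideal of the zero point in \<open>P\<close>, and let
  \<open>J \<subseteq> P\<close> be the preimage of \<open>I\<^sub>\<Gamma>\<close>; it is generated by \<open>I\<close> and the elements \<open>a\<^sub>i - \<gamma>\<^sub>i\<close>. Both local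
  rings are localizations at \<open>M\<close> of quotients of \<open>P\<close>, by \<open>I\<close> and by \<open>J\<close>. Hence their dimensions are
  the maximal lengths of chains of primes of \<open>P\<close> between \<open>I\<close> respectively \<open>J\<close> and \<open>M\<close>
  (\<open>krull_dim_eq\<close>), and their cotangent spaces are \<open>M/(M\<^sup>2 + I)\<close> and \<open>M/(M\<^sup>2 + J)\<close>
  (\<open>cot_dim_max_ideal\<close>). The theorem follows from three comparisons.

  \<^item> \<open>d_zero \<le> d_fiber + m\<close>: the ideal \<open>J\<close> arises from \<open>I\<close> by adjoining \<open>m\<close> elements of \<open>M\<close>. In a
  Noetherian ring, a chain of primes whose top contains \<open>x\<close> can be rerouted through \<open>x\<close> at the cost of
  one step (\<open>prime_chain_through\<close>), by Krull's principal ideal theorem (\<open>krull_principal_ideal\<close>).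
  The ring \<open>P\<close> is Noetherian by Hilbert's basis theorem (\<open>hilbert_basis\<close>).

  \<^item> The cotangent space at the zero point has dimension \<open>m + e\<close> if that of the fiber has dimension
  \<open>e\<close> (\<open>cotangent_dimensions\<close>): the partial derivatives at the zero point identify \<open>M/M\<^sup>2\<close> with
  \<open>K\<^sup>m \<times> K\<^sup>k\<close> (\<open>MM_iff\<close>). Because the grading is positive and \<open>I \<inter> A = 0\<close>, elements of \<open>I\<close> have no term
  that is constant in the \<open>x\<^sub>j\<close> (\<open>I_constant_term\<close>). So their derivatives by the \<open>a\<^sub>i\<close> vanish, and dividing
  by \<open>I\<close> affects the factor \<open>K\<^sup>k\<close> only, in the same way as dividing \<open>K[X]\<close> by \<open>I\<^sub>\<Gamma>\<close>.

  \<^item> \<open>d_fiber \<le> e\<close>: a basis of the cotangent space of the fiber lifts to \<open>e\<close> elements of \<open>M\<close>. By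
  Nakayama's lemma (\<open>nakayama_saturated\<close>) no prime between \<open>J\<close> and \<open>M\<close> other than \<open>M\<close> contains
  them all. So adjoining them reduces the dimension from \<open>d_fiber\<close> to \<open>0\<close>, and each of them
  lowers it by at most one (\<open>fiber_dim_le_generators\<close>).

  In particular all dimensions are finite, the embedding codimensions are \<open>e - d_fiber\<close> and
  \<open>m + e - d_zero\<close>, and the claims are arithmetic.\<close>

section \<open>Saturated ideals and Krull's principal ideal theorem\<close>

lemma (in noetherian_ring) exists_maximal_ideal_in_family:
  assumes "F \<noteq> {}" and "\<And>J. J \<in> F \<Longrightarrow> ideal J R"
  shows "\<exists>M\<in>F. \<forall>J\<in>F. M \<subseteq> J \<longrightarrow> J = M"
proof (rule subset_Zorn_nonempty[OF assms(1)])
  fix C assume C: "C \<noteq> {}" "subset.chain F C"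
  then have CF: "C \<subseteq> F" by (simp add: subset_chain_def)
  have "subset.chain {I. ideal I R} C"
    using C(2) assms(2) CF by (auto simp: subset_chain_def)
  from ideal_chain_is_trivial[OF C(1) this] CF show "\<Union>C \<in> F" by blast
qed

context cring
begin

text \<open>The ideals of the localization at a prime \<open>P\<close>, described inside \<open>R\<close>:
  localizing identifies them with the ideals of \<open>R\<close> from which factors outside \<open>P\<close>
  can be cancelled. In this way statements about the local ring at \<open>P\<close> are proved without leaving
  \<open>R\<close>, and \<open>saturation P J\<close> is the contraction of the extension of
  \<open>J\<close>.\<close>
definition saturated :: "'a set \<Rightarrow> 'a set \<Rightarrow> bool" where
  "saturated P J \<longleftrightarrow> ideal J R \<and>
     (\<forall>s\<in>carrier R - P. \<forall>a\<in>carrier R. s \<otimes> a \<in> J \<longrightarrow> a \<in> J)"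

definition saturation :: "'a set \<Rightarrow> 'a set \<Rightarrow> 'a set" where
  "saturation P J = {a \<in> carrier R. \<exists>s\<in>carrier R - P. s \<otimes> a \<in> J}"

lemma saturatedD:
  "saturated P J \<Longrightarrow> s \<otimes> a \<in> J \<Longrightarrow> s \<in> carrier R \<Longrightarrow> s \<notin> P \<Longrightarrow> a \<in> carrier R \<Longrightarrow> a \<in> J"
  unfolding saturated_def by blast

lemma saturated_ideal: "saturated P J \<Longrightarrow> ideal J R"
  unfolding saturated_def by blast

lemma ideal_memD:
  assumes "ideal J R"
  shows "\<And>a. a \<in> J \<Longrightarrow> a \<in> carrier R"
    and "\<And>a b. a \<in> J \<Longrightarrow> b \<in> J \<Longrightarrow> a \<oplus> b \<in> J"
    and "\<And>a b. a \<in> J \<Longrightarrow> b \<in> J \<Longrightarrow> a \<ominus> b \<in> J"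
    and "\<And>a r. a \<in> J \<Longrightarrow> r \<in> carrier R \<Longrightarrow> r \<otimes> a \<in> J"
    and "\<And>a r. a \<in> J \<Longrightarrow> r \<in> carrier R \<Longrightarrow> a \<otimes> r \<in> J"
    and "\<zero> \<in> J"
proof -
  interpret ideal J R by fact
  show "\<And>a b. a \<in> J \<Longrightarrow> b \<in> J \<Longrightarrow> a \<ominus> b \<in> J"
    by (simp add: a_minus_def)
qed (use assms in \<open>auto simp: ideal.Icarr ideal.I_l_closed ideal.I_r_closed additive_subgroup.a_closed
       additive_subgroup.zero_closed ideal.axioms(1)\<close>)

lemma ideal_criterion:
  assumes "J \<subseteq> carrier R" "\<zero> \<in> J" "\<And>a b. a \<in> J \<Longrightarrow> b \<in> J \<Longrightarrow> a \<oplus> b \<in> J"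
    and "\<And>a r. a \<in> J \<Longrightarrow> r \<in> carrier R \<Longrightarrow> r \<otimes> a \<in> J"
  shows "ideal J R"
proof (rule idealI)
  show "subgroup J (add_monoid R)"
  proof (rule add.subgroupI)
    fix a assume a: "a \<in> J"
    then have "(\<ominus> \<one>) \<otimes> a \<in> J" "a \<in> carrier R" using assms(1,4) by auto
    then show "\<ominus> a \<in> J" by (simp add: l_minus)
  qed (use assms in auto)
qed (use assms m_comm in \<open>auto simp: ring_axioms subset_iff\<close>)

lemma primeD:
  assumes "primeideal P R"
  shows "ideal P R" "\<one> \<notin> P" "\<And>a b. a \<in> carrier R \<Longrightarrow> b \<in> carrier R \<Longrightarrow> a \<notin> P \<Longrightarrow> b \<notin> P \<Longrightarrow> a \<otimes> b \<notin> P"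
proof -
  interpret primeideal P R by fact
  show "ideal P R" ..
  show "\<one> \<notin> P" using one_imp_carrier I_notcarr by blast
  show "\<And>a b. a \<in> carrier R \<Longrightarrow> b \<in> carrier R \<Longrightarrow> a \<notin> P \<Longrightarrow> b \<notin> P \<Longrightarrow> a \<otimes> b \<notin> P"
    using I_prime by blast
qed

lemma prime_pow:
  assumes "primeideal P R" "y \<in> carrier R" "y [^] (n::nat) \<in> P"
  shows "y \<in> P"
  using assms(3)
proof (induction n)
  case 0 then show ?case using primeD(2)[OF assms(1)] by simp
next
  case (Suc n) then show ?case
    using primeD(3)[OF assms(1), of "y [^] n" y] assms(2) by auto
qed

lemma saturated_saturation:
  assumes P: "primeideal P R" and J: "ideal J R"
  shows "saturated P (saturation P J)"
  unfolding saturated_def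
proof safe
  note J' = ideal_memD[OF J]
  note P' = primeD[OF P]
  show "ideal (saturation P J) R"
  proof (rule ideal_criterion)
    show "\<zero> \<in> saturation P J" unfolding saturation_def using J' P' by (auto intro!: bexI[of _ \<one>])
  next
    fix a b assume "a \<in> saturation P J" "b \<in> saturation P J"
    then obtain s t where st: "a \<in> carrier R" "b \<in> carrier R" "s \<in> carrier R" "s \<notin> P" "s \<otimes> a \<in> J"
      "t \<in> carrier R" "t \<notin> P" "t \<otimes> b \<in> J" unfolding saturation_def by blast
    have "(s \<otimes> t) \<otimes> (a \<oplus> b) = t \<otimes> (s \<otimes> a) \<oplus> s \<otimes> (t \<otimes> b)" using st by algebra
    then have "(s \<otimes> t) \<otimes> (a \<oplus> b) \<in> J" using st J' by simp
    then show "a \<oplus> b \<in> saturation P J" unfolding saturation_def using st P'(3)[of s t] by auto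
  next
    fix a r assume "a \<in> saturation P J" and r: "r \<in> carrier R"
    then obtain s where s: "a \<in> carrier R" "s \<in> carrier R" "s \<notin> P" "s \<otimes> a \<in> J"
      unfolding saturation_def by blast
    have "s \<otimes> (r \<otimes> a) = r \<otimes> (s \<otimes> a)" using s r by algebra
    then have "s \<otimes> (r \<otimes> a) \<in> J" using s r J' by simp
    then show "r \<otimes> a \<in> saturation P J" unfolding saturation_def using s r by auto
  qed (auto simp: saturation_def)
next
  fix s a assume s: "s \<in> carrier R" "s \<notin> P" "a \<in> carrier R" "s \<otimes> a \<in> saturation P J"
  then obtain t where t: "t \<in> carrier R" "t \<notin> P" "t \<otimes> (s \<otimes> a) \<in> J" unfolding saturation_def by blast
  then have "(t \<otimes> s) \<otimes> a \<in> J" using s by (simp add: m_assoc)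
  then show "a \<in> saturation P J" unfolding saturation_def using s t primeD(3)[OF P, of t s] by auto
qed

lemma saturation_upper:
  assumes "primeideal P R" "ideal J R" shows "J \<subseteq> saturation P J"
proof
  fix a assume "a \<in> J"
  then show "a \<in> saturation P J" unfolding saturation_def
    using ideal_memD(1)[OF assms(2)] primeD[OF assms(1)] by (auto intro!: bexI[of _ \<one>])
qed

lemma saturation_least:
  assumes "saturated P L" "J \<subseteq> L" shows "saturation P J \<subseteq> L"
  unfolding saturation_def using assms saturatedD by blast

lemma saturation_mono: "J \<subseteq> J' \<Longrightarrow> saturation P J \<subseteq> saturation P J'"
  unfolding saturation_def by blast

lemma saturated_antimono:
  "saturated P J \<Longrightarrow> P \<subseteq> P' \<Longrightarrow> saturated P' J"
  unfolding saturated_def by blast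

lemma saturated_prime:
  assumes "primeideal p R" "p \<subseteq> P" shows "saturated P p"
  unfolding saturated_def using primeD[OF assms(1)] assms(2) by blast

lemma saturated_carrier: "saturated P (carrier R)"
  unfolding saturated_def by (simp add: oneideal)

lemma saturated_proper:
  assumes "saturated P J" "J \<noteq> carrier R"
  shows "J \<subseteq> P"
proof
  fix s assume s: "s \<in> J"
  note J = saturated_ideal[OF assms(1)]
  show "s \<in> P"
  proof (rule ccontr)
    assume "s \<notin> P"
    then have "\<one> \<in> J" using saturatedD[OF assms(1), of s \<one>] s ideal_memD(1)[OF J s] by simp
    then show False using ideal.one_imp_carrier[OF J] assms(2) by simp
  qed
qed

lemma sum_ideal_memE:
  assumes "y \<in> J <+>\<^bsub>R\<^esub> PIdl a"
  obtains j r where "j \<in> J" "r \<in> carrier R" "y = j \<oplus> r \<otimes> a"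
  using assms unfolding set_add_def' cgenideal_def by auto

lemma sum_ideal_memI:
  "j \<in> J \<Longrightarrow> r \<in> carrier R \<Longrightarrow> j \<oplus> r \<otimes> a \<in> J <+>\<^bsub>R\<^esub> PIdl a"
  unfolding set_add_def' cgenideal_def by blast

lemma sum_ideal:
  assumes "ideal J R" "a \<in> carrier R"
  shows "ideal (J <+>\<^bsub>R\<^esub> PIdl a) R" "J \<subseteq> J <+>\<^bsub>R\<^esub> PIdl a" "a \<in> J <+>\<^bsub>R\<^esub> PIdl a"
proof -
  show "ideal (J <+>\<^bsub>R\<^esub> PIdl a) R" by (intro add_ideals assms cgenideal_ideal)
  show "J \<subseteq> J <+>\<^bsub>R\<^esub> PIdl a"
  proof
    fix j assume "j \<in> J"
    then show "j \<in> J <+>\<^bsub>R\<^esub> PIdl a" using sum_ideal_memI[of j J \<zero> a] ideal_memD(1)[OF assms(1)] assms(2) by simp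
  qed
  show "a \<in> J <+>\<^bsub>R\<^esub> PIdl a" using sum_ideal_memI[of \<zero> J \<one> a] ideal_memD(6)[OF assms(1)] assms(2) by simp
qed

text \<open>Nakayama's lemma after localization at \<open>P\<close>. Among the saturated ideals that contain
  \<open>N\<close> but not \<open>J\<close>, take a maximal one, \<open>L\<close>. If
  \<open>c \<in> P\<close>, \<open>z \<in> J\<close> and \<open>c z \<notin> L\<close>, then adjoining
  \<open>c z\<close> to \<open>L\<close> reaches \<open>z\<close>, which means
  \<open>(s - r c) z \<in> L\<close> for some \<open>s \<notin> P\<close>; as
  \<open>s - r c \<notin> P\<close>, already \<open>z \<in> L\<close>. So \<open>P J \<subseteq> L\<close>,
  and the hypothesis puts \<open>J\<close> into \<open>L\<close>.\<close>
lemma nakayama_saturated: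
  assumes noeth: "noetherian_ring R" and P: "primeideal P R" and N: "saturated P N"
    and J: "ideal J R"
    and step: "\<And>y. y \<in> J \<Longrightarrow> \<exists>s\<in>carrier R - P. \<exists>u\<in>N. \<exists>v\<in>P \<cdot> J. s \<otimes> y = u \<oplus> v"
  shows "J \<subseteq> N"
proof (rule ccontr)
  assume "\<not> J \<subseteq> N"
  define F where "F = {L. saturated P L \<and> N \<subseteq> L \<and> \<not> J \<subseteq> L}"
  have "N \<in> F" unfolding F_def using \<open>\<not> J \<subseteq> N\<close> N by blast
  then have "\<exists>M\<in>F. \<forall>L\<in>F. M \<subseteq> L \<longrightarrow> L = M"
    by (intro noetherian_ring.exists_maximal_ideal_in_family[OF noeth])
      (auto simp: F_def saturated_ideal)
  then obtain L where LF: "L \<in> F" and maxF: "\<forall>L'\<in>F. L \<subseteq> L' \<longrightarrow> L' = L" by blast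
  from LF have L: "saturated P L" "N \<subseteq> L" "\<not> J \<subseteq> L" by (simp_all add: F_def)
  have max: "J \<subseteq> L'" if "saturated P L'" "L \<subseteq> L'" "L' \<noteq> L" for L'
    using maxF that L(2) unfolding F_def by blast
  note Li = ideal_memD[OF saturated_ideal[OF L(1)]]
  note Pi = ideal_memD[OF primeD(1)[OF P]] and Ji = ideal_memD[OF J]
  have PJ: "c \<otimes> z \<in> L" if c: "c \<in> P" and z: "z \<in> J" for c z
  proof (rule ccontr)
    assume nin: "c \<otimes> z \<notin> L"
    have cz: "c \<otimes> z \<in> carrier R" using c z Pi(1) Ji(1) by simp
    let ?L' = "saturation P (L <+>\<^bsub>R\<^esub> PIdl (c \<otimes> z))"
    note S = sum_ideal[OF saturated_ideal[OF L(1)] cz]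
    have "J \<subseteq> ?L'"
    proof (rule max[OF saturated_saturation[OF P S(1)]])
      show "L \<subseteq> ?L'" using saturation_upper[OF P S(1)] S(2) by blast
      have "c \<otimes> z \<in> ?L'" using saturation_upper[OF P S(1)] S(3) by blast
      then show "?L' \<noteq> L" using nin by blast
    qed
    then obtain s where s: "s \<in> carrier R" "s \<notin> P" "s \<otimes> z \<in> L <+>\<^bsub>R\<^esub> PIdl (c \<otimes> z)"
      using z unfolding saturation_def by blast
    from s(3) obtain l r where lr: "l \<in> L" "r \<in> carrier R" "s \<otimes> z = l \<oplus> r \<otimes> (c \<otimes> z)"
      by (rule sum_ideal_memE)
    have carr: "c \<in> carrier R" "z \<in> carrier R" "l \<in> carrier R" using c z Pi(1) Ji(1) Li(1) lr by auto
    have "(s \<ominus> r \<otimes> c) \<otimes> z = (s \<otimes> z) \<ominus> r \<otimes> (c \<otimes> z)" using carr s(1) lr(2) by algebra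
    also have "\<dots> = l" unfolding lr(3) using carr lr(2) by algebra
    finally have l: "(s \<ominus> r \<otimes> c) \<otimes> z \<in> L" using lr(1) by simp
    have "s \<ominus> r \<otimes> c \<notin> P"
    proof
      assume "s \<ominus> r \<otimes> c \<in> P"
      then have "(s \<ominus> r \<otimes> c) \<oplus> r \<otimes> c \<in> P" using Pi(2,4) c lr(2) by blast
      moreover have "(s \<ominus> r \<otimes> c) \<oplus> r \<otimes> c = s" using carr s(1) lr(2) by algebra
      ultimately show False using s(2) by simp
    qed
    then have "z \<in> L" using saturatedD[OF L(1) l] carr s(1) lr(2) by simp
    then show False using nin Li(4) carr by blast
  qed
  have PJL: "v \<in> L" if "v \<in> P \<cdot> J" for v
    using that by (induction rule: ideal_prod.induct) (auto simp: PJ Li)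
  have "J \<subseteq> L"
  proof
    fix y assume y: "y \<in> J"
    from step[OF y] obtain s u v where "s \<in> carrier R" "s \<notin> P" "u \<in> N" "v \<in> P \<cdot> J" "s \<otimes> y = u \<oplus> v" by blast
    then show "y \<in> L" using saturatedD[OF L(1), of s y] PJL L(2) Li(2) Ji(1)[OF y] by auto
  qed
  with L(3) show False by simp
qed

definition stabilizes :: "(nat \<Rightarrow> 'a set) \<Rightarrow> bool" where
  "stabilizes L \<longleftrightarrow> (\<exists>n. \<forall>k\<ge>n. L k = L n)"

text \<open>If \<open>P\<close> is minimal over \<open>p\<close> and \<open>x\<close>, the local ring at
  \<open>P\<close> modulo \<open>p\<close> and \<open>x\<close> has only one prime ideal, so it is Artinian.
  The proof is a Noetherian induction on \<open>J\<close>. If \<open>J\<close> is prime, it equals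
  \<open>P\<close>, and above \<open>P\<close> there are only two saturated ideals. If
  \<open>a b \<in> J\<close> with \<open>a, b \<notin> J\<close>, then a descending chain \<open>L\<close>
  above \<open>J\<close> is controlled by the chains \<open>L + (a)\<close> and \<open>L : a\<close>, which
  lie above strictly larger ideals.\<close>
lemma saturated_dcc:
  assumes noeth: "noetherian_ring R" and P: "primeideal P R" and x: "x \<in> carrier R"
    and minimal: "\<And>q. primeideal q R \<Longrightarrow> p \<subseteq> q \<Longrightarrow> q \<subseteq> P \<Longrightarrow> x \<in> q \<Longrightarrow> q = P"
    and J: "saturated P J" "p \<subseteq> J" "x \<in> J"
    and L: "\<And>n. saturated P (L n)" "\<And>n. J \<subseteq> L n" "\<And>n. L (Suc n) \<subseteq> L n"
  shows "stabilizes L"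
proof (rule ccontr)
  assume "\<not> stabilizes L"
  define chain where "chain J L \<longleftrightarrow> (\<forall>n. saturated P (L n) \<and> J \<subseteq> L n \<and> L (Suc n) \<subseteq> L n)" for J L
  define F where "F = {J. saturated P J \<and> p \<subseteq> J \<and> x \<in> J \<and> (\<exists>L. chain J L \<and> \<not> stabilizes L)}"
  have "chain J L" unfolding chain_def using L by blast
  then have "J \<in> F" using J \<open>\<not> stabilizes L\<close> unfolding F_def by blast
  then have "\<exists>M\<in>F. \<forall>L\<in>F. M \<subseteq> L \<longrightarrow> L = M"
    by (intro noetherian_ring.exists_maximal_ideal_in_family[OF noeth])
      (auto simp: F_def saturated_ideal)
  then obtain N where NF: "N \<in> F" and max: "\<forall>N'\<in>F. N \<subseteq> N' \<longrightarrow> N' = N" by blast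
  from NF obtain L where N: "saturated P N" "p \<subseteq> N" "x \<in> N"
    and "chain N L" and nst: "\<not> stabilizes L" unfolding F_def by blast
  then have L: "\<And>n. saturated P (L n)" "\<And>n. N \<subseteq> L n" "\<And>n. L (Suc n) \<subseteq> L n"
    by (auto simp: chain_def)
  have dec: "L k \<subseteq> L n" if "n \<le> k" for n k
    using that L(3) by (metis lift_Suc_antimono_le)
  have bigger: "stabilizes L'" if "saturated P N'" "N \<subset> N'" "\<And>n. saturated P (L' n)" "\<And>n. N' \<subseteq> L' n"
    "\<And>n. L' (Suc n) \<subseteq> L' n" for N' L'
  proof (rule ccontr)
    assume "\<not> stabilizes L'"
    moreover have "chain N' L'" unfolding chain_def using that by blast
    ultimately have "N' \<in> F" unfolding F_def using that(1,2) N by blast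
    then show False using max that(2) by blast
  qed
  note Ni = ideal_memD[OF saturated_ideal[OF N(1)]]
  show False
  proof (cases "primeideal N R")
    case True
    have "N \<noteq> carrier R" using primeideal.I_notcarr[OF True] by blast
    then have NP: "N = P" using minimal[OF True N(2) saturated_proper[OF N(1)] N(3)] by simp
    show False
    proof (cases "\<exists>n. L n = N")
      case True
      then obtain n where n: "L n = N" by blast
      have "\<forall>k\<ge>n. L k = L n" using dec n L(2) by blast
      then show False using nst unfolding stabilizes_def by blast
    next
      case False
      then have "L n = carrier R" for n
        using saturated_proper[OF L(1)[of n]] L(2)[of n] NP by blast
      then show False using nst unfolding stabilizes_def by blast
    qed
  next
    case False
    show False
    proof (cases "N = carrier R")
      case True
      have "L n = carrier R" for n
        using L(2)[of n] ideal_memD(1)[OF saturated_ideal[OF L(1)[of n]]] True by blast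
      then show False using nst unfolding stabilizes_def by blast
    next
      case notcarr: False
      obtain a b where ab: "a \<in> carrier R" "b \<in> carrier R" "a \<otimes> b \<in> N" "a \<notin> N" "b \<notin> N"
        using False notcarr primeidealI[OF saturated_ideal[OF N(1)] is_cring] by blast
      define colon where "colon J = {r \<in> carrier R. r \<otimes> a \<in> J}" for J
      define plus where "plus J = saturation P (J <+>\<^bsub>R\<^esub> PIdl a)" for J
      have colon_sat: "saturated P (colon J)" if "saturated P J" for J
      proof -
        note Ji = ideal_memD[OF saturated_ideal[OF that]]
        show ?thesis unfolding saturated_def
        proof safe
          show "ideal (colon J) R"
            by (rule ideal_criterion) (auto simp: colon_def Ji ab l_distr m_assoc)
        next
          fix s r assume "s \<in> carrier R" "s \<notin> P" "r \<in> carrier R" "s \<otimes> r \<in> colon J"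
          then show "r \<in> colon J" using saturatedD[OF that, of s "r \<otimes> a"]
            by (auto simp: colon_def ab m_assoc)
        qed
      qed
      have plus_sat: "saturated P (plus J)" and plus_up: "J \<subseteq> plus J" and plus_a: "a \<in> plus J"
        if "saturated P J" for J
        unfolding plus_def using saturated_saturation[OF P] saturation_upper[OF P]
          sum_ideal[OF saturated_ideal[OF that] ab(1)] by blast+
      have mono: "colon J \<subseteq> colon J'" "plus J \<subseteq> plus J'" if "J \<subseteq> J'" for J J'
        using that unfolding colon_def plus_def
        by (auto intro!: saturation_mono simp: set_add_def')
      have "stabilizes (\<lambda>n. colon (L n))"
      proof (rule bigger[of "colon N"])
        have "b \<in> colon N" using ab m_comm by (simp add: colon_def)
        moreover have "N \<subseteq> colon N" using Ni(1,5) ab(1) by (auto simp: colon_def)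
        ultimately show "N \<subset> colon N" using ab by blast
      qed (use L N colon_sat mono in auto)
      then obtain n1 where n1: "\<forall>k\<ge>n1. colon (L k) = colon (L n1)" unfolding stabilizes_def by blast
      have "stabilizes (\<lambda>n. plus (L n))"
      proof (rule bigger[of "plus N"])
        show "N \<subset> plus N" using plus_up[OF N(1)] plus_a[OF N(1)] ab(4) by blast
      qed (use L N plus_sat mono in auto)
      then obtain n2 where n2: "\<forall>k\<ge>n2. plus (L k) = plus (L n2)" unfolding stabilizes_def by blast
      define n where "n = max n1 n2"
      have "L k = L n" if k: "k \<ge> n" for k
      proof
        show "L k \<subseteq> L n" using dec k .
        show "L n \<subseteq> L k"
        proof
          fix y assume y: "y \<in> L n"
          have eq: "colon (L k) = colon (L n)" "plus (L k) = plus (L n)"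
            using n1 n2 k unfolding n_def by (metis max.bounded_iff order_refl)+
          note Lk = ideal_memD[OF saturated_ideal[OF L(1)[of k]]]
          note Ln = ideal_memD[OF saturated_ideal[OF L(1)[of n]]]
          have "y \<in> plus (L k)" using y plus_up[OF L(1)] eq by blast
          then obtain s where s: "y \<in> carrier R" "s \<in> carrier R" "s \<notin> P" "s \<otimes> y \<in> L k <+>\<^bsub>R\<^esub> PIdl a"
            unfolding plus_def saturation_def by blast
          from s(4) obtain l r where lr: "l \<in> L k" "r \<in> carrier R" "s \<otimes> y = l \<oplus> r \<otimes> a"
            by (rule sum_ideal_memE)
          have "r \<otimes> a = s \<otimes> y \<ominus> l" unfolding lr(3) using Lk(1)[OF lr(1)] lr(2) ab(1) by algebra
          then have "r \<otimes> a \<in> L n" using Ln(3,4) y s(2) lr(1) \<open>L k \<subseteq> L n\<close> by (simp add: subset_iff)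
          then have "r \<in> colon (L k)" using eq lr(2) by (auto simp: colon_def)
          then have "s \<otimes> y \<in> L k" unfolding lr(3) using Lk(2) lr(1) by (simp add: colon_def)
          then show "y \<in> L k" using saturatedD[OF L(1)] s by blast
        qed
      qed
      then show False using nst unfolding stabilizes_def by blast
    qed
  qed
qed

lemma ideal_prod_least:
  assumes "ideal L R" "\<And>a b. a \<in> I \<Longrightarrow> b \<in> J \<Longrightarrow> a \<otimes> b \<in> L"
  shows "I \<cdot> J \<subseteq> L"
proof
  fix v assume "v \<in> I \<cdot> J"
  then show "v \<in> L" by (induction rule: ideal_prod.induct) (auto simp: assms ideal_memD[OF assms(1)])
qed

text \<open>Krull's principal ideal theorem, by symbolic powers \<open>Q n\<close> of \<open>q\<close>
  modulo \<open>p\<close>. The ideals \<open>Q n + (x)\<close> become stationary at \<open>P\<close>. Since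
  \<open>x \<notin> q\<close>, this yields \<open>Q n \<subseteq> Q (n + 1) + P (Q n)\<close> locally at
  \<open>P\<close>, so \<open>Q n = Q (n + 1)\<close> by Nakayama at \<open>P\<close>, and then
  \<open>Q n \<subseteq> p\<close> by Nakayama at \<open>q\<close>. Hence every element of \<open>q\<close>
  has a power in \<open>p\<close>.\<close>
lemma krull_principal_ideal:
  assumes noeth: "noetherian_ring R" and p: "primeideal p R" and q: "primeideal q R"
    and P: "primeideal P R" and pq: "p \<subseteq> q" and qP: "q \<subseteq> P"
    and x: "x \<in> P" "x \<notin> q"
    and minimal: "\<And>q'. primeideal q' R \<Longrightarrow> p \<subseteq> q' \<Longrightarrow> q' \<subseteq> P \<Longrightarrow> x \<in> q' \<Longrightarrow> q' = P"
  shows "q = p"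
proof -
  note pI = primeD(1)[OF p] and qI = primeD(1)[OF q] and PI = primeD(1)[OF P]
  have xc: "x \<in> carrier R" using x(1) ideal_memD(1)[OF PI] by blast
  \<comment> \<open>The symbolic powers of \<open>q\<close> modulo \<open>p\<close>, with the saturation
    at \<open>q\<close> built into each step.\<close>
  define Q where "Q = rec_nat (carrier R) (\<lambda>_ J. saturation q (p <+>\<^bsub>R\<^esub> q \<cdot> J))"
  have Q0: "Q 0 = carrier R" and QS: "\<And>n. Q (Suc n) = saturation q (p <+>\<^bsub>R\<^esub> q \<cdot> Q n)"
    by (simp_all add: Q_def)
  have idl: "ideal (p <+>\<^bsub>R\<^esub> q \<cdot> J) R" if "ideal J R" for J
    by (intro add_ideals pI ideal_prod_is_ideal qI that)
  have pplus: "p \<subseteq> p <+>\<^bsub>R\<^esub> q \<cdot> J" if "ideal J R" for J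
  proof
    fix a assume a: "a \<in> p"
    have "\<zero> \<in> q \<cdot> J" by (rule ideal_memD(6)[OF ideal_prod_is_ideal[OF qI that]])
    then have "a \<oplus> \<zero> \<in> p <+>\<^bsub>R\<^esub> q \<cdot> J" unfolding set_add_def' using a by blast
    then show "a \<in> p <+>\<^bsub>R\<^esub> q \<cdot> J" using ideal_memD(1)[OF pI a] by simp
  qed
  have Qsat: "saturated q (Q n)" for n
  proof (induction n)
    case 0 show ?case by (simp add: Q0 saturated_carrier)
  next
    case (Suc n) show ?case unfolding QS by (intro saturated_saturation q idl saturated_ideal[OF Suc])
  qed
  note QI = saturated_ideal[OF Qsat]
  have pQ: "p \<subseteq> Q n" for n
  proof (cases n)
    case 0 then show ?thesis using ideal_memD(1)[OF pI] by (auto simp: Q0)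
  next
    case (Suc n') show ?thesis unfolding Suc QS
      using pplus[OF QI] saturation_upper[OF q idl[OF QI]] by blast
  qed
  have dec: "Q (Suc n) \<subseteq> Q n" for n
  proof -
    have "q \<cdot> Q n \<subseteq> Q n"
      by (rule ideal_prod_least[OF QI]) (use ideal_memD[OF QI] ideal_memD(1)[OF qI] in auto)
    then have "p <+>\<^bsub>R\<^esub> q \<cdot> Q n \<subseteq> Q n" unfolding set_add_def' using pQ ideal_memD(2)[OF QI] by blast
    then show ?thesis unfolding QS by (rule saturation_least[OF Qsat])
  qed
  have pow: "y [^] n \<in> Q n" if "y \<in> q" for y n
  proof (induction n)
    case 0 then show ?case by (simp add: Q0)
  next
    case (Suc n)
    have yc: "y \<in> carrier R" using ideal_memD(1)[OF qI that] .
    have "y \<otimes> y [^] n \<in> q \<cdot> Q n" using that Suc by (rule ideal_prod.prod)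
    then have "\<zero> \<oplus> y \<otimes> y [^] n \<in> p <+>\<^bsub>R\<^esub> q \<cdot> Q n" unfolding set_add_def'
      using ideal_memD(6)[OF pI] by blast
    then have "y [^] Suc n \<in> p <+>\<^bsub>R\<^esub> q \<cdot> Q n" using yc by (simp add: m_comm)
    then show ?case unfolding QS using saturation_upper[OF q idl[OF QI]] by blast
  qed
  define L where "L n = saturation P (Q n <+>\<^bsub>R\<^esub> PIdl x)" for n
  note S = sum_ideal[OF QI xc]
  have "stabilizes L"
  proof (rule saturated_dcc[OF noeth P xc minimal, where J = "saturation P (p <+>\<^bsub>R\<^esub> PIdl x)"])
    show "saturated P (saturation P (p <+>\<^bsub>R\<^esub> PIdl x))"
      by (intro saturated_saturation P sum_ideal pI xc)
    show "p \<subseteq> saturation P (p <+>\<^bsub>R\<^esub> PIdl x)" "x \<in> saturation P (p <+>\<^bsub>R\<^esub> PIdl x)"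
      using saturation_upper[OF P sum_ideal(1)[OF pI xc]] sum_ideal(2,3)[OF pI xc] by blast+
    fix n
    show "saturated P (L n)" unfolding L_def by (intro saturated_saturation P S)
    show "saturation P (p <+>\<^bsub>R\<^esub> PIdl x) \<subseteq> L n" "L (Suc n) \<subseteq> L n"
      unfolding L_def using pQ[of n] dec[of n] by (auto intro!: saturation_mono simp: set_add_def')
  qed
  then obtain n where n: "L (Suc n) = L n" unfolding stabilizes_def by (meson le_SucI order_refl)
  have "Q n \<subseteq> Q (Suc n)"
  proof (rule nakayama_saturated[OF noeth P saturated_antimono[OF Qsat qP] QI])
    fix y assume y: "y \<in> Q n"
    have "y \<in> L (Suc n)" unfolding n unfolding L_def using saturation_upper[OF P S(1)] S(2) y by blast
    then obtain s where s: "s \<in> carrier R" "s \<notin> P" "s \<otimes> y \<in> Q (Suc n) <+>\<^bsub>R\<^esub> PIdl x"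
      unfolding L_def saturation_def by blast
    from s(3) obtain z r where zr: "z \<in> Q (Suc n)" "r \<in> carrier R" "s \<otimes> y = z \<oplus> r \<otimes> x"
      by (rule sum_ideal_memE)
    have zc: "z \<in> carrier R" using ideal_memD(1)[OF QI zr(1)] .
    have "x \<otimes> r = s \<otimes> y \<ominus> z" unfolding zr(3) using zc zr(2) xc by algebra
    then have "x \<otimes> r \<in> Q n" using ideal_memD(3,4)[OF QI] y s(1) zr(1) dec by (simp add: subset_iff)
    then have "r \<in> Q n" using saturatedD[OF Qsat] xc x(2) zr(2) by blast
    then have "r \<otimes> x \<in> P \<cdot> Q n" using x(1) xc zr(2) by (subst m_comm) (auto intro: ideal_prod.prod)
    then show "\<exists>s\<in>carrier R - P. \<exists>u\<in>Q (Suc n). \<exists>v\<in>P \<cdot> Q n. s \<otimes> y = u \<oplus> v"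
      using s zr by blast
  qed
  then have QSn: "Q n \<subseteq> saturation q (p <+>\<^bsub>R\<^esub> q \<cdot> Q n)" by (simp add: QS)
  \<comment> \<open>Locally at \<open>q\<close>, the ideal \<open>Q n\<close> is now contained in
    \<open>p + q (Q n)\<close>.\<close>
  have "Q n \<subseteq> p"
  proof (rule nakayama_saturated[OF noeth q saturated_prime[OF p pq] QI])
    fix y assume "y \<in> Q n"
    then show "\<exists>s\<in>carrier R - q. \<exists>u\<in>p. \<exists>v\<in>q \<cdot> Q n. s \<otimes> y = u \<oplus> v"
      using QSn unfolding saturation_def set_add_def' by blast
  qed
  then have "q \<subseteq> p" using pow prime_pow[OF p] ideal_memD(1)[OF qI] by blast
  with pq show ?thesis by simp
qed

text \<open>If there were no such prime, then \<open>x \<notin> q\<close> and \<open>r\<close> would be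
  minimal over \<open>p\<close> and \<open>x\<close>, and the principal ideal theorem would give
  \<open>q = p\<close>.\<close>
lemma prime_between_through:
  assumes noeth: "noetherian_ring R" and p: "primeideal p R" and q: "primeideal q R"
    and r: "primeideal r R" and pq: "p \<subset> q" and qr: "q \<subset> r" and x: "x \<in> r"
  shows "\<exists>q'. primeideal q' R \<and> p \<subset> q' \<and> q' \<subset> r \<and> x \<in> q'"
proof (rule ccontr)
  assume neg: "\<not> ?thesis"
  then have xq: "x \<notin> q" using q pq qr by blast
  have "q = p"
    by (rule krull_principal_ideal[OF noeth p q r _ _ x xq]) (use neg pq qr xq in blast)+
  then show False using pq by simp
qed

end

section \<open>Chains of primes in an interval\<close>

definition prime_chain :: "('a, 'b) ring_scheme \<Rightarrow> nat \<Rightarrow> (nat \<Rightarrow> 'a set) \<Rightarrow> bool" where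
  "prime_chain R n p \<longleftrightarrow> (\<forall>i\<le>n. primeideal (p i) R) \<and> (\<forall>i<n. p i \<subset> p (Suc i))"

text \<open>The dimension of the localization at \<open>M\<close> of \<open>R\<close> modulo
  \<open>J\<close>, read off from the primes of \<open>R\<close> itself. Here \<open>J\<close> is any set, so
  that dividing by one more element is inserting it into \<open>J\<close>.\<close>
definition interval_dim :: "('a, 'b) ring_scheme \<Rightarrow> 'a set \<Rightarrow> 'a set \<Rightarrow> ereal" where
  "interval_dim R J M = Sup {ereal (real n) | n. \<exists>p. prime_chain R n p \<and> J \<subseteq> p 0 \<and> p n \<subseteq> M}"

lemma prime_chain_mono: "prime_chain R n p \<Longrightarrow> i \<le> j \<Longrightarrow> j \<le> n \<Longrightarrow> p i \<subseteq> p j"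
proof (induction j)
  case (Suc j)
  show ?case
  proof (cases "i = Suc j")
    case False
    then have "p i \<subseteq> p j" using Suc by simp
    moreover have "p j \<subset> p (Suc j)" using Suc.prems unfolding prime_chain_def by simp
    ultimately show ?thesis by blast
  qed simp
qed simp

text \<open>Starting below the top, the members of the chain are exchanged one after the other for primes
  through \<open>x\<close>; only the bottom one is lost.\<close>
lemma (in cring) prime_chain_through:
  assumes noeth: "noetherian_ring R"
    and "prime_chain R (Suc n) p" "x \<in> p (Suc n)"
  shows "\<exists>q. prime_chain R n q \<and> p 0 \<subseteq> q 0 \<and> x \<in> q 0 \<and> q n = p (Suc n)"
  using assms(2,3)
proof (induction n arbitrary: p)
  case 0
  then show ?case by (intro exI[of _ "\<lambda>_. p 1"]) (auto simp: prime_chain_def)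
next
  case (Suc n)
  from Suc.prems have "\<exists>q'. primeideal q' R \<and> p n \<subset> q' \<and> q' \<subset> p (Suc (Suc n)) \<and> x \<in> q'"
    by (intro prime_between_through[OF noeth, where q="p (Suc n)"]) (auto simp: prime_chain_def)
  then obtain q' where q': "primeideal q' R" "p n \<subset> q'" "q' \<subset> p (Suc (Suc n))" "x \<in> q'" by blast
  let ?p = "p(Suc n := q')"
  have "prime_chain R (Suc n) ?p" using Suc.prems q' unfolding prime_chain_def
    by (auto simp: less_Suc_eq le_Suc_eq)
  from Suc.IH[OF this] obtain q where q: "prime_chain R n q" "p 0 \<subseteq> q 0" "x \<in> q 0" "q n = q'"
    using q'(4) by auto
  let ?q = "q(Suc n := p (Suc (Suc n)))"
  have "prime_chain R (Suc n) ?q" using Suc.prems q q' unfolding prime_chain_def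
    by (auto simp: less_Suc_eq le_Suc_eq)
  moreover have "p 0 \<subseteq> ?q 0" "x \<in> ?q 0" "?q (Suc n) = p (Suc (Suc n))" using q by simp_all
  ultimately show ?case by blast
qed

lemma interval_dimI:
  "prime_chain R n p \<Longrightarrow> J \<subseteq> p 0 \<Longrightarrow> p n \<subseteq> M \<Longrightarrow> ereal (real n) \<le> interval_dim R J M"
  unfolding interval_dim_def by (intro Sup_upper) auto

text \<open>The top of a chain may be moved up to \<open>M\<close>, which contains \<open>x\<close>; then
  the chain can be rerouted through \<open>x\<close> at the cost of one step.\<close>
lemma (in cring) interval_dim_insert:
  assumes noeth: "noetherian_ring R" and M: "primeideal M R" and J: "J \<subseteq> M" and x: "x \<in> M"
  shows "interval_dim R J M \<le> interval_dim R (insert x J) M + 1"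
proof -
  have "ereal (real n) \<le> interval_dim R (insert x J) M + 1"
    if p: "prime_chain R n p" "J \<subseteq> p 0" "p n \<subseteq> M" for n p
  proof (cases n)
    case 0
    have "ereal (real 0) \<le> interval_dim R (insert x J) M"
      by (rule interval_dimI[of R 0 "\<lambda>_. M"]) (use M J x in \<open>auto simp: prime_chain_def\<close>)
    then have "0 \<le> interval_dim R (insert x J) M + 1"
      by (intro add_nonneg_nonneg) (simp_all add: zero_ereal_def)
    then show ?thesis using 0 by (simp add: zero_ereal_def)
  next
    case (Suc n')
    let ?p = "p(n := M)"
    have "p n' \<subset> p n" using p(1) unfolding Suc prime_chain_def by simp
    then have "p n' \<subset> M" using p(3) by blast
    then have "prime_chain R (Suc n') ?p" using p M unfolding prime_chain_def Suc
      by (auto simp: less_Suc_eq le_Suc_eq)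
    from prime_chain_through[OF noeth this] obtain q where
      q: "prime_chain R n' q" "p 0 \<subseteq> q 0" "x \<in> q 0" "q n' = M"
      using x Suc by auto
    have "ereal (real n') \<le> interval_dim R (insert x J) M"
      by (rule interval_dimI[OF q(1)]) (use q p in auto)
    then have "ereal (real n') + 1 \<le> interval_dim R (insert x J) M + 1" by (rule add_right_mono)
    then show ?thesis using Suc by (simp add: one_ereal_def add.commute)
  qed
  then show ?thesis unfolding interval_dim_def[of R J M] by (auto intro!: Sup_least)
qed

lemma (in cring) interval_dim_finite_union:
  assumes noeth: "noetherian_ring R" and M: "primeideal M R" and J: "J \<subseteq> M"
    and X: "finite X" "X \<subseteq> M"
  shows "interval_dim R J M \<le> interval_dim R (J \<union> X) M + ereal (real (card X))"
  using X
proof (induction X rule: finite_induct)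
  case empty then show ?case by simp
next
  case (insert x X)
  have "interval_dim R J M \<le> interval_dim R (J \<union> X) M + ereal (real (card X))" using insert by auto
  also have "\<dots> \<le> interval_dim R (insert x (J \<union> X)) M + 1 + ereal (real (card X))"
    by (intro add_right_mono interval_dim_insert[OF noeth M]) (use J insert in auto)
  finally show ?case using insert by (simp add: one_ereal_def add.assoc)
qed

section \<open>Hilbert basis\<close>

lemma ring_hom_rules:
  assumes "h \<in> Ring.ring_hom T S" "a \<in> carrier T"
  shows "h a \<in> carrier S" "\<And>b. b \<in> carrier T \<Longrightarrow> h (a \<otimes>\<^bsub>T\<^esub> b) = h a \<otimes>\<^bsub>S\<^esub> h b"
    "\<And>b. b \<in> carrier T \<Longrightarrow> h (a \<oplus>\<^bsub>T\<^esub> b) = h a \<oplus>\<^bsub>S\<^esub> h b" "h \<one>\<^bsub>T\<^esub> = \<one>\<^bsub>S\<^esub>"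
  using assms by (auto simp: Ring.ring_hom_def)

locale ring_adjoin = S: cring S + T: cring T for S (structure) and T (structure) +
  fixes h x
  assumes h: "h \<in> Ring.ring_hom T S" and x: "x \<in> carrier S"
begin

text \<open>Polynomial expressions in \<open>x\<close> of degree less than \<open>d\<close> with
  coefficients from \<open>T\<close>. The element \<open>x\<close> may satisfy relations; with
  \<open>x = 0\<close> the construction covers surjections from \<open>T\<close> onto
  \<open>S\<close>.\<close>
fun lower :: "nat \<Rightarrow> 'a set" where
  "lower 0 = {\<zero>}"
| "lower (Suc d) = {h c \<otimes> x [^] d \<oplus> g | c g. c \<in> carrier T \<and> g \<in> lower d}"

sublocale h: ring_hom_cring T S h
  by unfold_locales (use h in auto)

lemma lower_carrier: "g \<in> lower d \<Longrightarrow> g \<in> carrier S"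
  by (induction d arbitrary: g) (auto simp: x)

lemma lower_zero: "\<zero> \<in> lower d"
proof (induction d)
  case (Suc d)
  have "\<zero> = h \<zero>\<^bsub>T\<^esub> \<otimes> x [^] d \<oplus> \<zero>" using x by simp
  then show ?case using Suc T.zero_closed unfolding lower.simps by blast
qed simp

lemma lower_add: "f \<in> lower d \<Longrightarrow> g \<in> lower d \<Longrightarrow> f \<oplus> g \<in> lower d"
proof (induction d arbitrary: f g)
  case (Suc d)
  then obtain a f' b g' where *: "f = h a \<otimes> x [^] d \<oplus> f'" "a \<in> carrier T" "f' \<in> lower d"
    "g = h b \<otimes> x [^] d \<oplus> g'" "b \<in> carrier T" "g' \<in> lower d" by auto
  define y where "y = x [^] d"
  have y: "y \<in> carrier S" using x by (simp add: y_def)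
  have "f \<oplus> g = (h a \<oplus> h b) \<otimes> y \<oplus> (f' \<oplus> g')"
    unfolding * y_def[symmetric] using y *(2,5) lower_carrier[OF *(3)] lower_carrier[OF *(6)] h.hom_closed by algebra
  then have "f \<oplus> g = h (a \<oplus>\<^bsub>T\<^esub> b) \<otimes> x [^] d \<oplus> (f' \<oplus> g')" using * y_def by simp
  then show ?case using Suc.IH[OF *(3,6)] T.a_closed[OF *(2,5)] unfolding lower.simps by blast
qed simp

lemma lower_smult: "c \<in> carrier T \<Longrightarrow> f \<in> lower d \<Longrightarrow> h c \<otimes> f \<in> lower d"
proof (induction d arbitrary: f)
  case (Suc d)
  then obtain a f' where *: "f = h a \<otimes> x [^] d \<oplus> f'" "a \<in> carrier T" "f' \<in> lower d" by auto
  have "h c \<otimes> f = h (c \<otimes>\<^bsub>T\<^esub> a) \<otimes> x [^] d \<oplus> h c \<otimes> f'"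
    unfolding * using * lower_carrier[OF *(3)] x Suc.prems(1)
    by (simp add: S.r_distr S.m_assoc)
  then show ?case using Suc.IH[OF Suc.prems(1) *(3)] T.m_closed[OF Suc.prems(1) *(2)] unfolding lower.simps by blast
qed simp

lemma lower_shift: "f \<in> lower d \<Longrightarrow> x \<otimes> f \<in> lower (Suc d)"
proof (induction d arbitrary: f)
  case 0
  then show ?case using lower_zero[of "Suc 0"] x by auto
next
  case (Suc d)
  then obtain a f' where *: "f = h a \<otimes> x [^] d \<oplus> f'" "a \<in> carrier T" "f' \<in> lower d" by auto
  define y where "y = x [^] d"
  have y: "y \<in> carrier S" using x by (simp add: y_def)
  have "x \<otimes> f = h a \<otimes> (y \<otimes> x) \<oplus> x \<otimes> f'"
    unfolding * y_def[symmetric] using *(2) lower_carrier[OF *(3)] x y h.hom_closed by algebra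
  then have "x \<otimes> f = h a \<otimes> x [^] Suc d \<oplus> x \<otimes> f'" by (simp add: y_def)
  then show ?case using Suc.IH[OF *(3)] *(2) unfolding lower.simps(2)[of "Suc d"] by blast
qed

lemma lower_Suc: "f \<in> lower d \<Longrightarrow> f \<in> lower (Suc d)"
proof -
  assume f: "f \<in> lower d"
  have "f = h \<zero>\<^bsub>T\<^esub> \<otimes> x [^] d \<oplus> f" using x lower_carrier[OF f] by simp
  then show ?thesis using f T.zero_closed unfolding lower.simps by blast
qed

lemma lower_mono: "d \<le> e \<Longrightarrow> lower d \<subseteq> lower e"
  by (rule lift_Suc_mono_le[of lower]) (auto intro: lower_Suc simp del: lower.simps)

definition lead :: "nat \<Rightarrow> 'a set \<Rightarrow> 'c set" where
  "lead d J = {c \<in> carrier T. \<exists>g\<in>lower d. h c \<otimes> x [^] d \<oplus> g \<in> J}"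

lemma lead_ideal:
  assumes J: "ideal J S"
  shows "ideal (lead d J) T"
proof (rule T.ideal_criterion)
  note Ji = S.ideal_memD[OF J]
  define y where "y = x [^] d"
  have y: "y \<in> carrier S" using x by (simp add: y_def)
  show "lead d J \<subseteq> carrier T" by (auto simp: lead_def)
  show "\<zero>\<^bsub>T\<^esub> \<in> lead d J" unfolding lead_def using lower_zero[of d] Ji x by (auto intro!: bexI[of _ "\<zero>"])
  fix a assume "a \<in> lead d J"
  then obtain f where a: "a \<in> carrier T" "f \<in> lower d" "h a \<otimes> y \<oplus> f \<in> J" by (auto simp: lead_def y_def)
  note fc = lower_carrier[OF a(2)] h.hom_closed[OF a(1)]
  {
    fix b assume "b \<in> lead d J"
    then obtain g where b: "b \<in> carrier T" "g \<in> lower d" "h b \<otimes> y \<oplus> g \<in> J" by (auto simp: lead_def y_def)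
    note gc = lower_carrier[OF b(2)] h.hom_closed[OF b(1)]
    have "(h a \<oplus> h b) \<otimes> y \<oplus> (f \<oplus> g) = (h a \<otimes> y \<oplus> f) \<oplus> (h b \<otimes> y \<oplus> g)"
      using fc gc y by algebra
    also have "\<dots> \<in> J" using Ji(2) a b by blast
    finally have "h (a \<oplus>\<^bsub>T\<^esub> b) \<otimes> y \<oplus> (f \<oplus> g) \<in> J" using a b by simp
    then show "a \<oplus>\<^bsub>T\<^esub> b \<in> lead d J" using lower_add[OF a(2) b(2)] a b by (auto simp: lead_def y_def)
  next
    fix r assume r: "r \<in> carrier T"
    have "h (r \<otimes>\<^bsub>T\<^esub> a) \<otimes> y \<oplus> h r \<otimes> f = h r \<otimes> (h a \<otimes> y \<oplus> f)"
      using r a fc y by (simp add: S.r_distr S.m_assoc)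
    also have "\<dots> \<in> J" using Ji(4) a r by simp
    finally show "r \<otimes>\<^bsub>T\<^esub> a \<in> lead d J" using lower_smult[OF r a(2)] a r by (auto simp: lead_def y_def)
  }
qed

lemma lead_mono: "J \<subseteq> J' \<Longrightarrow> lead d J \<subseteq> lead d J'"
  unfolding lead_def by blast

lemma lead_Suc:
  assumes J: "ideal J S" shows "lead d J \<subseteq> lead (Suc d) J"
proof
  fix c assume "c \<in> lead d J"
  then obtain f where c: "c \<in> carrier T" "f \<in> lower d" "h c \<otimes> x [^] d \<oplus> f \<in> J" by (auto simp: lead_def)
  define y where "y = x [^] d"
  have y: "y \<in> carrier S" using x by (simp add: y_def)
  have "h c \<otimes> (y \<otimes> x) \<oplus> x \<otimes> f = x \<otimes> (h c \<otimes> y \<oplus> f)"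
    using y x lower_carrier[OF c(2)] h.hom_closed[OF c(1)] by algebra
  also have "\<dots> \<in> J" using S.ideal_memD(4)[OF J _ x] c(3) by (simp add: y_def)
  finally have "h c \<otimes> x [^] Suc d \<oplus> x \<otimes> f \<in> J" by (simp add: y_def)
  then show "c \<in> lead (Suc d) J" using lower_shift[OF c(2)] c(1) unfolding lead_def by blast
qed

text \<open>An element of \<open>J'\<close> has the same leading coefficient as some element of
  \<open>J\<close> of the same degree, and subtracting the latter lowers the degree.\<close>
lemma eq_if_lead_eq:
  assumes J: "ideal J S" and J': "ideal J' S" and sub: "J \<subseteq> J'"
    and lead: "\<And>d. lead d J' \<subseteq> lead d J"
    and gen: "\<And>s. s \<in> carrier S \<Longrightarrow> \<exists>d. s \<in> lower d"
  shows "J' = J"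
proof -
  have "f \<in> J" if "f \<in> lower d" "f \<in> J'" for d f
    using that
  proof (induction d arbitrary: f)
    case 0 then show ?case using S.ideal_memD(6)[OF J] by simp
  next
    case (Suc d)
    then obtain c g where f: "f = h c \<otimes> x [^] d \<oplus> g" "c \<in> carrier T" "g \<in> lower d" by auto
    then have "c \<in> lead d J'" using Suc.prems(2) by (auto simp: lead_def)
    then have "c \<in> lead d J" using lead by blast
    then obtain g' where g': "g' \<in> lower d" "h c \<otimes> x [^] d \<oplus> g' \<in> J" by (auto simp: lead_def)
    define y where "y = x [^] d"
    have y: "y \<in> carrier S" using x by (simp add: y_def)
    note carr = lower_carrier[OF f(3)] lower_carrier[OF g'(1)] h.hom_closed[OF f(2)]
    have neg: "\<ominus> g' = h (\<ominus>\<^bsub>T\<^esub> \<one>\<^bsub>T\<^esub>) \<otimes> g'" using carr by (simp add: S.l_minus)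
    have "g \<oplus> (\<ominus> g') \<in> lower d" unfolding neg by (intro lower_add f lower_smult g') simp
    moreover have eq: "g \<oplus> (\<ominus> g') = f \<ominus> (h c \<otimes> y \<oplus> g')"
      unfolding f y_def[symmetric] using carr y by algebra
    moreover have "f \<ominus> (h c \<otimes> y \<oplus> g') \<in> J'"
      using Suc.prems(2) g'(2) sub by (intro S.ideal_memD(3)[OF J']) (auto simp: y_def)
    ultimately have "f \<ominus> (h c \<otimes> y \<oplus> g') \<in> J" using Suc.IH by simp
    then have "(f \<ominus> (h c \<otimes> y \<oplus> g')) \<oplus> (h c \<otimes> y \<oplus> g') \<in> J"
      using g'(2) S.ideal_memD(2)[OF J] by (simp add: y_def)
    moreover have "(f \<ominus> (h c \<otimes> y \<oplus> g')) \<oplus> (h c \<otimes> y \<oplus> g') = f"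
      using carr y lower_carrier[OF Suc.prems(1)] by algebra
    ultimately show ?case by simp
  qed
  then show ?thesis using gen S.ideal_memD(1)[OF J'] sub by blast
qed

text \<open>The ideals \<open>lead d J\<close> grow with \<open>d\<close> and with \<open>J\<close>. For a
  chain of ideals \<open>J\<close>, the ascending chain condition in \<open>T\<close> provides a pair
  \<open>d0\<close>, \<open>J0\<close> beyond which they are constant, and for each of the finitely many
  \<open>d < d0\<close> an ideal \<open>K d\<close> beyond which \<open>lead d\<close> is constant. A member
  \<open>N\<close> of the chain that contains all of these has the same leading coefficients as every larger
  member, so it is the largest.\<close>
theorem hilbert_basis:
  assumes noeth: "noetherian_ring T"
    and gen: "\<And>s. s \<in> carrier S \<Longrightarrow> \<exists>d. s \<in> lower d"
  shows "noetherian_ring S"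
proof (rule S.trivial_ideal_chain_imp_noetherian)
  fix C assume C: "C \<noteq> {}" "subset.chain {I. ideal I S} C"
  have Ci: "ideal J S" if "J \<in> C" for J using C(2) that by (auto simp: subset_chain_def)
  have lin: "J \<subseteq> J' \<or> J' \<subseteq> J" if "J \<in> C" "J' \<in> C" for J J'
    using C(2) that by (auto simp: subset_chain_def)
  define F where "F = {lead d J | d J. J \<in> C}"
  have "\<exists>M\<in>F. \<forall>L\<in>F. M \<subseteq> L \<longrightarrow> L = M"
    by (rule noetherian_ring.exists_maximal_ideal_in_family[OF noeth])
      (use C(1) lead_ideal[OF Ci] in \<open>auto simp: F_def\<close>)
  then obtain M where M: "M \<in> F" and maxM: "\<forall>L\<in>F. M \<subseteq> L \<longrightarrow> L = M" by blast
  from M obtain d0 J0 where J0: "J0 \<in> C" "M = lead d0 J0" unfolding F_def by blast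
  have inF: "lead d J \<in> F" if "J \<in> C" for d J unfolding F_def using that by blast
  have max0: "lead d J = lead d0 J0" if "J \<in> C" "lead d0 J0 \<subseteq> lead d J" for d J
    using maxM inF[OF that(1)] that(2) unfolding J0(2) by blast
  have ex: "\<exists>K\<in>C. \<forall>J\<in>C. lead d K \<subseteq> lead d J \<longrightarrow> lead d J = lead d K" for d
  proof -
    define G where "G = lead d ` C"
    have "\<exists>M\<in>G. \<forall>L\<in>G. M \<subseteq> L \<longrightarrow> L = M"
      by (rule noetherian_ring.exists_maximal_ideal_in_family[OF noeth])
        (use C(1) lead_ideal[OF Ci] in \<open>auto simp: G_def\<close>)
    then show ?thesis unfolding G_def by blast
  qed
  define K where "K d = (SOME K. K \<in> C \<and> (\<forall>J\<in>C. lead d K \<subseteq> lead d J \<longrightarrow> lead d J = lead d K))" for d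
  have K: "K d \<in> C \<and> (\<forall>J\<in>C. lead d (K d) \<subseteq> lead d J \<longrightarrow> lead d J = lead d (K d))" for d
    unfolding K_def by (rule someI_ex) (use ex[of d] in blast)
  have "\<exists>N\<in>C. J0 \<subseteq> N \<and> (\<forall>d<e. K d \<subseteq> N)" for e
  proof (induction e)
    case 0 show ?case using J0 by blast
  next
    case (Suc e)
    then obtain N where N: "N \<in> C" "J0 \<subseteq> N" "\<forall>d<e. K d \<subseteq> N" by blast
    show ?case
    proof (cases "N \<subseteq> K e")
      case True
      then show ?thesis using N K[of e] by (intro bexI[of _ "K e"]) (auto simp: less_Suc_eq)
    next
      case False
      then have "K e \<subseteq> N" using lin N(1) K[of e] by blast
      then show ?thesis using N by (intro bexI[of _ N]) (auto simp: less_Suc_eq)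
    qed
  qed
  then obtain N where N: "N \<in> C" "J0 \<subseteq> N" "\<forall>d<d0. K d \<subseteq> N" by blast
  have "J \<subseteq> N" if J: "J \<in> C" for J
  proof (cases "N \<subseteq> J")
    case True
    have "lead d J \<subseteq> lead d N" for d
    proof (cases "d < d0")
      case True
      have "lead d (K d) \<subseteq> lead d N" using N(3) True by (intro lead_mono) simp
      moreover have "lead d N \<subseteq> lead d J" using \<open>N \<subseteq> J\<close> by (rule lead_mono)
      ultimately show ?thesis using K[of d] N(1) J by blast
    next
      case False
      have "lead d0 J0 \<subseteq> lead d J'" if J': "J' \<in> C" "J0 \<subseteq> J'" for J'
      proof -
        have "lead d0 J' \<subseteq> lead d J'"
          by (rule lift_Suc_mono_le[of "\<lambda>d. lead d J'"]) (use lead_Suc[OF Ci[OF J'(1)]] False in auto)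
        then show ?thesis using lead_mono[OF J'(2), of d0] by blast
      qed
      then show ?thesis using max0[of N d] max0[of J d] N J \<open>N \<subseteq> J\<close> by blast
    qed
    then have "J = N" by (intro eq_if_lead_eq[OF Ci[OF N(1)] Ci[OF J] True _ gen])
    then show ?thesis by simp
  next
    case False
    then show ?thesis using lin[OF N(1) J] by blast
  qed
  then have "\<Union>C = N" using N(1) by blast
  then show "\<Union>C \<in> C" using N(1) by simp
qed

end

section \<open>Polynomial rings\<close>

definition coeff_ring :: "'a::comm_ring_1 set \<Rightarrow> bool" where
  "coeff_ring C \<longleftrightarrow> 1 \<in> C \<and> (\<forall>a\<in>C. \<forall>b\<in>C. a - b \<in> C \<and> a * b \<in> C)"

lemma coeff_ringD:
  assumes "coeff_ring C"
  shows "0 \<in> C" "1 \<in> C" "\<And>a b. a \<in> C \<Longrightarrow> b \<in> C \<Longrightarrow> a - b \<in> C" "\<And>a b. a \<in> C \<Longrightarrow> b \<in> C \<Longrightarrow> a * b \<in> C"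
    "\<And>a. a \<in> C \<Longrightarrow> - a \<in> C" "\<And>a b. a \<in> C \<Longrightarrow> b \<in> C \<Longrightarrow> a + b \<in> C"
proof -
  show 1: "1 \<in> C" and d: "\<And>a b. a \<in> C \<Longrightarrow> b \<in> C \<Longrightarrow> a - b \<in> C" and "\<And>a b. a \<in> C \<Longrightarrow> b \<in> C \<Longrightarrow> a * b \<in> C"
    using assms by (auto simp: coeff_ring_def)
  show 0: "0 \<in> C" using d[OF 1 1] by simp
  show m: "\<And>a. a \<in> C \<Longrightarrow> - a \<in> C" using d[OF 0] by simp
  show "\<And>a b. a \<in> C \<Longrightarrow> b \<in> C \<Longrightarrow> a + b \<in> C" using d m by (metis diff_minus_eq_add)
qed

lemma coeff_ring_UNIV: "coeff_ring UNIV"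
  by (simp add: coeff_ring_def)

abbreviation "lookup \<equiv> Poly_Mapping.lookup"
abbreviation "keys \<equiv> Poly_Mapping.keys"
abbreviation "single \<equiv> Poly_Mapping.single"

lemma mpoly_ring_simps [simp]:
  "p \<otimes>\<^bsub>mpoly_ring n C\<^esub> q = p * q" "\<one>\<^bsub>mpoly_ring n C\<^esub> = 1"
  "\<zero>\<^bsub>mpoly_ring n C\<^esub> = 0" "p \<oplus>\<^bsub>mpoly_ring n C\<^esub> q = p + q"
  by (simp_all add: mpoly_ring_def)

lemma mpoly_carrier:
  "p \<in> carrier (mpoly_ring n C) \<longleftrightarrow> (\<forall>t\<in>keys p. keys t \<subseteq> {..<n} \<and> lookup p t \<in> C)"
  by (simp add: mpoly_ring_def)

lemma mpoly_eq_sum_single: "p = (\<Sum>t\<in>keys p. single t (lookup p t))"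
proof (rule poly_mapping_eqI)
  fix t
  have "lookup (\<Sum>t\<in>keys p. single t (lookup p t)) t = (\<Sum>s\<in>keys p. if s = t then lookup p s else 0)"
    by (auto simp: lookup_sum lookup_single when_def intro!: sum.cong)
  also have "\<dots> = lookup p t" by (simp add: in_keys_iff)
  finally show "lookup p t = lookup (\<Sum>t\<in>keys p. single t (lookup p t)) t" ..
qed

lemma single_mem_mpoly:
  "keys t \<subseteq> {..<n} \<Longrightarrow> c \<in> C \<Longrightarrow> single t c \<in> carrier (mpoly_ring n C)"
  by (auto simp: mpoly_carrier split: if_splits)

lemma mpoly_lookup_mem:
  "coeff_ring C \<Longrightarrow> p \<in> carrier (mpoly_ring n C) \<Longrightarrow> lookup p t \<in> C"
  by (cases "t \<in> keys p") (auto simp: mpoly_carrier in_keys_iff coeff_ringD)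

lemma mpoly_add_mem:
  assumes C: "coeff_ring C" and "p \<in> carrier (mpoly_ring n C)" "q \<in> carrier (mpoly_ring n C)"
  shows "p + q \<in> carrier (mpoly_ring n C)"
  unfolding mpoly_carrier
proof safe
  fix t assume "t \<in> keys (p + q)"
  show "lookup (p + q) t \<in> C" unfolding lookup_add
    by (intro coeff_ringD(6)[OF C] mpoly_lookup_mem[OF C assms(2)] mpoly_lookup_mem[OF C assms(3)])
  fix i assume "i \<in> keys t"
  have "t \<in> keys p \<union> keys q" using \<open>t \<in> keys (p + q)\<close> keys_add[of p q] by blast
  then show "i < n" using assms(2,3) \<open>i \<in> keys t\<close> by (auto simp: mpoly_carrier)
qed

lemma mpoly_zero_mem: "0 \<in> carrier (mpoly_ring n C)"
  by (simp add: mpoly_carrier)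

lemma mpoly_sum_mem:
  assumes C: "coeff_ring C" and "\<And>i. i \<in> X \<Longrightarrow> f i \<in> carrier (mpoly_ring n C)"
  shows "sum f X \<in> carrier (mpoly_ring n C)"
  using assms(2) by (induction X rule: infinite_finite_induct) (auto simp: mpoly_zero_mem mpoly_add_mem[OF C])

lemma mpoly_uminus_mem:
  assumes C: "coeff_ring C" and "p \<in> carrier (mpoly_ring n C)"
  shows "- p \<in> carrier (mpoly_ring n C)"
  using assms by (auto simp: mpoly_carrier in_keys_iff coeff_ringD)

lemma mpoly_mult_mem:
  assumes C: "coeff_ring C" and p: "p \<in> carrier (mpoly_ring n C)" and q: "q \<in> carrier (mpoly_ring n C)"
  shows "p * q \<in> carrier (mpoly_ring n C)"
proof -
  have "p * q = (\<Sum>s\<in>keys p. \<Sum>t\<in>keys q. single (s + t) (lookup p s * lookup q t))"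
    by (subst mpoly_eq_sum_single[of p], subst mpoly_eq_sum_single[of q])
      (simp add: sum_product mult_single)
  also have "\<dots> \<in> carrier (mpoly_ring n C)"
  proof (intro mpoly_sum_mem[OF C] single_mem_mpoly coeff_ringD(4)[OF C] mpoly_lookup_mem[OF C p] mpoly_lookup_mem[OF C q])
    fix s t assume "s \<in> keys p" "t \<in> keys q"
    then show "keys (s + t) \<subseteq> {..<n}" using p q keys_add[of s t] by (fastforce simp: mpoly_carrier)
  qed
  finally show ?thesis .
qed

lemma const_mem: "c \<in> C \<Longrightarrow> const c \<in> carrier (mpoly_ring n C)"
  unfolding const_def by (rule single_mem_mpoly) auto

lemma mpoly_one_mem: "coeff_ring C \<Longrightarrow> 1 \<in> carrier (mpoly_ring n C)"
  using const_mem[of 1 C n] by (simp add: const_def coeff_ringD)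

lemma var_mem: "coeff_ring C \<Longrightarrow> i < n \<Longrightarrow> var i \<in> carrier (mpoly_ring n C)"
  unfolding var_def by (rule single_mem_mpoly) (auto simp: coeff_ringD)

lemma coeff_ring_mpoly: "coeff_ring C \<Longrightarrow> coeff_ring (carrier (mpoly_ring n C))"
  unfolding coeff_ring_def[of "carrier _"]
  using mpoly_add_mem[of C _ n "- _"] by (auto simp: mpoly_one_mem mpoly_uminus_mem mpoly_mult_mem)

lemma cring_mpoly:
  assumes C: "coeff_ring C"
  shows "cring (mpoly_ring n C)"
proof (rule cringI)
  show "abelian_group (mpoly_ring n C)"
  proof (rule abelian_groupI)
    fix x assume "x \<in> carrier (mpoly_ring n C)"
    then show "\<exists>y\<in>carrier (mpoly_ring n C). y \<oplus>\<^bsub>mpoly_ring n C\<^esub> x = \<zero>\<^bsub>mpoly_ring n C\<^esub>"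
      by (intro bexI[of _ "- x"]) (simp_all add: mpoly_uminus_mem[OF C])
  qed (simp_all add: mpoly_add_mem[OF C] mpoly_zero_mem add_ac)
  show "comm_monoid (mpoly_ring n C)"
    by (rule comm_monoidI) (simp_all add: mpoly_mult_mem[OF C] mpoly_one_mem[OF C] mult_ac)
qed (simp add: distrib_right)

lemma mpoly_a_inv:
  assumes C: "coeff_ring C" and p: "p \<in> carrier (mpoly_ring n C)"
  shows "\<ominus>\<^bsub>mpoly_ring n C\<^esub> p = - p"
proof -
  interpret cring "mpoly_ring n C" by (rule cring_mpoly[OF C])
  show ?thesis using minus_equality[of "- p" p] mpoly_uminus_mem[OF C p] p by simp
qed

lemma mpoly_a_minus:
  assumes C: "coeff_ring C" and p: "q \<in> carrier (mpoly_ring n C)"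
  shows "p \<ominus>\<^bsub>mpoly_ring n C\<^esub> q = p - q"
  by (simp add: a_minus_def mpoly_a_inv[OF assms])

text \<open>A monomial arises from its coefficient by multiplying with one variable at a time.\<close>
lemma mpoly_induct [consumes 2, case_names const add var]:
  assumes C: "coeff_ring C" and p: "p \<in> carrier (mpoly_ring n C)"
    and const: "\<And>c. c \<in> C \<Longrightarrow> Q (const c)"
    and add: "\<And>f g. f \<in> carrier (mpoly_ring n C) \<Longrightarrow> g \<in> carrier (mpoly_ring n C) \<Longrightarrow> Q f \<Longrightarrow> Q g \<Longrightarrow> Q (f + g)"
    and var: "\<And>i f. i < n \<Longrightarrow> f \<in> carrier (mpoly_ring n C) \<Longrightarrow> Q f \<Longrightarrow> Q (var i * f)"
  shows "Q p"
proof -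
  have mono: "Q (single t c)" if "keys t \<subseteq> {..<n}" "c \<in> C" for t c
    using that(1)
  proof (induction "\<Sum>i<n. lookup t i" arbitrary: t)
    case 0
    have "t = 0"
    proof (rule poly_mapping_eqI)
      fix i show "lookup t i = lookup 0 i" using 0 by (cases "i < n") (auto simp: in_keys_iff subset_iff)
    qed
    then show ?case using const[OF that(2)] by (simp add: const_def)
  next
    case (Suc N)
    have "\<exists>i<n. lookup t i \<noteq> 0" using Suc.hyps(2) by (metis lessThan_iff nat.distinct(1) sum.neutral)
    then obtain i where i: "i < n" "lookup t i \<noteq> 0" by blast
    define s where "s = t - single i 1"
    have t: "t = single i 1 + s"
      by (rule poly_mapping_eqI) (use i in \<open>auto simp: s_def lookup_add lookup_minus lookup_single when_def\<close>)
    have ks: "keys s \<subseteq> {..<n}" using Suc.prems i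
      by (auto simp: s_def in_keys_iff lookup_minus subset_iff)
    have "(\<Sum>j<n. lookup t j) = (\<Sum>j<n. (if j = i then 1 else 0) + lookup s j)"
      unfolding t by (intro sum.cong) (auto simp: lookup_add lookup_single when_def)
    also have "\<dots> = 1 + (\<Sum>j<n. lookup s j)" using i by (simp add: sum.distrib)
    finally have "N = (\<Sum>j<n. lookup s j)" using Suc.hyps(2) by simp
    then have "Q (single s c)" using Suc.hyps(1) ks by blast
    then have "Q (var i * single s c)" using var i(1) single_mem_mpoly[OF ks that(2)] by blast
    then show ?case unfolding var_def mult_single t by simp
  qed
  have "(\<Sum>t\<in>X. single t (lookup p t)) \<in> carrier (mpoly_ring n C) \<and> Q (\<Sum>t\<in>X. single t (lookup p t))"
    if "X \<subseteq> keys p" for X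
    using finite_subset[OF that finite_keys] that
  proof (induction X rule: finite_induct)
    case empty
    then show ?case using const[OF coeff_ringD(1)[OF C]] by (simp add: const_def mpoly_zero_mem)
  next
    case (insert t X)
    have "keys t \<subseteq> {..<n}" "lookup p t \<in> C" using insert.prems p by (auto simp: mpoly_carrier)
    then show ?case using insert by (simp add: add mono single_mem_mpoly mpoly_add_mem[OF C])
  qed
  from this[of "keys p"] show ?thesis using mpoly_eq_sum_single[of p] by simp
qed

lemma mpoly_mono: "n \<le> n' \<Longrightarrow> carrier (mpoly_ring n C) \<subseteq> carrier (mpoly_ring n' C)"
  by (fastforce simp: mpoly_carrier)

lemma noetherian_mpoly_Suc:
  assumes C: "coeff_ring C" and noeth: "noetherian_ring (mpoly_ring n C)"
  shows "noetherian_ring (mpoly_ring (Suc n) C)"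
proof -
  interpret T: cring "mpoly_ring n C" by (rule cring_mpoly[OF C])
  interpret S: cring "mpoly_ring (Suc n) C" by (rule cring_mpoly[OF C])
  interpret ring_adjoin "mpoly_ring (Suc n) C" "mpoly_ring n C" "\<lambda>p. p" "var n"
    by unfold_locales (use mpoly_mono[of n "Suc n" C] var_mem[OF C] in \<open>auto simp: Ring.ring_hom_def subset_iff\<close>)
  have "\<exists>d. s \<in> lower d" if "s \<in> carrier (mpoly_ring (Suc n) C)" for s
    using C that
  proof (induction s rule: mpoly_induct)
    case (const c)
    have "const c = const c \<otimes>\<^bsub>mpoly_ring (Suc n) C\<^esub> var n [^]\<^bsub>mpoly_ring (Suc n) C\<^esub> (0::nat) \<oplus>\<^bsub>mpoly_ring (Suc n) C\<^esub> 0"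
      by simp
    then have "const c \<in> lower (Suc 0)" using const_mem[OF const, of n] unfolding lower.simps by fastforce
    then show ?case by blast
  next
    case (add f g)
    then obtain d e where "f \<in> lower d" "g \<in> lower e" by blast
    then have "f \<in> lower (max d e)" "g \<in> lower (max d e)" using lower_mono[of d "max d e"] lower_mono[of e "max d e"] by auto
    then show ?case using lower_add by fastforce
  next
    case (var i f)
    then obtain d where d: "f \<in> lower d" by blast
    show ?case
    proof (cases "i = n")
      case True
      have "var n * f \<in> lower (Suc d)" using lower_shift[OF d] unfolding mpoly_ring_simps by blast
      with True show ?thesis by blast
    next
      case False
      then have "var i \<in> carrier (mpoly_ring n C)" using var by (intro var_mem[OF C]) simp
      then have "var i * f \<in> lower d" using lower_smult[OF _ d] unfolding mpoly_ring_simps by blast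
      then show ?thesis by blast
    qed
  qed
  then show ?thesis using hilbert_basis[OF noeth] by blast
qed

lemma noetherian_mpoly:
  assumes C: "coeff_ring C" and noeth: "noetherian_ring (mpoly_ring 0 C)"
  shows "noetherian_ring (mpoly_ring n C)"
  by (induction n) (use noeth noetherian_mpoly_Suc[OF C] in auto)

lemma const_add: "const (a + b) = const a + const b" and const_mult: "const (a * b) = const a * const b"
  and const_one: "const 1 = 1" and const_zero: "const 0 = 0" and const_uminus: "const (- a) = - const a"
  and const_diff: "const (a - b) = const a - const b"
  by (simp_all add: const_def single_add mult_single single_uminus single_diff)

text \<open>Without variables, the polynomial ring consists of the image of \<open>T\<close>: adjoin the
  element \<open>0\<close>.\<close>
lemma noetherian_mpoly_0:
  assumes noeth: "noetherian_ring T" and T: "cring T" and C: "coeff_ring C"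
    and h: "h \<in> Ring.ring_hom T (mpoly_ring 0 C)" and surj: "const ` C \<subseteq> h ` carrier T"
  shows "noetherian_ring (mpoly_ring 0 C)"
proof -
  interpret T: cring T by fact
  interpret S: cring "mpoly_ring 0 C" by (rule cring_mpoly[OF C])
  interpret ring_adjoin "mpoly_ring 0 C" T h 0
    by unfold_locales (use h mpoly_zero_mem in auto)
  have "\<exists>d. s \<in> lower d" if "s \<in> carrier (mpoly_ring 0 C)" for s
    using C that
  proof (induction s rule: mpoly_induct)
    case (const c)
    then obtain a where a: "a \<in> carrier T" "const c = h a" using surj by blast
    have "h a = h a \<otimes>\<^bsub>mpoly_ring 0 C\<^esub> 0 [^]\<^bsub>mpoly_ring 0 C\<^esub> (0::nat) \<oplus>\<^bsub>mpoly_ring 0 C\<^esub> 0"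
      by simp
    then have "const c \<in> lower (Suc 0)" using a unfolding lower.simps by fastforce
    then show ?case by blast
  next
    case (add f g)
    then obtain d e where "f \<in> lower d" "g \<in> lower e" by blast
    then have "f \<in> lower (max d e)" "g \<in> lower (max d e)" using lower_mono[of d "max d e"] lower_mono[of e "max d e"] by auto
    then show ?case using lower_add by fastforce
  qed simp
  then show ?thesis using hilbert_basis[OF noeth] by blast
qed

lemma noetherian_class_ring: "noetherian_ring (class_ring :: 'k::field ring)"
proof (rule ring.noetherian_ringI[OF cring.axioms(1)[OF class_cring.is_cring]])
  fix I assume I: "ideal I (class_ring :: 'k ring)"
  note Ii = cring.ideal_memD[OF class_cring.is_cring I]
  show "\<exists>A\<subseteq>carrier (class_ring :: 'k ring). finite A \<and> I = Idl\<^bsub>class_ring\<^esub> A"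
  proof (cases "I = {0}")
    case True
    then show ?thesis using ring.genideal_zero[OF cring.axioms(1)[OF class_cring.is_cring]] by (intro exI[of _ "{0}"]) auto
  next
    case False
    then obtain a where a: "a \<in> I" "a \<noteq> 0" using Ii(6) by auto
    then have "1 \<in> I" using Ii(4)[OF a(1), of "inverse a"] by simp
    then have "I = UNIV" using ideal.one_imp_carrier[OF I] by simp
    then show ?thesis using ring.genideal_one[OF cring.axioms(1)[OF class_cring.is_cring]] by (intro exI[of _ "{1}"]) auto
  qed
qed

lemma coeff_ring_A: "coeff_ring (carrier (A_ring m))"
  unfolding A_ring_def by (rule coeff_ring_mpoly[OF coeff_ring_UNIV])

lemma cring_A: "cring (A_ring m)" unfolding A_ring_def by (rule cring_mpoly[OF coeff_ring_UNIV])
lemma cring_P: "cring (P_ring m k)" unfolding P_ring_def by (rule cring_mpoly[OF coeff_ring_A])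
lemma cring_KX: "cring (KX_ring k)" unfolding KX_ring_def by (rule cring_mpoly[OF coeff_ring_UNIV])

lemma noetherian_A: "noetherian_ring (A_ring m :: 'k::field mpoly ring)"
proof -
  have "noetherian_ring (mpoly_ring 0 (UNIV :: 'k set))"
    by (rule noetherian_mpoly_0[OF noetherian_class_ring class_cring.is_cring coeff_ring_UNIV, of const])
      (auto simp: Ring.ring_hom_def const_add const_mult const_one const_mem)
  then show ?thesis unfolding A_ring_def by (rule noetherian_mpoly[OF coeff_ring_UNIV])
qed

lemma noetherian_P: "noetherian_ring (P_ring m k :: 'k::field mpoly mpoly ring)"
proof -
  have "noetherian_ring (mpoly_ring 0 (carrier (A_ring m :: 'k mpoly ring)))"
    by (rule noetherian_mpoly_0[OF noetherian_A cring_A coeff_ring_A, of const])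
      (auto simp: Ring.ring_hom_def const_add const_mult const_one const_mem A_ring_def)
  then show ?thesis unfolding P_ring_def by (rule noetherian_mpoly[OF coeff_ring_A])
qed

section \<open>Localization\<close>

locale fractions = cring +
  fixes U
  assumes U_carrier: "U \<subseteq> carrier R" and U_one: "\<one> \<in> U"
    and U_mult: "s \<in> U \<Longrightarrow> t \<in> U \<Longrightarrow> s \<otimes> t \<in> U"
begin

abbreviation frac where "frac r s \<equiv> loc_frac R U r s"
abbreviation L where "L \<equiv> localization R U"

lemma UD: "s \<in> U \<Longrightarrow> s \<in> carrier R"
  using U_carrier by blast

lemma mem_frac: "(a, b) \<in> frac r s \<longleftrightarrow> a \<in> carrier R \<and> b \<in> U \<and> (\<exists>t\<in>U. t \<otimes> (r \<otimes> b) = t \<otimes> (a \<otimes> s))"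
  by (simp add: loc_frac_def)

lemma frac_self: "r \<in> carrier R \<Longrightarrow> s \<in> U \<Longrightarrow> (r, s) \<in> frac r s"
  using U_one by (auto simp: mem_frac)

lemma frac_trans:
  assumes c: "r \<in> carrier R" "r' \<in> carrier R" "r'' \<in> carrier R" "s \<in> U" "s' \<in> U" "s'' \<in> U"
    and t: "t \<in> U" "t \<otimes> (r \<otimes> s') = t \<otimes> (r' \<otimes> s)" and t': "t' \<in> U" "t' \<otimes> (r' \<otimes> s'') = t' \<otimes> (r'' \<otimes> s')"
  shows "\<exists>u\<in>U. u \<otimes> (r \<otimes> s'') = u \<otimes> (r'' \<otimes> s)"
proof
  note carr = c(1-3) c(4-6)[THEN UD] t(1)[THEN UD] t'(1)[THEN UD]
  show "t \<otimes> t' \<otimes> s' \<in> U" using t t' c U_mult by blast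
  have "t \<otimes> t' \<otimes> s' \<otimes> (r \<otimes> s'') = (t \<otimes> (r \<otimes> s')) \<otimes> (t' \<otimes> s'')" using carr by algebra
  also have "\<dots> = (t' \<otimes> (r' \<otimes> s'')) \<otimes> (t \<otimes> s)" unfolding t(2) using carr by algebra
  also have "\<dots> = t \<otimes> t' \<otimes> s' \<otimes> (r'' \<otimes> s)" unfolding t'(2) using carr by algebra
  finally show "t \<otimes> t' \<otimes> s' \<otimes> (r \<otimes> s'') = t \<otimes> t' \<otimes> s' \<otimes> (r'' \<otimes> s)" .
qed

lemma frac_eq_iff:
  assumes c: "r \<in> carrier R" "r' \<in> carrier R" "s \<in> U" "s' \<in> U"
  shows "frac r s = frac r' s' \<longleftrightarrow> (\<exists>t\<in>U. t \<otimes> (r \<otimes> s') = t \<otimes> (r' \<otimes> s))"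
proof
  assume "frac r s = frac r' s'"
  then have "(r', s') \<in> frac r s" using frac_self[OF c(2,4)] by simp
  then show "\<exists>t\<in>U. t \<otimes> (r \<otimes> s') = t \<otimes> (r' \<otimes> s)" by (simp add: mem_frac)
next
  assume "\<exists>t\<in>U. t \<otimes> (r \<otimes> s') = t \<otimes> (r' \<otimes> s)"
  then obtain t where t: "t \<in> U" "t \<otimes> (r \<otimes> s') = t \<otimes> (r' \<otimes> s)" by blast
  have sub: "frac r s \<subseteq> frac r' s'"
    if "r \<in> carrier R" "r' \<in> carrier R" "s \<in> U" "s' \<in> U" "t \<otimes> (r \<otimes> s') = t \<otimes> (r' \<otimes> s)" for r s r' s'
  proof clarify
    fix a b assume "(a, b) \<in> frac r s"
    then obtain t' where ab: "a \<in> carrier R" "b \<in> U" "t' \<in> U" "t' \<otimes> (r \<otimes> b) = t' \<otimes> (a \<otimes> s)"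
      by (auto simp: mem_frac)
    have "\<exists>u\<in>U. u \<otimes> (r' \<otimes> b) = u \<otimes> (a \<otimes> s')"
      by (rule frac_trans[OF that(2,1) ab(1) that(4,3) ab(2) t(1) that(5)[symmetric] ab(3,4)])
    then show "(a, b) \<in> frac r' s'" using ab by (simp add: mem_frac)
  qed
  show "frac r s = frac r' s'" using sub[OF c t(2)] sub[OF c(2,1,4,3) t(2)[symmetric]] by blast
qed

lemma frac_eqI:
  assumes "r \<in> carrier R" "r' \<in> carrier R" "s \<in> U" "s' \<in> U" "r \<otimes> s' = r' \<otimes> s"
  shows "frac r s = frac r' s'"
  unfolding frac_eq_iff[OF assms(1-4)] using U_one assms(5) by auto

lemma carrier_L: "X \<in> carrier L \<longleftrightarrow> (\<exists>r\<in>carrier R. \<exists>s\<in>U. X = frac r s)"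
  by (auto simp: localization_def)

lemma frac_mem: "r \<in> carrier R \<Longrightarrow> s \<in> U \<Longrightarrow> frac r s \<in> carrier L"
  by (auto simp: carrier_L)

lemma one_L: "\<one>\<^bsub>L\<^esub> = frac \<one> \<one>" and zero_L: "\<zero>\<^bsub>L\<^esub> = frac \<zero> \<one>"
  by (simp_all add: localization_def)

text \<open>Sums and products of fractions are unions over all representatives; such a union collapses to
  one value once this value is independent of the representatives.\<close>
lemma UN_frac_const:
  assumes c: "r \<in> carrier R" "r' \<in> carrier R" "s \<in> U" "s' \<in> U"
    and "\<And>a b a' b'. (a, b) \<in> frac r s \<Longrightarrow> (a', b') \<in> frac r' s' \<Longrightarrow> F a b a' b' = F r s r' s'"
  shows "(\<Union>(a, b)\<in>frac r s. \<Union>(a', b')\<in>frac r' s'. F a b a' b') = F r s r' s'"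
  using frac_self[OF c(1,3)] frac_self[OF c(2,4)] assms(5) by fast

lemma mult_L:
  assumes c: "r \<in> carrier R" "r' \<in> carrier R" "s \<in> U" "s' \<in> U"
  shows "frac r s \<otimes>\<^bsub>L\<^esub> frac r' s' = frac (r \<otimes> r') (s \<otimes> s')"
proof -
  have "(\<Union>(a, b)\<in>frac r s. \<Union>(a', b')\<in>frac r' s'. frac (a \<otimes> a') (b \<otimes> b')) = frac (r \<otimes> r') (s \<otimes> s')"
  proof (rule UN_frac_const[OF c])
    fix a b a' b' assume "(a, b) \<in> frac r s" "(a', b') \<in> frac r' s'"
    then obtain t t' where ab: "a \<in> carrier R" "b \<in> U" "t \<in> U" "t \<otimes> (r \<otimes> b) = t \<otimes> (a \<otimes> s)"
      "a' \<in> carrier R" "b' \<in> U" "t' \<in> U" "t' \<otimes> (r' \<otimes> b') = t' \<otimes> (a' \<otimes> s')" by (auto simp: mem_frac)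
    note carr = c(1,2) c(3,4)[THEN UD] ab(1,5) ab(2,3,6,7)[THEN UD]
    have "t \<otimes> t' \<otimes> ((a \<otimes> a') \<otimes> (s \<otimes> s')) = (t \<otimes> (a \<otimes> s)) \<otimes> (t' \<otimes> (a' \<otimes> s'))" using carr by algebra
    also have "\<dots> = t \<otimes> t' \<otimes> ((r \<otimes> r') \<otimes> (b \<otimes> b'))"
      unfolding ab(4)[symmetric] ab(8)[symmetric] using carr by algebra
    finally show "frac (a \<otimes> a') (b \<otimes> b') = frac (r \<otimes> r') (s \<otimes> s')"
      using carr U_mult ab c by (subst frac_eq_iff) (auto intro!: bexI[of _ "t \<otimes> t'"])
  qed
  then show ?thesis by (simp add: localization_def)
qed

lemma add_L:
  assumes c: "r \<in> carrier R" "r' \<in> carrier R" "s \<in> U" "s' \<in> U"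
  shows "frac r s \<oplus>\<^bsub>L\<^esub> frac r' s' = frac (r \<otimes> s' \<oplus> r' \<otimes> s) (s \<otimes> s')"
proof -
  have "(\<Union>(a, b)\<in>frac r s. \<Union>(a', b')\<in>frac r' s'. frac (a \<otimes> b' \<oplus> a' \<otimes> b) (b \<otimes> b')) = frac (r \<otimes> s' \<oplus> r' \<otimes> s) (s \<otimes> s')"
  proof (rule UN_frac_const[OF c])
    fix a b a' b' assume "(a, b) \<in> frac r s" "(a', b') \<in> frac r' s'"
    then obtain t t' where ab: "a \<in> carrier R" "b \<in> U" "t \<in> U" "t \<otimes> (r \<otimes> b) = t \<otimes> (a \<otimes> s)"
      "a' \<in> carrier R" "b' \<in> U" "t' \<in> U" "t' \<otimes> (r' \<otimes> b') = t' \<otimes> (a' \<otimes> s')" by (auto simp: mem_frac)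
    note carr = c(1,2) c(3,4)[THEN UD] ab(1,5) ab(2,3,6,7)[THEN UD]
    have "t \<otimes> t' \<otimes> ((a \<otimes> b' \<oplus> a' \<otimes> b) \<otimes> (s \<otimes> s'))
        = (t \<otimes> (a \<otimes> s)) \<otimes> (t' \<otimes> b' \<otimes> s') \<oplus> (t' \<otimes> (a' \<otimes> s')) \<otimes> (t \<otimes> b \<otimes> s)" using carr by algebra
    also have "\<dots> = t \<otimes> t' \<otimes> ((r \<otimes> s' \<oplus> r' \<otimes> s) \<otimes> (b \<otimes> b'))"
      unfolding ab(4)[symmetric] ab(8)[symmetric] using carr by algebra
    finally show "frac (a \<otimes> b' \<oplus> a' \<otimes> b) (b \<otimes> b') = frac (r \<otimes> s' \<oplus> r' \<otimes> s) (s \<otimes> s')"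
      using carr U_mult ab c by (subst frac_eq_iff) (auto intro!: bexI[of _ "t \<otimes> t'"])
  qed
  then show ?thesis by (simp add: localization_def)
qed

lemma cring_L: "cring L"
proof (rule cringI)
  note simps = mult_L add_L one_L zero_L U_mult U_one UD
  show "abelian_group L"
  proof (rule abelian_groupI)
    fix X Y Z assume "X \<in> carrier L" "Y \<in> carrier L" "Z \<in> carrier L"
    then obtain r s r' s' r'' s'' where XYZ: "X = frac r s" "Y = frac r' s'" "Z = frac r'' s''"
      and c: "r \<in> carrier R" "s \<in> U" "r' \<in> carrier R" "s' \<in> U" "r'' \<in> carrier R" "s'' \<in> U"
      by (auto simp: carrier_L)
    note carr = c(1,3,5) c(2,4,6)[THEN UD]
    show "X \<oplus>\<^bsub>L\<^esub> Y \<oplus>\<^bsub>L\<^esub> Z = X \<oplus>\<^bsub>L\<^esub> (Y \<oplus>\<^bsub>L\<^esub> Z)" unfolding XYZ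
      by (simp add: simps c, rule frac_eqI) (use carr c in \<open>simp_all add: U_mult\<close>, algebra)
  next
    fix X Y assume "X \<in> carrier L" "Y \<in> carrier L"
    then obtain r s r' s' where XYZ: "X = frac r s" "Y = frac r' s'"
      and c: "r \<in> carrier R" "s \<in> U" "r' \<in> carrier R" "s' \<in> U"
      by (auto simp: carrier_L)
    note carr = c(1,3) c(2,4)[THEN UD]
    show "X \<oplus>\<^bsub>L\<^esub> Y \<in> carrier L" unfolding XYZ by (simp add: simps c frac_mem)
    show "X \<oplus>\<^bsub>L\<^esub> Y = Y \<oplus>\<^bsub>L\<^esub> X" unfolding XYZ
      by (simp add: simps c, rule frac_eqI) (use carr c in \<open>simp_all add: U_mult\<close>, algebra)
  next
    show "\<zero>\<^bsub>L\<^esub> \<in> carrier L" by (simp add: zero_L frac_mem U_one)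
  next
    fix X assume "X \<in> carrier L"
    then obtain r s where X: "X = frac r s" and c: "r \<in> carrier R" "s \<in> U" by (auto simp: carrier_L)
    note carr = c(1) c(2)[THEN UD]
    show "\<zero>\<^bsub>L\<^esub> \<oplus>\<^bsub>L\<^esub> X = X" unfolding X using c by (simp add: simps)
    show "\<exists>Y\<in>carrier L. Y \<oplus>\<^bsub>L\<^esub> X = \<zero>\<^bsub>L\<^esub>"
    proof
      show "frac (\<ominus> r) s \<in> carrier L" using c by (simp add: frac_mem)
      show "frac (\<ominus> r) s \<oplus>\<^bsub>L\<^esub> X = \<zero>\<^bsub>L\<^esub>" unfolding X
        by (simp add: simps c, rule frac_eqI) (use carr c in \<open>simp_all add: U_mult U_one l_minus l_neg\<close>)
    qed
  qed
  show "comm_monoid L"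
  proof (rule comm_monoidI)
    fix X Y Z assume "X \<in> carrier L" "Y \<in> carrier L" "Z \<in> carrier L"
    then obtain r s r' s' r'' s'' where XYZ: "X = frac r s" "Y = frac r' s'" "Z = frac r'' s''"
      and c: "r \<in> carrier R" "s \<in> U" "r' \<in> carrier R" "s' \<in> U" "r'' \<in> carrier R" "s'' \<in> U"
      by (auto simp: carrier_L)
    show "X \<otimes>\<^bsub>L\<^esub> Y \<otimes>\<^bsub>L\<^esub> Z = X \<otimes>\<^bsub>L\<^esub> (Y \<otimes>\<^bsub>L\<^esub> Z)" unfolding XYZ using c by (simp add: simps m_assoc)
  next
    fix X Y assume "X \<in> carrier L" "Y \<in> carrier L"
    then obtain r s r' s' where XYZ: "X = frac r s" "Y = frac r' s'"
      and c: "r \<in> carrier R" "s \<in> U" "r' \<in> carrier R" "s' \<in> U"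
      by (auto simp: carrier_L)
    show "X \<otimes>\<^bsub>L\<^esub> Y \<in> carrier L" unfolding XYZ by (simp add: simps c frac_mem)
    show "X \<otimes>\<^bsub>L\<^esub> Y = Y \<otimes>\<^bsub>L\<^esub> X" unfolding XYZ using c by (simp add: simps m_comm)
  next
    show "\<one>\<^bsub>L\<^esub> \<in> carrier L" by (simp add: one_L frac_mem U_one)
  next
    fix X assume "X \<in> carrier L"
    then obtain r s where X: "X = frac r s" and c: "r \<in> carrier R" "s \<in> U" by (auto simp: carrier_L)
    show "\<one>\<^bsub>L\<^esub> \<otimes>\<^bsub>L\<^esub> X = X" unfolding X using c by (simp add: simps)
  qed
  fix X Y Z assume "X \<in> carrier L" "Y \<in> carrier L" "Z \<in> carrier L"
  then obtain r s r' s' r'' s'' where XYZ: "X = frac r s" "Y = frac r' s'" "Z = frac r'' s''"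
    and c: "r \<in> carrier R" "s \<in> U" "r' \<in> carrier R" "s' \<in> U" "r'' \<in> carrier R" "s'' \<in> U"
    by (auto simp: carrier_L)
  note carr = c(1,3,5) c(2,4,6)[THEN UD]
  show "(X \<oplus>\<^bsub>L\<^esub> Y) \<otimes>\<^bsub>L\<^esub> Z = X \<otimes>\<^bsub>L\<^esub> Z \<oplus>\<^bsub>L\<^esub> Y \<otimes>\<^bsub>L\<^esub> Z" unfolding XYZ
    by (simp add: simps c, rule frac_eqI) (use carr c in \<open>simp_all add: U_mult\<close>, algebra)
qed

lemma frac_hom: "(\<lambda>r. frac r \<one>) \<in> Ring.ring_hom R L"
  unfolding Ring.ring_hom_def
  by (auto simp: frac_mem U_one mult_L add_L one_L)

lemma frac_mult_denom:
  assumes "r \<in> carrier R" "s \<in> U" shows "frac r s \<otimes>\<^bsub>L\<^esub> frac s \<one> = frac r \<one>"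
  using assms by (simp add: mult_L U_one UD, intro frac_eqI) (simp_all add: U_one UD)

lemma frac_unit:
  assumes "s \<in> U" shows "frac s \<one> \<in> Units L"
proof -
  have "frac \<one> s \<otimes>\<^bsub>L\<^esub> frac s \<one> = \<one>\<^bsub>L\<^esub>" using assms by (simp add: frac_mult_denom one_L)
  moreover have "frac s \<one> \<otimes>\<^bsub>L\<^esub> frac \<one> s = \<one>\<^bsub>L\<^esub>"
    using calculation cring.cring_simprules(14)[OF cring_L] assms by (simp add: frac_mem U_one UD)
  ultimately show ?thesis using assms unfolding Units_def by (auto simp: frac_mem U_one UD)
qed

lemma frac_zero_iff:
  assumes "r \<in> carrier R" shows "frac r \<one> = \<zero>\<^bsub>L\<^esub> \<longleftrightarrow> (\<exists>t\<in>U. t \<otimes> r = \<zero>)"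
  unfolding zero_L using assms by (subst frac_eq_iff) (auto simp: U_one UD)

end

text \<open>The ring \<open>L\<close> as the localization at \<open>M\<close> of \<open>R\<close> modulo
  \<open>J\<close>, seen through the canonical map \<open>g\<close> from \<open>R\<close>. Its primes and its
  cotangent space are determined by these properties of \<open>g\<close>, so that both local rings of the
  theorem can be studied inside one polynomial ring.\<close>
locale localization_model = cring R + L: cring L for R (structure) and L (structure) +
  fixes g J M
  assumes g: "g \<in> Ring.ring_hom R L" and M: "primeideal M R" and J: "ideal J R" and JM: "J \<subseteq> M"
    and denominator: "y \<in> carrier L \<Longrightarrow> \<exists>r\<in>carrier R. \<exists>s\<in>carrier R - M. y \<otimes>\<^bsub>L\<^esub> g s = g r"
    and unit: "s \<in> carrier R - M \<Longrightarrow> g s \<in> Units L"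
    and kernel: "r \<in> carrier R \<Longrightarrow> g r = \<zero>\<^bsub>L\<^esub> \<longleftrightarrow> (\<exists>t\<in>carrier R - M. t \<otimes> r \<in> J)"
begin

sublocale g: ring_hom_cring R L g
  by unfold_locales (rule g)

lemmas Mi = ideal_memD[OF primeD(1)[OF M]]
lemmas Ji = ideal_memD[OF J]

lemma ker_J: "r \<in> J \<Longrightarrow> g r = \<zero>\<^bsub>L\<^esub>"
  using kernel[of r] Ji(1)[of r] primeD(2)[OF M] by (auto intro!: bexI[of _ "\<one>"])

lemma unit_cancel:
  assumes "ideal q L" "y \<in> carrier L" "u \<in> Units L" "y \<otimes>\<^bsub>L\<^esub> u \<in> q"
  shows "y \<in> q"
proof -
  have "(y \<otimes>\<^bsub>L\<^esub> u) \<otimes>\<^bsub>L\<^esub> inv\<^bsub>L\<^esub> u \<in> q" using L.ideal_memD(5)[OF assms(1,4)] assms(3) by simp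
  moreover have "(y \<otimes>\<^bsub>L\<^esub> u) \<otimes>\<^bsub>L\<^esub> inv\<^bsub>L\<^esub> u = y"
    using assms(2) L.Units_closed[OF assms(3)] L.Units_inv_closed[OF assms(3)] L.Units_r_inv[OF assms(3)]
    by (simp add: L.m_assoc)
  ultimately show ?thesis by simp
qed

definition extension :: "'a set \<Rightarrow> 'c set" where
  "extension p = {y \<in> carrier L. \<exists>r\<in>p. \<exists>s\<in>carrier R - M. y \<otimes>\<^bsub>L\<^esub> g s = g r}"

definition contraction :: "'c set \<Rightarrow> 'a set" where
  "contraction q = {r \<in> carrier R. g r \<in> q}"

lemma extension_mono: "p \<subseteq> p' \<Longrightarrow> extension p \<subseteq> extension p'"
  unfolding extension_def by blast

lemma extension_memI:
  "y \<in> carrier L \<Longrightarrow> r \<in> p \<Longrightarrow> s \<in> carrier R - M \<Longrightarrow> y \<otimes>\<^bsub>L\<^esub> g s = g r \<Longrightarrow> y \<in> extension p"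
  unfolding extension_def by blast

lemma extension_ideal:
  assumes p: "ideal p R" shows "ideal (extension p) L"
proof (rule L.ideal_criterion)
  note pi = ideal_memD[OF p]
  have one: "\<one> \<in> carrier R - M" using primeD(2)[OF M] by simp
  show "extension p \<subseteq> carrier L" by (auto simp: extension_def)
  show "\<zero>\<^bsub>L\<^esub> \<in> extension p" by (rule extension_memI[OF L.zero_closed pi(6) one]) simp
  fix y assume "y \<in> extension p"
  then obtain r s where y: "y \<in> carrier L" "r \<in> p" "s \<in> carrier R" "s \<notin> M" "y \<otimes>\<^bsub>L\<^esub> g s = g r"
    by (auto simp: extension_def)
  note yc = y(1,3) pi(1)[OF y(2)] g.hom_closed[OF y(3)]
  {
    fix y' assume "y' \<in> extension p"
    then obtain r' s' where y': "y' \<in> carrier L" "r' \<in> p" "s' \<in> carrier R" "s' \<notin> M" "y' \<otimes>\<^bsub>L\<^esub> g s' = g r'"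
      by (auto simp: extension_def)
    note yc' = y'(1,3) pi(1)[OF y'(2)] g.hom_closed[OF y'(3)]
    have "(y \<oplus>\<^bsub>L\<^esub> y') \<otimes>\<^bsub>L\<^esub> (g s \<otimes>\<^bsub>L\<^esub> g s') = (y \<otimes>\<^bsub>L\<^esub> g s) \<otimes>\<^bsub>L\<^esub> g s' \<oplus>\<^bsub>L\<^esub> (y' \<otimes>\<^bsub>L\<^esub> g s') \<otimes>\<^bsub>L\<^esub> g s"
      using yc yc' by algebra
    then have "(y \<oplus>\<^bsub>L\<^esub> y') \<otimes>\<^bsub>L\<^esub> g (s \<otimes> s') = g (r \<otimes> s' \<oplus> r' \<otimes> s)"
      unfolding y(5) y'(5) using yc yc' by simp
    moreover have "r \<otimes> s' \<oplus> r' \<otimes> s \<in> p" using pi(2,5) y y' by simp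
    moreover have "s \<otimes> s' \<in> carrier R - M" using primeD(3)[OF M] y y' by simp
    ultimately show "y \<oplus>\<^bsub>L\<^esub> y' \<in> extension p" using y(1) y'(1) unfolding extension_def by blast
  next
    fix z assume z: "z \<in> carrier L"
    then obtain r' s' where z': "r' \<in> carrier R" "s' \<in> carrier R" "s' \<notin> M" "z \<otimes>\<^bsub>L\<^esub> g s' = g r'"
      using denominator[OF z] by blast
    note zc = z z'(1,2) g.hom_closed[OF z'(2)]
    have "(z \<otimes>\<^bsub>L\<^esub> y) \<otimes>\<^bsub>L\<^esub> (g s' \<otimes>\<^bsub>L\<^esub> g s) = (z \<otimes>\<^bsub>L\<^esub> g s') \<otimes>\<^bsub>L\<^esub> (y \<otimes>\<^bsub>L\<^esub> g s)"
      using yc zc by algebra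
    then have "(z \<otimes>\<^bsub>L\<^esub> y) \<otimes>\<^bsub>L\<^esub> g (s' \<otimes> s) = g (r' \<otimes> r)"
      unfolding y(5) z'(4) using yc zc by simp
    moreover have "r' \<otimes> r \<in> p" using pi(4) y z' by simp
    moreover have "s' \<otimes> s \<in> carrier R - M" using primeD(3)[OF M] y z' by simp
    ultimately show "z \<otimes>\<^bsub>L\<^esub> y \<in> extension p" using y(1) z unfolding extension_def by blast
  }
qed

lemma extension_gI: "r \<in> p \<Longrightarrow> r \<in> carrier R \<Longrightarrow> g r \<in> extension p"
  by (rule extension_memI[of _ r p "\<one>"]) (use primeD(2)[OF M] in auto)

lemma extension_gD:
  assumes p: "ideal p R" "J \<subseteq> p" and r: "r \<in> carrier R" "g r \<in> extension p"
  shows "\<exists>s\<in>carrier R - M. s \<otimes> r \<in> p"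
proof -
  note pi = ideal_memD[OF p(1)]
  from r(2) obtain r' s where *: "r' \<in> p" "s \<in> carrier R" "s \<notin> M" "g r \<otimes>\<^bsub>L\<^esub> g s = g r'"
    by (auto simp: extension_def)
  have r': "r' \<in> carrier R" using pi(1) * by blast
  have "g (r \<otimes> s \<ominus> r') = \<zero>\<^bsub>L\<^esub>" using * r r' by (simp add: a_minus_def L.r_neg)
  then obtain t where t: "t \<in> carrier R" "t \<notin> M" "t \<otimes> (r \<otimes> s \<ominus> r') \<in> J"
    using kernel[of "r \<otimes> s \<ominus> r'"] r r' * by auto
  have "t \<otimes> (r \<otimes> s \<ominus> r') \<oplus> t \<otimes> r' \<in> p" using t p(2) pi(2,4) * by blast
  moreover have "t \<otimes> (r \<otimes> s \<ominus> r') \<oplus> t \<otimes> r' = (t \<otimes> s) \<otimes> r"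
    using t(1) r r' * by algebra
  moreover have "t \<otimes> s \<in> carrier R - M" using primeD(3)[OF M] t * by simp
  ultimately show ?thesis by auto
qed

lemma extension_gD_prime:
  assumes p: "primeideal p R" "J \<subseteq> p" "p \<subseteq> M" and r: "r \<in> carrier R" "g r \<in> extension p"
  shows "r \<in> p"
  using extension_gD[OF primeD(1)[OF p(1)] p(2) r] primeD(3)[OF p(1)] p(3) r(1) by blast

lemma extension_prime:
  assumes p: "primeideal p R" "J \<subseteq> p" "p \<subseteq> M"
  shows "primeideal (extension p) L"
proof (rule primeidealI[OF extension_ideal[OF primeD(1)[OF p(1)]] L.is_cring])
  note pi = ideal_memD[OF primeD(1)[OF p(1)]]
  show "carrier L \<noteq> extension p"
  proof
    assume "carrier L = extension p"
    then have "g \<one> \<in> extension p" by auto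
    then show False using extension_gD_prime[OF p, of "\<one>"] primeD(2)[OF p(1)] by simp
  qed
  fix y z assume yz: "y \<in> carrier L" "z \<in> carrier L" "y \<otimes>\<^bsub>L\<^esub> z \<in> extension p"
  obtain r s where y: "r \<in> carrier R" "s \<in> carrier R" "s \<notin> M" "y \<otimes>\<^bsub>L\<^esub> g s = g r"
    using denominator[OF yz(1)] by blast
  obtain r' s' where z: "r' \<in> carrier R" "s' \<in> carrier R" "s' \<notin> M" "z \<otimes>\<^bsub>L\<^esub> g s' = g r'"
    using denominator[OF yz(2)] by blast
  note carr = yz(1,2) g.hom_closed[OF y(2)] g.hom_closed[OF z(2)]
  have "(y \<otimes>\<^bsub>L\<^esub> z) \<otimes>\<^bsub>L\<^esub> (g s \<otimes>\<^bsub>L\<^esub> g s') \<in> extension p"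
    using L.ideal_memD(5)[OF extension_ideal[OF primeD(1)[OF p(1)]] yz(3)] carr by simp
  moreover have "(y \<otimes>\<^bsub>L\<^esub> z) \<otimes>\<^bsub>L\<^esub> (g s \<otimes>\<^bsub>L\<^esub> g s') = (y \<otimes>\<^bsub>L\<^esub> g s) \<otimes>\<^bsub>L\<^esub> (z \<otimes>\<^bsub>L\<^esub> g s')" using carr by algebra
  ultimately have "g (r \<otimes> r') \<in> extension p" using y z by simp
  then have "r \<otimes> r' \<in> p" using extension_gD_prime[OF p] y z by simp
  then have "r \<in> p \<or> r' \<in> p" using primeD(3)[OF p(1)] y z by blast
  then show "y \<in> extension p \<or> z \<in> extension p" unfolding extension_def using y z yz by blast
qed

lemma contraction_prime:
  assumes q: "primeideal q L"
  shows "primeideal (contraction q) R" "J \<subseteq> contraction q" "contraction q \<subseteq> M"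
proof -
  note qi = L.ideal_memD[OF L.primeD(1)[OF q]]
  show "J \<subseteq> contraction q" unfolding contraction_def using ker_J qi(6) Ji(1) by auto
  show "contraction q \<subseteq> M"
  proof (rule ccontr)
    assume "\<not> contraction q \<subseteq> M"
    then obtain s where s: "s \<in> carrier R - M" "g s \<in> q" unfolding contraction_def by blast
    then have "\<one>\<^bsub>L\<^esub> \<otimes>\<^bsub>L\<^esub> g s \<in> q" by simp
    then have "\<one>\<^bsub>L\<^esub> \<in> q" using unit_cancel[OF L.primeD(1)[OF q] _ unit[OF s(1)]] by blast
    then show False using L.primeD(2)[OF q] by simp
  qed
  show "primeideal (contraction q) R"
  proof (rule primeidealI)
    show "ideal (contraction q) R"
      by (rule ideal_criterion) (use qi in \<open>auto simp: contraction_def\<close>)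
    show "cring R" by (rule is_cring)
    have "\<one> \<notin> contraction q" using L.primeD(2)[OF q] by (simp add: contraction_def)
    then show "carrier R \<noteq> contraction q" by auto
    fix a b assume "a \<in> carrier R" "b \<in> carrier R" "a \<otimes> b \<in> contraction q"
    then show "a \<in> contraction q \<or> b \<in> contraction q"
      using L.primeD(3)[OF q, of "g a" "g b"] by (auto simp: contraction_def)
  qed
qed

lemma contraction_strict:
  assumes q: "primeideal q L" and q': "primeideal q' L" and sub: "q \<subset> q'"
  shows "contraction q \<subset> contraction q'"
proof -
  note qi = L.ideal_memD[OF L.primeD(1)[OF q]] and qi' = L.ideal_memD[OF L.primeD(1)[OF q']]
  obtain y where y: "y \<in> q'" "y \<notin> q" using sub by blast
  have yc: "y \<in> carrier L" using qi' y by blast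
  obtain r s where rs: "r \<in> carrier R" "s \<in> carrier R - M" "y \<otimes>\<^bsub>L\<^esub> g s = g r"
    using denominator[OF yc] by blast
  have "g r \<in> q'" using qi'(5)[OF y(1), of "g s"] rs by simp
  moreover have "g r \<notin> q" using unit_cancel[OF L.primeD(1)[OF q] yc unit[OF rs(2)]] y(2) rs(3) by auto
  ultimately show ?thesis using sub rs(1) unfolding contraction_def by blast
qed

text \<open>Contraction and extension match the primes of \<open>L\<close> with the primes of
  \<open>R\<close> between \<open>J\<close> and \<open>M\<close>, and they preserve strict inclusions.\<close>
theorem krull_dim_eq: "krull_dim L = interval_dim R J M"
proof -
  have "(\<exists>q. (\<forall>i\<le>n. primeideal (q i) L) \<and> (\<forall>i<n. q i \<subset> q (Suc i))) \<longleftrightarrow>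
      (\<exists>p. prime_chain R n p \<and> J \<subseteq> p 0 \<and> p n \<subseteq> M)" for n
  proof
    assume "\<exists>q. (\<forall>i\<le>n. primeideal (q i) L) \<and> (\<forall>i<n. q i \<subset> q (Suc i))"
    then obtain q where q: "\<And>i. i \<le> n \<Longrightarrow> primeideal (q i) L" "\<And>i. i < n \<Longrightarrow> q i \<subset> q (Suc i)" by blast
    have "prime_chain R n (\<lambda>i. contraction (q i))"
      unfolding prime_chain_def by (simp add: contraction_prime contraction_strict q)
    then show "\<exists>p. prime_chain R n p \<and> J \<subseteq> p 0 \<and> p n \<subseteq> M"
      using contraction_prime(2)[OF q(1)[of 0]] contraction_prime(3)[OF q(1)[of n]] by blast
  next
    assume "\<exists>p. prime_chain R n p \<and> J \<subseteq> p 0 \<and> p n \<subseteq> M"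
    then obtain p where p: "prime_chain R n p" "J \<subseteq> p 0" "p n \<subseteq> M" by blast
    have prime: "primeideal (p i) R" "J \<subseteq> p i" "p i \<subseteq> M" if "i \<le> n" for i
      using p(2,3) prime_chain_mono[OF p(1), of 0 i] prime_chain_mono[OF p(1), of i n] p(1) that
      by (auto simp: prime_chain_def)
    have "extension (p i) \<subset> extension (p (Suc i))" if i: "i < n" for i
    proof -
      have sub: "p i \<subset> p (Suc i)" using p(1) i by (simp add: prime_chain_def)
      then obtain r where r: "r \<in> p (Suc i)" "r \<notin> p i" by blast
      have i': "Suc i \<le> n" "i \<le> n" using i by simp_all
      have rc: "r \<in> carrier R" using ideal_memD(1)[OF primeD(1)[OF prime(1)[OF i'(1)]] r(1)] .
      have "g r \<in> extension (p (Suc i))" by (rule extension_gI[OF r(1) rc])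
      moreover have "g r \<notin> extension (p i)" using extension_gD_prime[OF prime[OF i'(2)] rc] r(2) by blast
      ultimately show ?thesis using extension_mono[of "p i" "p (Suc i)"] sub by blast
    qed
    then show "\<exists>q. (\<forall>i\<le>n. primeideal (q i) L) \<and> (\<forall>i<n. q i \<subset> q (Suc i))"
      using extension_prime[OF prime] by (intro exI[of _ "\<lambda>i. extension (p i)"]) blast
  qed
  then show ?thesis unfolding krull_dim_def interval_dim_def by simp
qed

text \<open>An element outside the extension of \<open>M\<close> has a numerator outside \<open>M\<close>,
  so it is a unit.\<close>
lemma proper_ideal_sub:
  assumes Q: "ideal Q L" "Q \<noteq> carrier L"
  shows "Q \<subseteq> extension M"
proof
  fix y assume y: "y \<in> Q"
  note Qi = L.ideal_memD[OF Q(1)]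
  obtain r s where rs: "r \<in> carrier R" "s \<in> carrier R - M" "y \<otimes>\<^bsub>L\<^esub> g s = g r"
    using denominator[OF Qi(1)[OF y]] by blast
  have "r \<in> M"
  proof (rule ccontr)
    assume "r \<notin> M"
    then have u: "g r \<in> Units L" using unit rs(1) by simp
    have "g r \<in> Q" using Qi(5)[OF y, of "g s"] rs by simp
    then have "\<one>\<^bsub>L\<^esub> \<otimes>\<^bsub>L\<^esub> g r \<in> Q" using rs(1) by simp
    then have "\<one>\<^bsub>L\<^esub> \<in> Q" using unit_cancel[OF Q(1) _ u] by blast
    then show False using ideal.one_imp_carrier[OF Q(1)] Q(2) by simp
  qed
  then show "y \<in> extension M" unfolding extension_def using rs Qi(1)[OF y] by blast
qed

lemma max_ideal_eq: "max_ideal L = extension M"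
  unfolding max_ideal_def
proof (rule the_equality)
  have prime: "primeideal (extension M) L" by (rule extension_prime[OF M JM order_refl])
  show "maximalideal (extension M) L"
  proof (rule maximalidealI[OF L.primeD(1)[OF prime]])
    show "carrier L \<noteq> extension M" using L.primeD(2)[OF prime] by auto
    fix Q assume "ideal Q L" "extension M \<subseteq> Q" "Q \<subseteq> carrier L"
    then show "Q = extension M \<or> Q = carrier L" using proper_ideal_sub by blast
  qed
  fix N assume N: "maximalideal N L"
  have "N \<subseteq> extension M"
    using proper_ideal_sub[OF maximalideal.axioms(1)[OF N]] maximalideal.I_notcarr[OF N] by blast
  then show "N = extension M"
    using maximalideal.I_maximal[OF N L.primeD(1)[OF prime]] L.primeD(2)[OF prime]
      L.ideal_memD(1)[OF L.primeD(1)[OF prime]] L.one_closed by blast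
qed

end

text \<open>As the kernel lies in \<open>M\<close>, no element outside \<open>M\<close> has the same image
  as an element of \<open>M\<close>. So the denominators in \<open>S\<close> are the images of the elements
  outside \<open>M\<close>.\<close>
lemma localization_model_of_surjection:
  fixes P :: "('a, 'b) ring_scheme" and S :: "('c, 'd) ring_scheme"
  assumes P: "cring P" and S: "cring S" and h: "h \<in> Ring.ring_hom P S" and surj: "h ` carrier P = carrier S"
    and M: "primeideal M P" and ker: "{r \<in> carrier P. h r = \<zero>\<^bsub>S\<^esub>} \<subseteq> M"
  shows "localization_model P (localization_at S (h ` M)) (\<lambda>r. loc_map S (h ` M) (h r))
     {r \<in> carrier P. h r = \<zero>\<^bsub>S\<^esub>} M"
proof -
  interpret P: cring P by fact
  interpret S: cring S by fact
  interpret h: ring_hom_cring P S h by unfold_locales (rule h)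
  note Mi = P.ideal_memD[OF P.primeD(1)[OF M]]
  have mem: "h r \<in> h ` M \<longleftrightarrow> r \<in> M" if r: "r \<in> carrier P" for r
  proof
    assume "h r \<in> h ` M"
    then obtain x where x: "x \<in> M" "h r = h x" by blast
    have xc: "x \<in> carrier P" using Mi(1) x by blast
    have "h (r \<ominus>\<^bsub>P\<^esub> x) = \<zero>\<^bsub>S\<^esub>" using r xc x(2) by (simp add: a_minus_def S.r_neg)
    then have "r \<ominus>\<^bsub>P\<^esub> x \<in> M" using ker r xc by blast
    then have "(r \<ominus>\<^bsub>P\<^esub> x) \<oplus>\<^bsub>P\<^esub> x \<in> M" using Mi(2) x by blast
    moreover have "(r \<ominus>\<^bsub>P\<^esub> x) \<oplus>\<^bsub>P\<^esub> x = r" using r xc by algebra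
    ultimately show "r \<in> M" by simp
  qed simp
  let ?U = "carrier S - h ` M"
  have U: "?U = h ` (carrier P - M)"
  proof
    show "?U \<subseteq> h ` (carrier P - M)" using surj by blast
    show "h ` (carrier P - M) \<subseteq> ?U"
    proof
      fix y assume "y \<in> h ` (carrier P - M)"
      then obtain r where "r \<in> carrier P" "r \<notin> M" "y = h r" by blast
      then show "y \<in> ?U" using mem[of r] by simp
    qed
  qed
  interpret F: fractions S ?U
  proof
    show "\<one>\<^bsub>S\<^esub> \<in> ?U" using mem[of "\<one>\<^bsub>P\<^esub>"] P.primeD(2)[OF M] by simp
    fix s t assume "s \<in> ?U" "t \<in> ?U"
    then obtain a b where ab: "s = h a" "t = h b" "a \<in> carrier P" "a \<notin> M" "b \<in> carrier P" "b \<notin> M" unfolding U by blast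
    then have "s \<otimes>\<^bsub>S\<^esub> t = h (a \<otimes>\<^bsub>P\<^esub> b)" "a \<otimes>\<^bsub>P\<^esub> b \<in> carrier P - M" using P.primeD(3)[OF M] by simp_all
    then show "s \<otimes>\<^bsub>S\<^esub> t \<in> ?U" unfolding U by blast
  qed blast
  interpret L: cring F.L by (rule F.cring_L)
  have "localization_model P F.L (\<lambda>r. F.frac (h r) \<one>\<^bsub>S\<^esub>) {r \<in> carrier P. h r = \<zero>\<^bsub>S\<^esub>} M"
  proof (intro localization_model.intro localization_model_axioms.intro)
    show "cring P" "cring F.L" by (rule P.is_cring, rule F.cring_L)
    show "(\<lambda>r. F.frac (h r) \<one>\<^bsub>S\<^esub>) \<in> Ring.ring_hom P F.L"
      using F.frac_hom unfolding Ring.ring_hom_def by auto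
    show "primeideal M P" by fact
    show "ideal {r \<in> carrier P. h r = \<zero>\<^bsub>S\<^esub>} P"
      by (rule P.ideal_criterion) auto
    show "{r \<in> carrier P. h r = \<zero>\<^bsub>S\<^esub>} \<subseteq> M" by fact
  next
    fix y assume "y \<in> carrier F.L"
    then obtain a b where y: "a \<in> carrier S" "b \<in> ?U" "y = F.frac a b" by (auto simp: F.carrier_L)
    then obtain r s where rs: "r \<in> carrier P" "s \<in> carrier P - M" "a = h r" "b = h s"
      unfolding U using surj by blast
    have "y \<otimes>\<^bsub>F.L\<^esub> F.frac (h s) \<one>\<^bsub>S\<^esub> = F.frac (h r) \<one>\<^bsub>S\<^esub>"
      using F.frac_mult_denom[OF y(1,2)] rs y by simp
    then show "\<exists>r\<in>carrier P. \<exists>s\<in>carrier P - M. y \<otimes>\<^bsub>F.L\<^esub> F.frac (h s) \<one>\<^bsub>S\<^esub> = F.frac (h r) \<one>\<^bsub>S\<^esub>"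
      using rs by blast
  next
    fix s assume "s \<in> carrier P - M"
    then show "F.frac (h s) \<one>\<^bsub>S\<^esub> \<in> Units F.L" using F.frac_unit[of "h s"] U by blast
  next
    fix r assume r: "r \<in> carrier P"
    have "F.frac (h r) \<one>\<^bsub>S\<^esub> = \<zero>\<^bsub>F.L\<^esub> \<longleftrightarrow> (\<exists>t\<in>?U. t \<otimes>\<^bsub>S\<^esub> h r = \<zero>\<^bsub>S\<^esub>)"
      using r by (intro F.frac_zero_iff) simp
    also have "\<dots> \<longleftrightarrow> (\<exists>t\<in>carrier P - M. h t \<otimes>\<^bsub>S\<^esub> h r = \<zero>\<^bsub>S\<^esub>)" unfolding U by blast
    also have "\<dots> \<longleftrightarrow> (\<exists>t\<in>carrier P - M. t \<otimes>\<^bsub>P\<^esub> r \<in> {r \<in> carrier P. h r = \<zero>\<^bsub>S\<^esub>})"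
      by (intro bex_cong) (use r in auto)
    finally show "F.frac (h r) \<one>\<^bsub>S\<^esub> = \<zero>\<^bsub>F.L\<^esub> \<longleftrightarrow>
        (\<exists>t\<in>carrier P - M. t \<otimes>\<^bsub>P\<^esub> r \<in> {r \<in> carrier P. h r = \<zero>\<^bsub>S\<^esub>})" .
  qed
  then show ?thesis unfolding localization_at_def loc_map_def .
qed

section \<open>Dimensions of cotangent spaces\<close>

lemma set_add_iff: "y \<in> A <+>\<^bsub>S\<^esub> B \<longleftrightarrow> (\<exists>a\<in>A. \<exists>b\<in>B. y = a \<oplus>\<^bsub>S\<^esub> b)"
  unfolding set_add_def' by blast

lemma vec_add_right_cancel:
  fixes a b c :: "'k::field vec"
  assumes "a \<in> carrier_vec n" "b \<in> carrier_vec n" "c \<in> carrier_vec n" "a + c = b + c"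
  shows "a = b"
proof
  fix i assume i: "i < dim_vec b"
  have "(a + c) $ i = (b + c) $ i" using assms(4) by simp
  then show "a $ i = b $ i" using i assms(1-3) by simp
qed (use assms in simp)

text \<open>The cosets of \<open>M\<^sup>2\<close> in \<open>M\<close> are the fibers \<open>E v\<close> of
  \<open>f\<close>, and \<open>E\<close> turns the operations of \<open>K\<^sup>n\<close> into those of the
  cotangent space.\<close>
lemma cot_dim_eq:
  fixes \<phi> :: "'k::field \<Rightarrow> 'a" and S :: "('a, 'b) ring_scheme" (structure) and f :: "'a \<Rightarrow> 'k vec"
  assumes S: "cring S" and M: "ideal M S" and \<phi>: "\<And>c. \<phi> c \<in> carrier S"
    and f_closed: "\<And>x. x \<in> M \<Longrightarrow> f x \<in> carrier_vec n"
    and f_add: "\<And>x y. x \<in> M \<Longrightarrow> y \<in> M \<Longrightarrow> f (x \<oplus> y) = f x + f y"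
    and f_smult: "\<And>c x. x \<in> M \<Longrightarrow> f (\<phi> c \<otimes> x) = c \<cdot>\<^sub>v f x"
    and f_surj: "\<And>v. v \<in> carrier_vec n \<Longrightarrow> \<exists>x\<in>M. f x = v"
    and f_ker: "\<And>x. x \<in> M \<Longrightarrow> f x = 0\<^sub>v n \<longleftrightarrow> x \<in> ideal_prod S M M"
  shows "cot_dim \<phi> S M = n"
proof -
  interpret S: cring S by fact
  note Mi = S.ideal_memD[OF M]
  define Q where "Q = ideal_prod S M M"
  define V where "V = cotangent_space \<phi> S M"
  define W where "W = module_vec TYPE('k) n"
  define E where "E v = {y \<in> M. f y = v}" for v
  have Qi: "ideal Q S" unfolding Q_def by (rule S.ideal_prod_is_ideal[OF M M])
  have QM: "Q \<subseteq> M" unfolding Q_def using S.ideal_prod_inter[OF M M] by blast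
  have f_diff: "f y = f (y \<ominus> x) + f x" if "x \<in> M" "y \<in> M" for x y
  proof -
    have "y = (y \<ominus> x) \<oplus> x" using Mi(1)[OF that(1)] Mi(1)[OF that(2)] by algebra
    then show ?thesis using f_add[OF Mi(3)[OF that(2,1)] that(1)] by simp
  qed
  have coset: "Q +> x = E (f x)" if x: "x \<in> M" for x
  proof
    show "Q +> x \<subseteq> E (f x)"
    proof
      fix y assume "y \<in> Q +> x"
      then obtain q where q: "q \<in> Q" "y = q \<oplus> x" by (auto simp: a_r_coset_def')
      have qM: "q \<in> M" using q QM by blast
      have "f q = 0\<^sub>v n" using f_ker[OF qM] q by (simp add: Q_def)
      then show "y \<in> E (f x)" using q f_add[OF qM x] f_closed[OF x] Mi(2)[OF qM x] by (simp add: E_def)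
    qed
    show "E (f x) \<subseteq> Q +> x"
    proof
      fix y assume "y \<in> E (f x)"
      then have y: "y \<in> M" "f y = f x" by (auto simp: E_def)
      have "f (y \<ominus> x) + f x = f x" using f_diff[OF x y(1)] y(2) by simp
      then have "f (y \<ominus> x) = 0\<^sub>v n" using f_closed[OF x] f_closed[OF Mi(3)[OF y(1) x]]
        by (intro vec_add_right_cancel[of _ n "0\<^sub>v n" "f x"]) auto
      then have "y \<ominus> x \<in> Q" using f_ker[OF Mi(3)[OF y(1) x]] by (simp add: Q_def)
      moreover have "y = (y \<ominus> x) \<oplus> x" using Mi(1)[OF x] Mi(1)[OF y(1)] by algebra
      ultimately show "y \<in> Q +> x" unfolding a_r_coset_def' by blast
    qed
  qed
  have carrier_V: "carrier V = E ` carrier_vec n"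
  proof -
    have "carrier V = (\<lambda>x. Q +> x) ` M" by (simp add: V_def cotangent_space_def Let_def Q_def)
    also have "\<dots> = (\<lambda>x. E (f x)) ` M" by (intro image_cong refl coset)
    also have "\<dots> = E ` (f ` M)" by (simp add: image_image)
    also have "f ` M = carrier_vec n" using f_closed f_surj by blast
    finally show ?thesis .
  qed
  have zero_V: "\<zero>\<^bsub>V\<^esub> = E (0\<^sub>v n)"
  proof -
    have "E (0\<^sub>v n) = Q" unfolding E_def using f_ker QM by (auto simp: Q_def)
    then show ?thesis by (simp add: V_def cotangent_space_def Let_def Q_def)
  qed
  have add_V: "E v \<oplus>\<^bsub>V\<^esub> E w = E (v + w)" if v: "v \<in> carrier_vec n" and w: "w \<in> carrier_vec n" for v w
  proof -
    have "E v <+>\<^bsub>S\<^esub> E w = E (v + w)"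
    proof
      show "E v <+>\<^bsub>S\<^esub> E w \<subseteq> E (v + w)" unfolding set_add_def' E_def using f_add Mi(2) by auto
      show "E (v + w) \<subseteq> E v <+>\<^bsub>S\<^esub> E w"
      proof
        fix y assume "y \<in> E (v + w)"
        then have y: "y \<in> M" "f y = v + w" by (auto simp: E_def)
        obtain x where x: "x \<in> M" "f x = w" using f_surj[OF w] by blast
        have "f (y \<ominus> x) + w = v + w" using f_diff[OF x(1) y(1)] x y by simp
        then have "f (y \<ominus> x) = v" using v w f_closed[OF Mi(3)[OF y(1) x(1)]]
          by (intro vec_add_right_cancel[of _ n v w]) auto
        moreover have "y = (y \<ominus> x) \<oplus> x" using Mi(1)[OF x(1)] Mi(1)[OF y(1)] by algebra
        ultimately show "y \<in> E v <+>\<^bsub>S\<^esub> E w"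
          unfolding set_add_iff E_def using Mi(3)[OF y(1) x(1)] x by blast
      qed
    qed
    then show ?thesis by (simp add: V_def cotangent_space_def Let_def)
  qed
  have smult_V: "c \<odot>\<^bsub>V\<^esub> E v = E (c \<cdot>\<^sub>v v)" if v: "v \<in> carrier_vec n" for c v
  proof -
    have "c \<odot>\<^bsub>V\<^esub> E v = (\<Union>x\<in>E v. Q +> (\<phi> c \<otimes> x))"
      by (simp add: V_def cotangent_space_def Let_def Q_def)
    also have "\<dots> = (\<Union>x\<in>E v. E (c \<cdot>\<^sub>v v))"
    proof (rule SUP_cong[OF refl])
      fix x assume "x \<in> E v"
      then show "Q +> (\<phi> c \<otimes> x) = E (c \<cdot>\<^sub>v v)"
        using coset[OF Mi(4)[OF _ \<phi>], of x c] f_smult[of x c] by (simp add: E_def)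
    qed
    also have "E v \<noteq> {}" using f_surj[OF v] by (auto simp: E_def)
    then have "(\<Union>x\<in>E v. E (c \<cdot>\<^sub>v v)) = E (c \<cdot>\<^sub>v v)" by simp
    finally show ?thesis .
  qed
  have E_inj: "v = w" if "v \<in> carrier_vec n" "E v = E w" for v w
    using f_surj[OF that(1)] that(2) by (auto simp: E_def)
  interpret vs: vec_space "TYPE('k)" n .
  have "vectorspace (class_ring :: 'k ring) V"
  proof (rule vs_criteria[OF class_field])
    show "\<forall>v\<in>carrier V. \<exists>neg_v\<in>carrier V. v \<oplus>\<^bsub>V\<^esub> neg_v = \<zero>\<^bsub>V\<^esub>"
    proof
      fix X assume "X \<in> carrier V"
      then obtain v where v: "v \<in> carrier_vec n" "X = E v" by (auto simp: carrier_V)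
      then show "\<exists>Y\<in>carrier V. X \<oplus>\<^bsub>V\<^esub> Y = \<zero>\<^bsub>V\<^esub>"
        by (intro bexI[of _ "E (- v)"]) (auto simp: carrier_V add_V zero_V)
    qed
  qed (auto simp: carrier_V zero_V add_V smult_V comm_add_vec smult_smult_assoc[symmetric]
        add_smult_distrib_vec smult_add_distrib_vec intro!: imageI)
  then interpret V: vectorspace "class_ring :: 'k ring" V .
  have "linear_map class_ring (module_vec TYPE('k) n) V E"
  proof (intro linear_map.intro mod_hom.intro mod_hom_axioms.intro)
    show "vectorspace class_ring (module_vec TYPE('k) n)" by (rule vs.vectorspace_axioms)
    show "E \<in> module_hom class_ring (module_vec TYPE('k) n) V"
      unfolding module_hom_def by (auto simp: module_vec_simps carrier_V add_V smult_V)
  qed (use V.vectorspace_axioms V.module_axioms vs.module_axioms in auto)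
  then interpret lin: linear_map class_ring "module_vec TYPE('k) n" V E .
  have "vectorspace.dim class_ring (module_vec TYPE('k) n) = vectorspace.dim class_ring V"
    by (rule lin.dim_eq) (auto simp: module_vec_simps carrier_V inj_on_def E_inj)
  then show ?thesis using vs.dim_is_n unfolding cot_dim_def V_def by simp
qed

text \<open>The coordinates \<open>f\<close> on \<open>M\<close> are carried over to \<open>N\<close> along
  the map \<open>M \<rightarrow> N/N\<^sup>2\<close> induced by \<open>g\<close>: \<open>approx\<close> says
  that this map is onto, and \<open>f_ker\<close> that it has the same kernel as \<open>f\<close>.\<close>
lemma cot_dim_hom:
  fixes \<phi> :: "'k::field \<Rightarrow> 'a" and f :: "'a \<Rightarrow> 'k vec" and S (structure)
  assumes P: "cring P" and S: "cring S" and g: "g \<in> Ring.ring_hom P S"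
    and M: "ideal M P" and N: "ideal N S" and \<phi>: "\<And>c. \<phi> c \<in> carrier P"
    and f_closed: "\<And>x. x \<in> M \<Longrightarrow> f x \<in> carrier_vec n"
    and f_add: "\<And>x y. x \<in> M \<Longrightarrow> y \<in> M \<Longrightarrow> f (x \<oplus>\<^bsub>P\<^esub> y) = f x + f y"
    and f_smult: "\<And>c x. x \<in> M \<Longrightarrow> f (\<phi> c \<otimes>\<^bsub>P\<^esub> x) = c \<cdot>\<^sub>v f x"
    and f_surj: "\<And>v. v \<in> carrier_vec n \<Longrightarrow> \<exists>x\<in>M. f x = v"
    and f_ker: "\<And>x. x \<in> M \<Longrightarrow> f x = 0\<^sub>v n \<longleftrightarrow> g x \<in> ideal_prod S N N"
    and gM: "\<And>x. x \<in> M \<Longrightarrow> g x \<in> N"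
    and approx: "\<And>y. y \<in> N \<Longrightarrow> \<exists>x\<in>M. y \<ominus> g x \<in> ideal_prod S N N"
  shows "cot_dim (\<lambda>c. g (\<phi> c)) S N = n"
proof -
  interpret P: cring P by fact
  interpret S: cring S by fact
  interpret g: ring_hom_cring P S g by unfold_locales (rule g)
  note Mi = P.ideal_memD[OF M] and Ni = S.ideal_memD[OF N]
  define Q where "Q = ideal_prod S N N"
  have Qid: "ideal Q S" unfolding Q_def by (rule S.ideal_prod_is_ideal[OF N N])
  note Qi = S.ideal_memD[OF Qid]
  define F where "F y = f (SOME x. x \<in> M \<and> y \<ominus> g x \<in> Q)" for y
  have f_eq: "f x = f x'" if x: "x \<in> M" "x' \<in> M" "g x \<ominus> g x' \<in> Q" for x x'
  proof -
    have c: "x \<in> carrier P" "x' \<in> carrier P" using Mi(1) x by auto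
    have "g (x \<ominus>\<^bsub>P\<^esub> x') \<in> Q" using x(3) c by (simp add: a_minus_def)
    then have "f (x \<ominus>\<^bsub>P\<^esub> x') = 0\<^sub>v n" using f_ker[OF Mi(3)[OF x(1,2)]] by (simp add: Q_def)
    moreover have "x = (x \<ominus>\<^bsub>P\<^esub> x') \<oplus>\<^bsub>P\<^esub> x'" using c by algebra
    ultimately show ?thesis using f_add[OF Mi(3)[OF x(1,2)] x(2)] f_closed[OF x(2)] by simp
  qed
  have F: "F y = f x" if y: "y \<in> N" and x: "x \<in> M" "y \<ominus> g x \<in> Q" for x y
  proof -
    define x' where "x' = (SOME x. x \<in> M \<and> y \<ominus> g x \<in> Q)"
    have x': "x' \<in> M" "y \<ominus> g x' \<in> Q"
      using someI[of "\<lambda>x. x \<in> M \<and> y \<ominus> g x \<in> Q", OF conjI[OF x]] by (auto simp: x'_def)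
    have c: "y \<in> carrier S" "g x \<in> carrier S" "g x' \<in> carrier S" using Ni(1) y gM x x' by auto
    have "(y \<ominus> g x') \<ominus> (y \<ominus> g x) \<in> Q" by (rule Qi(3)[OF x'(2) x(2)])
    moreover have "(y \<ominus> g x') \<ominus> (y \<ominus> g x) = g x \<ominus> g x'" using c by algebra
    ultimately have "f x = f x'" using f_eq[OF x(1) x'(1)] by simp
    then show ?thesis by (simp add: F_def x'_def)
  qed
  have app: "\<exists>x\<in>M. y \<ominus> g x \<in> Q \<and> F y = f x" if "y \<in> N" for y
    using approx[OF that] F[OF that] by (auto simp: Q_def)
  have Fg: "F (g x) = f x" if x: "x \<in> M" for x
    using F[OF gM[OF x] x] Qi(6) Mi(1)[OF x] by (simp add: a_minus_def S.r_neg)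
  show ?thesis
  proof (rule cot_dim_eq[OF S N, where f = F])
    show "g (\<phi> c) \<in> carrier S" for c by (simp add: \<phi>)
    show "F y \<in> carrier_vec n" if "y \<in> N" for y using app[OF that] f_closed by auto
    show "F (y \<oplus> z) = F y + F z" if yz: "y \<in> N" "z \<in> N" for y z
    proof -
      obtain x where x: "x \<in> M" "y \<ominus> g x \<in> Q" "F y = f x" using app[OF yz(1)] by blast
      obtain x' where x': "x' \<in> M" "z \<ominus> g x' \<in> Q" "F z = f x'" using app[OF yz(2)] by blast
      have c: "y \<in> carrier S" "z \<in> carrier S" "g x \<in> carrier S" "g x' \<in> carrier S"
        using Ni(1) yz gM x x' by auto
      have "(y \<ominus> g x) \<oplus> (z \<ominus> g x') = (y \<oplus> z) \<ominus> (g x \<oplus> g x')" using c by algebra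
      also have "\<dots> = (y \<oplus> z) \<ominus> g (x \<oplus>\<^bsub>P\<^esub> x')" using Mi(1) x x' by simp
      finally have "(y \<oplus> z) \<ominus> g (x \<oplus>\<^bsub>P\<^esub> x') \<in> Q" using Qi(2)[OF x(2) x'(2)] by simp
      then have "F (y \<oplus> z) = f (x \<oplus>\<^bsub>P\<^esub> x')" by (rule F[OF Ni(2)[OF yz] Mi(2)[OF x(1) x'(1)]])
      then show ?thesis using f_add[OF x(1) x'(1)] x x' by simp
    qed
    show "F (g (\<phi> c) \<otimes> y) = c \<cdot>\<^sub>v F y" if y: "y \<in> N" for c y
    proof -
      obtain x where x: "x \<in> M" "y \<ominus> g x \<in> Q" "F y = f x" using app[OF y] by blast
      have c: "y \<in> carrier S" "g x \<in> carrier S" "g (\<phi> c) \<in> carrier S" using Ni(1) y gM x \<phi> by auto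
      have "g (\<phi> c) \<otimes> (y \<ominus> g x) = g (\<phi> c) \<otimes> y \<ominus> g (\<phi> c) \<otimes> g x" using c by algebra
      also have "\<dots> = g (\<phi> c) \<otimes> y \<ominus> g (\<phi> c \<otimes>\<^bsub>P\<^esub> x)" using Mi(1) x \<phi> by simp
      finally have "g (\<phi> c) \<otimes> y \<ominus> g (\<phi> c \<otimes>\<^bsub>P\<^esub> x) \<in> Q" using Qi(4)[OF x(2) c(3)] by simp
      then have "F (g (\<phi> c) \<otimes> y) = f (\<phi> c \<otimes>\<^bsub>P\<^esub> x)" by (rule F[OF Ni(4)[OF y c(3)] Mi(4)[OF x(1) \<phi>]])
      then show ?thesis using f_smult[OF x(1)] x by simp
    qed
    show "\<exists>y\<in>N. F y = v" if v: "v \<in> carrier_vec n" for v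
    proof -
      obtain x where "x \<in> M" "f x = v" using f_surj[OF v] by blast
      then show ?thesis using Fg gM by (intro bexI[of _ "g x"]) auto
    qed
    show "F y = 0\<^sub>v n \<longleftrightarrow> y \<in> ideal_prod S N N" if y: "y \<in> N" for y
    proof -
      obtain x where x: "x \<in> M" "y \<ominus> g x \<in> Q" "F y = f x" using app[OF y] by blast
      have c: "y \<in> carrier S" "g x \<in> carrier S" using Ni(1) y gM x by auto
      have "F y = 0\<^sub>v n \<longleftrightarrow> g x \<in> Q" using f_ker[OF x(1)] x(3) by (simp add: Q_def)
      also have "\<dots> \<longleftrightarrow> y \<in> Q"
      proof
        assume "g x \<in> Q"
        then have "(y \<ominus> g x) \<oplus> g x \<in> Q" using Qi(2) x(2) by blast
        moreover have "(y \<ominus> g x) \<oplus> g x = y" using c by algebra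
        ultimately show "y \<in> Q" by simp
      next
        assume "y \<in> Q"
        then have "y \<ominus> (y \<ominus> g x) \<in> Q" using Qi(3) x(2) by blast
        moreover have "y \<ominus> (y \<ominus> g x) = g x" using c by algebra
        ultimately show "g x \<in> Q" by simp
      qed
      finally show ?thesis by (simp add: Q_def)
    qed
  qed
qed

lemma hom_ideal_prod:
  assumes g: "g \<in> Ring.ring_hom P S" and P: "cring P" and M: "ideal M P"
    and gM: "\<And>x. x \<in> M \<Longrightarrow> g x \<in> N" and u: "u \<in> ideal_prod P M M"
  shows "g u \<in> ideal_prod S N N"
proof -
  interpret P: cring P by fact
  note Mi = P.ideal_memD[OF M]
  have "ideal_prod P M M \<subseteq> M" using P.ideal_prod_inter[OF M M] by blast
  then have c: "v \<in> carrier P" if "v \<in> ideal_prod P M M" for v using that Mi(1) by blast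
  show ?thesis using u
  proof (induction rule: ideal_prod.induct)
    case (prod i j)
    then show ?case using Mi(1) ring_hom_rules(2)[OF g] by (auto intro: ideal_prod.prod gM)
  next
    case (sum s t)
    then show ?case using c ring_hom_rules(3)[OF g, of s t] by (auto intro: ideal_prod.sum)
  qed
qed

lemma surjective_image_ideal:
  fixes S (structure)
  assumes P: "cring P" and S: "cring S" and h: "h \<in> Ring.ring_hom P S" and surj: "h ` carrier P = carrier S"
    and M: "ideal M P"
  shows "ideal (h ` M) S"
proof -
  interpret P: cring P by fact
  interpret S: cring S by fact
  interpret h: ring_hom_cring P S h by unfold_locales (rule h)
  note Mi = P.ideal_memD[OF M]
  show ?thesis
  proof (rule S.ideal_criterion)
    show "h ` M \<subseteq> carrier S" using Mi(1) by auto
    show "\<zero> \<in> h ` M" using Mi(6) h.hom_zero by (metis imageI)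
    fix a assume "a \<in> h ` M"
    then obtain x where x: "x \<in> M" "a = h x" by blast
    {
      fix b assume "b \<in> h ` M"
      then obtain y where y: "y \<in> M" "b = h y" by blast
      have "a \<oplus> b = h (x \<oplus>\<^bsub>P\<^esub> y)" using x y Mi(1) by simp
      then show "a \<oplus> b \<in> h ` M" using Mi(2) x y by blast
    next
      fix b assume "b \<in> carrier S"
      then obtain y where y: "y \<in> carrier P" "b = h y" using surj by blast
      have "b \<otimes> a = h (y \<otimes>\<^bsub>P\<^esub> x)" using x y Mi(1) by simp
      then show "b \<otimes> a \<in> h ` M" using Mi(4) x y by blast
    }
  qed
qed

lemma cot_dim_surjection:
  fixes \<phi> :: "'k::field \<Rightarrow> 'a" and f :: "'a \<Rightarrow> 'k vec" and S (structure)
  assumes P: "cring P" and S: "cring S" and h: "h \<in> Ring.ring_hom P S" and surj: "h ` carrier P = carrier S"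
    and M: "ideal M P" and \<phi>: "\<And>c. \<phi> c \<in> carrier P"
    and f_closed: "\<And>x. x \<in> M \<Longrightarrow> f x \<in> carrier_vec n"
    and f_add: "\<And>x y. x \<in> M \<Longrightarrow> y \<in> M \<Longrightarrow> f (x \<oplus>\<^bsub>P\<^esub> y) = f x + f y"
    and f_smult: "\<And>c x. x \<in> M \<Longrightarrow> f (\<phi> c \<otimes>\<^bsub>P\<^esub> x) = c \<cdot>\<^sub>v f x"
    and f_surj: "\<And>v. v \<in> carrier_vec n \<Longrightarrow> \<exists>x\<in>M. f x = v"
    and f_ker: "\<And>x. x \<in> M \<Longrightarrow> f x = 0\<^sub>v n \<longleftrightarrow> x \<in> ideal_prod P M M <+>\<^bsub>P\<^esub> {r \<in> carrier P. h r = \<zero>}"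
  shows "cot_dim (\<lambda>c. h (\<phi> c)) S (h ` M) = n"
proof -
  interpret P: cring P by fact
  interpret S: cring S by fact
  interpret h: ring_hom_cring P S h by unfold_locales (rule h)
  note Mi = P.ideal_memD[OF M]
  have MM: "ideal_prod P M M \<subseteq> M" using P.ideal_prod_inter[OF M M] by blast
  have N: "ideal (h ` M) S" by (rule surjective_image_ideal[OF P S h surj M])
  have lift: "\<exists>u\<in>ideal_prod P M M. h u = z" if "z \<in> ideal_prod S (h ` M) (h ` M)" for z
    using that
  proof (induction rule: ideal_prod.induct)
    case (prod i j)
    then obtain x y where xy: "x \<in> M" "y \<in> M" "i = h x" "j = h y" by blast
    then show ?case using Mi(1) by (intro bexI[of _ "x \<otimes>\<^bsub>P\<^esub> y"] ideal_prod.prod) auto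
  next
    case (sum s t)
    then obtain u v where "u \<in> ideal_prod P M M" "v \<in> ideal_prod P M M" "s = h u" "t = h v" by blast
    moreover from this have "u \<in> carrier P" "v \<in> carrier P" using Mi(1) MM by blast+
    ultimately show ?case by (intro bexI[of _ "u \<oplus>\<^bsub>P\<^esub> v"] ideal_prod.sum) simp_all
  qed
  show ?thesis
  proof (rule cot_dim_hom[OF P S h M N \<phi> f_closed f_add f_smult f_surj])
    show "h x \<in> h ` M" if "x \<in> M" for x using that by simp
    show "\<exists>x\<in>M. y \<ominus> h x \<in> ideal_prod S (h ` M) (h ` M)" if y: "y \<in> h ` M" for y
    proof -
      obtain x where x: "x \<in> M" "y = h x" using y by blast
      have "y \<ominus> h x = \<zero>" using x Mi(1) by (simp add: a_minus_def S.r_neg)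
      then show ?thesis using x(1) S.ideal_memD(6)[OF S.ideal_prod_is_ideal[OF N N]] by metis
    qed
    show "f x = 0\<^sub>v n \<longleftrightarrow> h x \<in> ideal_prod S (h ` M) (h ` M)" if x: "x \<in> M" for x
      unfolding f_ker[OF x]
    proof
      assume "x \<in> ideal_prod P M M <+>\<^bsub>P\<^esub> {r \<in> carrier P. h r = \<zero>}"
      then obtain u j where u: "u \<in> ideal_prod P M M" "j \<in> carrier P" "h j = \<zero>" "x = u \<oplus>\<^bsub>P\<^esub> j"
        unfolding set_add_iff by blast
      then have "h x = h u" using MM Mi(1) by (simp add: subset_iff)
      then show "h x \<in> ideal_prod S (h ` M) (h ` M)" using hom_ideal_prod[OF h P M _ u(1), of "h ` M"] by simp
    next
      assume "h x \<in> ideal_prod S (h ` M) (h ` M)"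
      then obtain u where u: "u \<in> ideal_prod P M M" "h u = h x" using lift by blast
      have c: "u \<in> carrier P" "x \<in> carrier P" using u x MM Mi(1) by auto
      have "h (x \<ominus>\<^bsub>P\<^esub> u) = \<zero>" using u c by (simp add: a_minus_def S.r_neg)
      moreover have "x = u \<oplus>\<^bsub>P\<^esub> (x \<ominus>\<^bsub>P\<^esub> u)" using c by algebra
      ultimately show "x \<in> ideal_prod P M M <+>\<^bsub>P\<^esub> {r \<in> carrier P. h r = \<zero>}"
        unfolding set_add_iff using u c P.minus_closed by blast
    qed
  qed
qed

text \<open>The cotangent space of \<open>L\<close> is \<open>M\<close> modulo \<open>M\<^sup>2 + J\<close>.
  A denominator \<open>s \<notin> M\<close> is congruent modulo \<open>M\<close> to a nonzero scalar
  \<open>c\<close>; so the fraction of \<open>r\<close> by \<open>s\<close> agrees modulo the square of the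
  maximal ideal with the image of \<open>c\<^sup>-\<^sup>1 r\<close>, and a factor \<open>s\<close> can be
  cancelled modulo \<open>M\<^sup>2 + J\<close>.\<close>
lemma (in localization_model) cot_dim_max_ideal:
  fixes \<phi> :: "'k::field \<Rightarrow> 'a" and f :: "'a \<Rightarrow> 'k vec"
  assumes \<phi>: "\<And>c. \<phi> c \<in> carrier R" and \<phi>_zero: "\<phi> 0 = \<zero>" and \<phi>_one: "\<phi> 1 = \<one>"
    and \<phi>_mult: "\<And>c d. \<phi> (c * d) = \<phi> c \<otimes> \<phi> d"
    and residue: "\<And>r. r \<in> carrier R \<Longrightarrow> \<exists>c. r \<ominus> \<phi> c \<in> M"
    and f_closed: "\<And>x. x \<in> M \<Longrightarrow> f x \<in> carrier_vec n"
    and f_add: "\<And>x y. x \<in> M \<Longrightarrow> y \<in> M \<Longrightarrow> f (x \<oplus> y) = f x + f y"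
    and f_smult: "\<And>c x. x \<in> M \<Longrightarrow> f (\<phi> c \<otimes> x) = c \<cdot>\<^sub>v f x"
    and f_surj: "\<And>v. v \<in> carrier_vec n \<Longrightarrow> \<exists>x\<in>M. f x = v"
    and f_ker: "\<And>x. x \<in> M \<Longrightarrow> f x = 0\<^sub>v n \<longleftrightarrow> x \<in> ideal_prod R M M <+>\<^bsub>R\<^esub> J"
  shows "cot_dim (\<lambda>c. g (\<phi> c)) L (max_ideal L) = n"
proof -
  define N where "N = extension M"
  define T where "T = ideal_prod R M M <+>\<^bsub>R\<^esub> J"
  note Mid = primeD(1)[OF M]
  have MMid: "ideal (ideal_prod R M M) R" by (rule ideal_prod_is_ideal[OF Mid Mid])
  have Tid: "ideal T R" unfolding T_def by (rule add_ideals[OF MMid J])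
  note MMi = ideal_memD[OF MMid] and Ti = ideal_memD[OF Tid]
  have MM: "ideal_prod R M M \<subseteq> M" using ideal_prod_inter[OF Mid Mid] by blast
  have MMT: "ideal_prod R M M \<subseteq> T"
  proof
    fix u assume u: "u \<in> ideal_prod R M M"
    then have "u = u \<oplus> \<zero>" using MMi(1) by simp
    then show "u \<in> T" unfolding T_def set_add_iff using u Ji(6) by blast
  qed
  have JT: "J \<subseteq> T"
  proof
    fix u assume u: "u \<in> J"
    then have "u = \<zero> \<oplus> u" using Ji(1) by simp
    then show "u \<in> T" unfolding T_def set_add_iff using u MMi(6) by blast
  qed
  have Nid: "ideal N L" unfolding N_def by (rule extension_ideal[OF Mid])
  have NNid: "ideal (ideal_prod L N N) L" by (rule L.ideal_prod_is_ideal[OF Nid Nid])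
  have gM: "g x \<in> N" if "x \<in> M" for x unfolding N_def by (rule extension_gI[OF that Mi(1)[OF that]])
  have gMM: "g u \<in> ideal_prod L N N" if "u \<in> ideal_prod R M M" for u
    by (rule hom_ideal_prod[OF g is_cring Mid gM that])
  have res: "\<exists>c. c \<noteq> 0 \<and> s \<ominus> \<phi> c \<in> M" if s: "s \<in> carrier R" "s \<notin> M" for s
  proof -
    obtain c where c: "s \<ominus> \<phi> c \<in> M" using residue[OF s(1)] by blast
    have "c \<noteq> 0"
    proof
      assume "c = 0"
      then have "s \<in> M" using c s(1) \<phi>_zero by (simp add: a_minus_def)
      then show False using s(2) by simp
    qed
    then show ?thesis using c by blast
  qed
  have inv: "\<phi> (inverse c) \<otimes> \<phi> c = \<one>" if "c \<noteq> 0" for c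
    using \<phi>_mult[of "inverse c" c] \<phi>_one that by simp
  have NT: "ideal_prod L N N \<subseteq> extension T"
  proof (rule L.ideal_prod_least[OF extension_ideal[OF Tid]])
    fix y z assume "y \<in> N" "z \<in> N"
    then obtain r s r' s' where yz: "y \<in> carrier L" "r \<in> M" "s \<in> carrier R - M" "y \<otimes>\<^bsub>L\<^esub> g s = g r"
      "z \<in> carrier L" "r' \<in> M" "s' \<in> carrier R - M" "z \<otimes>\<^bsub>L\<^esub> g s' = g r'"
      by (auto simp: N_def extension_def)
    have carr: "y \<in> carrier L" "z \<in> carrier L" "g s \<in> carrier L" "g s' \<in> carrier L" "r \<in> carrier R" "r' \<in> carrier R"
      using yz Mi(1) by auto
    have "(y \<otimes>\<^bsub>L\<^esub> z) \<otimes>\<^bsub>L\<^esub> (g s \<otimes>\<^bsub>L\<^esub> g s') = (y \<otimes>\<^bsub>L\<^esub> g s) \<otimes>\<^bsub>L\<^esub> (z \<otimes>\<^bsub>L\<^esub> g s')"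
      using carr by algebra
    then have "(y \<otimes>\<^bsub>L\<^esub> z) \<otimes>\<^bsub>L\<^esub> g (s \<otimes> s') = g (r \<otimes> r')" using yz carr by simp
    moreover have "r \<otimes> r' \<in> T" using MMT ideal_prod.prod[OF yz(2,6)] by blast
    moreover have "s \<otimes> s' \<in> carrier R - M" using primeD(3)[OF M] yz by simp
    ultimately show "y \<otimes>\<^bsub>L\<^esub> z \<in> extension T" using carr by (intro extension_memI) auto
  qed
  show ?thesis unfolding max_ideal_eq N_def[symmetric]
  proof (rule cot_dim_hom[OF is_cring L.is_cring g Mid Nid \<phi> f_closed f_add f_smult f_surj])
    show "g x \<in> N" if "x \<in> M" for x by (rule gM[OF that])
    show "\<exists>x\<in>M. y \<ominus>\<^bsub>L\<^esub> g x \<in> ideal_prod L N N" if y: "y \<in> N" for y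
    proof -
      obtain r s where rs: "y \<in> carrier L" "r \<in> M" "s \<in> carrier R" "s \<notin> M" "y \<otimes>\<^bsub>L\<^esub> g s = g r"
        using y by (auto simp: N_def extension_def)
      obtain c where c: "c \<noteq> 0" "s \<ominus> \<phi> c \<in> M" using res[OF rs(3,4)] by blast
      define d where "d = \<phi> (inverse c)"
      have d: "d \<in> carrier R" "d \<otimes> \<phi> c = \<one>" using inv[OF c(1)] \<phi> by (auto simp: d_def)
      define x where "x = d \<otimes> r"
      have rc: "r \<in> carrier R" using Mi(1) rs(2) .
      have x: "x \<in> M" "x \<in> carrier R" using Mi(4)[OF rs(2) d(1)] Mi(1) by (auto simp: x_def)
      have "s \<otimes> x \<ominus> r = s \<otimes> x \<ominus> (d \<otimes> \<phi> c) \<otimes> r" using d(2) rc by simp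
      also have "\<dots> = (s \<ominus> \<phi> c) \<otimes> x" unfolding x_def using rs(3) rc d(1) \<phi>[of c] by algebra
      also have "\<dots> \<in> ideal_prod R M M" using c(2) x(1) by (rule ideal_prod.prod)
      finally have "g (s \<otimes> x \<ominus> r) \<in> ideal_prod L N N" by (rule gMM)
      then have 1: "g s \<otimes>\<^bsub>L\<^esub> g x \<ominus>\<^bsub>L\<^esub> y \<otimes>\<^bsub>L\<^esub> g s \<in> ideal_prod L N N" using rs(3,5) x(2) rc by (simp add: a_minus_def)
      have "(\<ominus>\<^bsub>L\<^esub> \<one>\<^bsub>L\<^esub>) \<otimes>\<^bsub>L\<^esub> (g s \<otimes>\<^bsub>L\<^esub> g x \<ominus>\<^bsub>L\<^esub> y \<otimes>\<^bsub>L\<^esub> g s) \<in> ideal_prod L N N"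
        by (rule L.ideal_memD(4)[OF NNid 1]) simp
      moreover have "(\<ominus>\<^bsub>L\<^esub> \<one>\<^bsub>L\<^esub>) \<otimes>\<^bsub>L\<^esub> (g s \<otimes>\<^bsub>L\<^esub> g x \<ominus>\<^bsub>L\<^esub> y \<otimes>\<^bsub>L\<^esub> g s) = (y \<ominus>\<^bsub>L\<^esub> g x) \<otimes>\<^bsub>L\<^esub> g s"
        using rs(1) g.hom_closed[OF rs(3)] g.hom_closed[OF x(2)] by algebra
      ultimately have "(y \<ominus>\<^bsub>L\<^esub> g x) \<otimes>\<^bsub>L\<^esub> g s \<in> ideal_prod L N N" by simp
      then have "y \<ominus>\<^bsub>L\<^esub> g x \<in> ideal_prod L N N"
        using unit_cancel[OF NNid _ unit] rs x(2) by simp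
      then show ?thesis using x(1) by blast
    qed
    show "f x = 0\<^sub>v n \<longleftrightarrow> g x \<in> ideal_prod L N N" if x: "x \<in> M" for x
      unfolding f_ker[OF x] T_def[symmetric]
    proof
      assume "x \<in> T"
      then obtain u j where u: "u \<in> ideal_prod R M M" "j \<in> J" "x = u \<oplus> j" unfolding T_def set_add_iff by blast
      then have "g x = g u" using MMi(1) Ji(1) ker_J by simp
      then show "g x \<in> ideal_prod L N N" using gMM[OF u(1)] by simp
    next
      assume "g x \<in> ideal_prod L N N"
      then have "g x \<in> extension T" using NT by blast
      then obtain s where s: "s \<in> carrier R" "s \<notin> M" "s \<otimes> x \<in> T"
        using extension_gD[OF Tid JT Mi(1)[OF x]] by blast
      obtain c where c: "c \<noteq> 0" "s \<ominus> \<phi> c \<in> M" using res[OF s(1,2)] by blast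
      have xc: "x \<in> carrier R" using Mi(1) x .
      have "(s \<ominus> \<phi> c) \<otimes> x \<in> T" using MMT ideal_prod.prod[OF c(2) x] by blast
      then have "s \<otimes> x \<ominus> (s \<ominus> \<phi> c) \<otimes> x \<in> T" using Ti(3) s(3) by blast
      moreover have "s \<otimes> x \<ominus> (s \<ominus> \<phi> c) \<otimes> x = \<phi> c \<otimes> x" using xc s(1) \<phi>[of c] by algebra
      ultimately have "\<phi> (inverse c) \<otimes> (\<phi> c \<otimes> x) \<in> T" using Ti(4) \<phi> by simp
      moreover have "\<phi> (inverse c) \<otimes> (\<phi> c \<otimes> x) = x" using inv[OF c(1)] \<phi> xc by (simp add: m_assoc[symmetric])
      ultimately show "x \<in> T" by simp
    qed
  qed
qed

section \<open>Evaluation and specialization\<close>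

lemma additive_sum:
  fixes F :: "'b::comm_monoid_add \<Rightarrow> 'c::comm_monoid_add"
  assumes "F 0 = 0" "\<And>x y. F (x + y) = F x + F y"
  shows "F (sum f X) = (\<Sum>x\<in>X. F (f x))"
  by (induction X rule: infinite_finite_induct) (simp_all add: assms)

lemma additive_eq:
  fixes F G :: "'a::comm_ring_1 mpoly \<Rightarrow> 'c::comm_monoid_add"
  assumes "F 0 = 0" "\<And>x y. F (x + y) = F x + F y" and "G 0 = 0" "\<And>x y. G (x + y) = G x + G y"
    and "\<And>t c. F (single t c) = G (single t c)"
  shows "F p = G p"
proof -
  have "F (\<Sum>t\<in>keys p. single t (lookup p t)) = G (\<Sum>t\<in>keys p. single t (lookup p t))"
    using assms by (simp add: additive_sum)
  then show ?thesis using mpoly_eq_sum_single[of p] by simp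
qed

text \<open>Used to check multiplicativity of maps between polynomial rings on pairs of monomials.\<close>
lemma biadditive_eq:
  fixes F G :: "'a::comm_ring_1 mpoly \<Rightarrow> 'a mpoly \<Rightarrow> 'c::ab_group_add"
  assumes F: "\<And>x y q. F (x + y) q = F x q + F y q" "\<And>x y p. F p (x + y) = F p x + F p y"
    and G: "\<And>x y q. G (x + y) q = G x q + G y q" "\<And>x y p. G p (x + y) = G p x + G p y"
    and single: "\<And>s a t b. F (single s a) (single t b) = G (single s a) (single t b)"
  shows "F p q = G p q"
proof -
  have z: "F 0 q = 0" "F p 0 = 0" "G 0 q = 0" "G p 0 = 0" for p q
    using F(1)[of 0 0 q] F(2)[of p 0 0] G(1)[of 0 0 q] G(2)[of p 0 0] by simp_all
  have 1: "F (single s a) q = G (single s a) q" for s a q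
    by (rule additive_eq[of "F (single s a)" "G (single s a)"]) (simp_all add: z F G single)
  show ?thesis by (rule additive_eq[of "\<lambda>p. F p q" "\<lambda>p. G p q"]) (simp_all add: z F G 1)
qed

definition monomial_at :: "(nat \<Rightarrow> 'a::comm_ring_1) \<Rightarrow> (nat \<Rightarrow>\<^sub>0 nat) \<Rightarrow> 'a" where
  "monomial_at \<gamma> t = (\<Prod>i\<in>keys t. \<gamma> i ^ lookup t i)"

lemma monomial_at_superset:
  assumes "finite X" "keys t \<subseteq> X" shows "monomial_at \<gamma> t = (\<Prod>i\<in>X. \<gamma> i ^ lookup t i)"
  unfolding monomial_at_def
  by (rule prod.mono_neutral_left) (use assms in \<open>auto simp: in_keys_iff\<close>)

lemma monomial_at_add: "monomial_at \<gamma> (s + t) = monomial_at \<gamma> s * monomial_at \<gamma> t"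
proof -
  have "keys (s + t) \<subseteq> keys s \<union> keys t" by (rule keys_add)
  then show ?thesis
    by (simp add: monomial_at_superset[of "keys s \<union> keys t"] lookup_add power_add prod.distrib)
qed

lemma eval_at_superset:
  assumes "finite X" "keys f \<subseteq> X"
  shows "eval_at \<gamma> f = (\<Sum>t\<in>X. lookup f t * monomial_at \<gamma> t)"
  unfolding eval_at_def monomial_at_def[symmetric]
  by (rule sum.mono_neutral_left) (use assms in \<open>auto simp: in_keys_iff\<close>)

lemma eval_at_zero: "eval_at \<gamma> 0 = 0" by (simp add: eval_at_def)

lemma eval_at_add: "eval_at \<gamma> (f + g) = eval_at \<gamma> f + eval_at \<gamma> g"
proof -
  have "keys (f + g) \<subseteq> keys f \<union> keys g" by (rule keys_add)
  then show ?thesis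
    by (simp add: eval_at_superset[of "keys f \<union> keys g"] lookup_add distrib_right sum.distrib)
qed

lemma eval_at_single: "eval_at \<gamma> (single t c) = c * monomial_at \<gamma> t"
  by (simp add: eval_at_superset[of "{t}"])

lemma eval_at_mult: "eval_at \<gamma> (f * g) = eval_at \<gamma> f * eval_at \<gamma> g"
  by (rule biadditive_eq[of "\<lambda>f g. eval_at \<gamma> (f * g)" "\<lambda>f g. eval_at \<gamma> f * eval_at \<gamma> g"])
    (simp_all add: algebra_simps eval_at_add mult_single eval_at_single monomial_at_add)

lemma eval_at_const: "eval_at \<gamma> (const c) = c"
  by (simp add: const_def eval_at_single monomial_at_def)

lemma eval_at_var: "eval_at \<gamma> (var i) = \<gamma> i"
  by (simp add: var_def eval_at_single monomial_at_def)

lemma eval_at_one: "eval_at \<gamma> 1 = 1"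
  using eval_at_const[of \<gamma> 1] by (simp add: const_one)

lemma eval_at_uminus: "eval_at \<gamma> (- f) = - eval_at \<gamma> f"
  using eval_at_add[of \<gamma> f "- f"] by (simp add: eval_at_zero eq_neg_iff_add_eq_0 add.commute)

lemma eval_at_diff: "eval_at \<gamma> (f - g) = eval_at \<gamma> f - eval_at \<gamma> g"
  using eval_at_add[of \<gamma> f "- g"] by (simp add: eval_at_uminus)

abbreviation pmap where "pmap \<equiv> Poly_Mapping.map"

lemma lookup_pmap: "h 0 = 0 \<Longrightarrow> lookup (pmap h p) t = h (lookup p t)"
  by (simp add: Poly_Mapping.map.rep_eq when_def)

lemma pmap_zero: "h 0 = 0 \<Longrightarrow> pmap h 0 = 0"
  by (rule poly_mapping_eqI) (simp add: lookup_pmap)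

lemma pmap_add:
  assumes "h 0 = 0" "\<And>a b. h (a + b) = h a + h b" shows "pmap h (p + q) = pmap h p + pmap h q"
  by (rule poly_mapping_eqI) (simp add: lookup_pmap assms lookup_add)

lemma pmap_single: "h 0 = 0 \<Longrightarrow> pmap h (single t c) = single t (h c)"
  by (rule poly_mapping_eqI) (simp add: lookup_pmap lookup_single when_def)

lemma pmap_mult:
  fixes h :: "'a::comm_ring_1 \<Rightarrow> 'b::comm_ring_1" and p q :: "'a mpoly"
  assumes h: "h 0 = 0" "\<And>a b. h (a + b) = h a + h b" "\<And>a b. h (a * b) = h a * h b"
  shows "pmap h (p * q) = pmap h p * pmap h q"
  by (rule biadditive_eq[of "\<lambda>p q. pmap h (p * q)" "\<lambda>p q. pmap h p * pmap h q"])
    (simp_all add: distrib_left distrib_right pmap_add[of h, OF h(1,2)] mult_single pmap_single h)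

lemma pmap_mem:
  assumes "h 0 = 0" "p \<in> carrier (mpoly_ring n C)" "\<And>c. c \<in> C \<Longrightarrow> h c \<in> D"
  shows "pmap h p \<in> carrier (mpoly_ring n D)"
  unfolding mpoly_carrier
proof
  fix t assume "t \<in> keys (pmap h p)"
  then have "t \<in> keys p" using assms(1) by (auto simp: in_keys_iff lookup_pmap)
  then show "keys t \<subseteq> {..<n} \<and> lookup (pmap h p) t \<in> D"
    using assms by (simp add: mpoly_carrier lookup_pmap)
qed

lemma monomial_add_eq_0_iff:
  fixes s t :: "nat \<Rightarrow>\<^sub>0 nat"
  shows "s + t = 0 \<longleftrightarrow> s = 0 \<and> t = 0"
proof
  assume eq: "s + t = 0"
  have "lookup (s + t) j = 0" for j using eq by simp
  then have "lookup s j = 0" "lookup t j = 0" for j by (simp_all add: lookup_add)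
  then show "s = 0 \<and> t = 0" by (intro conjI poly_mapping_eqI) simp_all
qed simp

lemma lookup_mult_0:
  fixes p q :: "'a::comm_ring_1 mpoly"
  shows "lookup (p * q) 0 = lookup p 0 * lookup q 0"
proof (rule biadditive_eq[of "\<lambda>p q. lookup (p * q) 0" "\<lambda>p q. lookup p 0 * lookup q 0"])
  fix s t :: "nat \<Rightarrow>\<^sub>0 nat" and a b :: 'a
  show "lookup (single s a * single t b) 0 = lookup (single s a) 0 * lookup (single t b) 0"
    unfolding mult_single lookup_single when_def using monomial_add_eq_0_iff[of s t] by simp
qed (simp_all add: distrib_left distrib_right lookup_add)

lemma single_1_nonzero: "single i (Suc 0) \<noteq> (0 :: nat \<Rightarrow>\<^sub>0 nat)"
proof
  assume eq: "single i (Suc 0) = (0 :: nat \<Rightarrow>\<^sub>0 nat)"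
  have "lookup (single i (Suc 0)) i = 0" unfolding eq by simp
  then show False by simp
qed

lemma add_eq_single_1_iff:
  fixes s t :: "nat \<Rightarrow>\<^sub>0 nat"
  shows "s + t = single i 1 \<longleftrightarrow> (s = 0 \<and> t = single i 1) \<or> (s = single i 1 \<and> t = 0)"
proof
  assume eq: "s + t = single i 1"
  have l: "lookup s j + lookup t j = (if i = j then 1 else 0)" for j
    using arg_cong[OF eq, of "\<lambda>p. lookup p j"] by (simp add: lookup_add lookup_single when_def)
  have off: "lookup s j = 0" "lookup t j = 0" if "j \<noteq> i" for j using l[of j] that by simp_all
  show "(s = 0 \<and> t = single i 1) \<or> (s = single i 1 \<and> t = 0)"
  proof (cases "lookup s i = 0")
    case True
    then have "lookup t i = 1" using l[of i] by simp
    then show ?thesis using True off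
      by (intro disjI1 conjI poly_mapping_eqI) (auto simp: lookup_single when_def, metis)
  next
    case False
    then have "lookup s i = 1" "lookup t i = 0" using l[of i] by simp_all
    then show ?thesis using off
      by (intro disjI2 conjI poly_mapping_eqI) (auto simp: lookup_single when_def, metis)
  qed
qed auto

lemma lookup_mult_1:
  fixes p q :: "'a::comm_ring_1 mpoly"
  shows "lookup (p * q) (single i 1) = lookup p 0 * lookup q (single i 1) + lookup p (single i 1) * lookup q 0"
proof (rule biadditive_eq[of "\<lambda>p q. lookup (p * q) (single i 1)"
      "\<lambda>p q. lookup p 0 * lookup q (single i 1) + lookup p (single i 1) * lookup q 0"])
  fix s t :: "nat \<Rightarrow>\<^sub>0 nat" and a b :: 'a
  have ne: "single i (1::nat) \<noteq> 0" "0 \<noteq> single i (1::nat)" using single_1_nonzero[of i] by auto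
  show "lookup (single s a * single t b) (single i 1)
      = lookup (single s a) 0 * lookup (single t b) (single i 1) + lookup (single s a) (single i 1) * lookup (single t b) 0"
    unfolding mult_single lookup_single add_eq_single_1_iff when_def using ne by auto
qed (simp_all add: algebra_simps lookup_add)

lemma lookup_const_0: "lookup (const c) 0 = c" and lookup_var_0: "lookup (var j) 0 = 0"
  using single_1_nonzero[of j] by (auto simp: const_def var_def lookup_single when_def)

lemma lookup_const_1: "lookup (const c) (single i (Suc 0)) = 0"
  using single_1_nonzero[of i] by (auto simp: const_def lookup_single when_def)

lemma lookup_var_1: "lookup (var j) (single i (Suc 0)) = (if i = j then 1 else 0)"
  by (auto simp: var_def lookup_single when_def) (metis lookup_single_eq lookup_single_not_eq nat.simps(3))

section \<open>First-order expansion\<close>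

text \<open>Taylor expansion at \<open>\<gamma>\<close>: after substituting
  \<open>a\<^sub>i + \<gamma>\<^sub>i\<close> for \<open>a\<^sub>i\<close>, the value and the first partial
  derivatives at \<open>\<gamma>\<close> are the coefficients of \<open>1\<close> and of the
  \<open>a\<^sub>i\<close>.\<close>
definition shift :: "(nat \<Rightarrow> 'k::field) \<Rightarrow> 'k mpoly \<Rightarrow> 'k mpoly" where
  "shift \<gamma> c = eval_at (\<lambda>i. var i + const (\<gamma> i)) (pmap const c)"

lemma shift_add: "shift \<gamma> (c + d) = shift \<gamma> c + shift \<gamma> d"
  by (simp add: shift_def pmap_add const_zero const_add eval_at_add)

lemma shift_mult: "shift \<gamma> (c * d) = shift \<gamma> c * shift \<gamma> d"
  by (simp add: shift_def pmap_mult const_zero const_add const_mult eval_at_mult)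

lemma shift_zero: "shift \<gamma> 0 = 0"
  by (simp add: shift_def pmap_zero const_zero eval_at_zero)

lemma shift_const: "shift \<gamma> (const c) = const c"
proof -
  have "pmap const (const c) = const (const c)"
    unfolding const_def[of c] pmap_single[of const, OF const_zero] unfolding const_def ..
  then show ?thesis by (simp add: shift_def eval_at_const)
qed

lemma shift_var:
  fixes \<gamma> :: "nat \<Rightarrow> 'k::field"
  shows "shift \<gamma> (var i) = var i + const (\<gamma> i)"
proof -
  have "pmap const (var i :: 'k mpoly) = var i"
    unfolding var_def pmap_single[of const, OF const_zero] const_one ..
  then show ?thesis by (simp add: shift_def eval_at_var)
qed

lemma mem_A_induct [consumes 1, case_names const add var]:
  assumes "c \<in> carrier (A_ring m)"
    and "\<And>c. Q (const c)"
    and "\<And>f g. f \<in> carrier (A_ring m) \<Longrightarrow> g \<in> carrier (A_ring m) \<Longrightarrow> Q f \<Longrightarrow> Q g \<Longrightarrow> Q (f + g)"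
    and "\<And>i f. i < m \<Longrightarrow> f \<in> carrier (A_ring m) \<Longrightarrow> Q f \<Longrightarrow> Q (var i * f)"
  shows "Q c"
  using coeff_ring_UNIV assms(1) unfolding A_ring_def
  by (induction c rule: mpoly_induct) (use assms in \<open>auto simp: A_ring_def\<close>)

lemma shift_lookup_0: "c \<in> carrier (A_ring m) \<Longrightarrow> lookup (shift \<gamma> c) 0 = eval_at \<gamma> c"
  by (induction c rule: mem_A_induct)
    (simp_all add: shift_const shift_add shift_mult shift_var lookup_const_0 lookup_var_0 lookup_add
      lookup_mult_0 eval_at_const eval_at_add eval_at_mult eval_at_var)

text \<open>The first-order data of \<open>p\<close> at the zero point. The derivatives by the
  \<open>a\<^sub>i\<close> depend only on the part of \<open>p\<close> that is constant in the
  \<open>x\<^sub>j\<close>; the value and the derivatives by the \<open>x\<^sub>j\<close> depend only on the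
  specialization of \<open>p\<close>.\<close>
definition partial_a :: "(nat \<Rightarrow> 'k::field) \<Rightarrow> nat \<Rightarrow> 'k mpoly mpoly \<Rightarrow> 'k" where
  "partial_a \<gamma> i p = lookup (shift \<gamma> (lookup p 0)) (single i 1)"

definition partial_x :: "(nat \<Rightarrow> 'k::field) \<Rightarrow> 'k mpoly mpoly \<Rightarrow> nat \<Rightarrow> 'k" where
  "partial_x \<gamma> p j = lookup (specialize \<gamma> p) (single j 1)"

definition value_at :: "(nat \<Rightarrow> 'k::field) \<Rightarrow> 'k mpoly mpoly \<Rightarrow> 'k" where
  "value_at \<gamma> p = lookup (specialize \<gamma> p) 0"

lemma specialize_add: "specialize \<gamma> (p + q) = specialize \<gamma> p + specialize \<gamma> q"
  by (simp add: specialize_def pmap_add eval_at_zero eval_at_add)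

lemma specialize_mult: "specialize \<gamma> (p * q) = specialize \<gamma> p * specialize \<gamma> q"
  by (simp add: specialize_def pmap_mult eval_at_zero eval_at_add eval_at_mult)

lemma specialize_const: "specialize \<gamma> (const c) = const (eval_at \<gamma> c)"
  by (simp add: specialize_def const_def pmap_single eval_at_zero)

lemma specialize_one: "specialize \<gamma> 1 = 1"
  using specialize_const[of \<gamma> 1] by (simp add: const_one eval_at_one)

lemma specialize_zero: "specialize \<gamma> 0 = 0"
  using specialize_const[of \<gamma> 0] by (simp add: const_zero eval_at_zero)

lemma specialize_uminus: "specialize \<gamma> (- p) = - specialize \<gamma> p"
  using specialize_add[of \<gamma> p "- p"] by (simp add: specialize_zero eq_neg_iff_add_eq_0 add.commute)

lemma specialize_diff: "specialize \<gamma> (p - q) = specialize \<gamma> p - specialize \<gamma> q"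
  using specialize_add[of \<gamma> p "- q"] by (simp add: specialize_uminus)

lemma specialize_var: "specialize \<gamma> (var j) = var j"
  by (simp add: specialize_def var_def pmap_single eval_at_zero eval_at_one)

lemma specialize_pmap_const: "specialize \<gamma> (pmap const q) = q"
  by (rule poly_mapping_eqI) (simp add: specialize_def lookup_pmap eval_at_zero const_zero eval_at_const)

lemma P_simps:
  "p \<otimes>\<^bsub>P_ring m k\<^esub> q = p * q" "\<one>\<^bsub>P_ring m k\<^esub> = 1"
  "\<zero>\<^bsub>P_ring m k\<^esub> = 0" "p \<oplus>\<^bsub>P_ring m k\<^esub> q = p + q"
  by (simp_all add: P_ring_def)

lemma KX_simps:
  "p \<otimes>\<^bsub>KX_ring k\<^esub> q = p * q" "\<one>\<^bsub>KX_ring k\<^esub> = 1"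
  "\<zero>\<^bsub>KX_ring k\<^esub> = 0" "p \<oplus>\<^bsub>KX_ring k\<^esub> q = p + q"
  by (simp_all add: KX_ring_def)

lemma P_minus: "q \<in> carrier (P_ring m k) \<Longrightarrow> p \<ominus>\<^bsub>P_ring m k\<^esub> q = p - q"
  unfolding P_ring_def by (rule mpoly_a_minus[OF coeff_ring_A])

lemma A_mem: "const c \<in> carrier (A_ring m)" "i < m \<Longrightarrow> var i \<in> carrier (A_ring m)"
  by (simp_all add: A_ring_def const_mem var_mem coeff_ring_UNIV)

lemma P_mem:
  "c \<in> carrier (A_ring m) \<Longrightarrow> const c \<in> carrier (P_ring m k)" "j < k \<Longrightarrow> var j \<in> carrier (P_ring m k)"
  by (simp_all add: P_ring_def const_mem var_mem coeff_ring_A)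

lemma coeff_ring_P: "coeff_ring (carrier (P_ring m k))"
  unfolding P_ring_def by (rule coeff_ring_mpoly[OF coeff_ring_A])

lemmas P_closed = coeff_ringD[OF coeff_ring_P]
lemmas A_closed = coeff_ringD[OF coeff_ring_A]

lemma P_lookup: "p \<in> carrier (P_ring m k) \<Longrightarrow> lookup p t \<in> carrier (A_ring m)"
  unfolding P_ring_def by (rule mpoly_lookup_mem[OF coeff_ring_A])

lemma mem_P_induct [consumes 1, case_names const add var]:
  assumes "p \<in> carrier (P_ring m k)"
    and "\<And>c. c \<in> carrier (A_ring m) \<Longrightarrow> Q (const c)"
    and "\<And>f g. f \<in> carrier (P_ring m k) \<Longrightarrow> g \<in> carrier (P_ring m k) \<Longrightarrow> Q f \<Longrightarrow> Q g \<Longrightarrow> Q (f + g)"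
    and "\<And>j f. j < k \<Longrightarrow> f \<in> carrier (P_ring m k) \<Longrightarrow> Q f \<Longrightarrow> Q (var j * f)"
  shows "Q p"
  using coeff_ring_A assms(1) unfolding P_ring_def
  by (induction p rule: mpoly_induct) (use assms in \<open>auto simp: P_ring_def\<close>)

lemma specialize_mem: "p \<in> carrier (P_ring m k) \<Longrightarrow> specialize \<gamma> p \<in> carrier (KX_ring k)"
  unfolding specialize_def P_ring_def KX_ring_def by (rule pmap_mem) (auto simp: eval_at_zero)

lemma specialize_hom: "specialize \<gamma> \<in> Ring.ring_hom (P_ring m k) (KX_ring k)"
  by (auto simp: Ring.ring_hom_def specialize_mem P_simps KX_simps specialize_add specialize_mult specialize_one)

lemma pmap_const_mem: "q \<in> carrier (KX_ring k) \<Longrightarrow> pmap const q \<in> carrier (P_ring m k)"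
  unfolding P_ring_def KX_ring_def by (rule pmap_mem) (auto simp: const_zero A_mem)

lemma specialize_surj: "specialize \<gamma> ` carrier (P_ring m k) = carrier (KX_ring k)"
proof
  show "carrier (KX_ring k) \<subseteq> specialize \<gamma> ` carrier (P_ring m k)"
    using pmap_const_mem specialize_pmap_const by (metis imageI subsetI)
qed (auto simp: specialize_mem)

lemma value_at_simps:
  "value_at \<gamma> (p + q) = value_at \<gamma> p + value_at \<gamma> q" "value_at \<gamma> (p * q) = value_at \<gamma> p * value_at \<gamma> q"
  "value_at \<gamma> 0 = 0" "value_at \<gamma> 1 = 1" "value_at \<gamma> (const c) = eval_at \<gamma> c" "value_at \<gamma> (var j) = 0"
  "value_at \<gamma> (p - q) = value_at \<gamma> p - value_at \<gamma> q"
  by (simp_all add: value_at_def specialize_add specialize_mult specialize_zero specialize_one specialize_const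
      specialize_var specialize_diff lookup_add lookup_mult_0 lookup_const_0 lookup_var_0 lookup_minus)

lemma value_at_eq: "value_at \<gamma> p = eval_at \<gamma> (lookup p 0)"
  by (simp add: value_at_def specialize_def lookup_pmap eval_at_zero)

lemma partial_x_simps:
  "partial_x \<gamma> (p + q) j = partial_x \<gamma> p j + partial_x \<gamma> q j"
  "partial_x \<gamma> (p * q) j = value_at \<gamma> p * partial_x \<gamma> q j + partial_x \<gamma> p j * value_at \<gamma> q"
  "partial_x \<gamma> 0 j = 0" "partial_x \<gamma> (const c) j = 0" "partial_x \<gamma> (var i) j = (if i = j then 1 else 0)"
  "partial_x \<gamma> (p - q) j = partial_x \<gamma> p j - partial_x \<gamma> q j"
  using lookup_mult_1[of "specialize \<gamma> p" "specialize \<gamma> q" j]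
  by (auto simp: partial_x_def value_at_def specialize_add specialize_mult specialize_zero specialize_const
      specialize_var specialize_diff lookup_add lookup_const_1 lookup_var_1 lookup_minus)

lemma partial_a_add: "partial_a \<gamma> i (p + q) = partial_a \<gamma> i p + partial_a \<gamma> i q"
  and partial_a_zero: "partial_a \<gamma> i 0 = 0"
  by (simp_all add: partial_a_def lookup_add shift_add shift_zero)

lemma partial_a_diff: "partial_a \<gamma> i (p - q) = partial_a \<gamma> i p - partial_a \<gamma> i q"
  using partial_a_add[of \<gamma> i "p - q" q] by simp

lemma partial_a_mult:
  assumes "p \<in> carrier (P_ring m k)" "q \<in> carrier (P_ring m k)"
  shows "partial_a \<gamma> i (p * q) = value_at \<gamma> p * partial_a \<gamma> i q + partial_a \<gamma> i p * value_at \<gamma> q"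
  unfolding partial_a_def lookup_mult_0 shift_mult lookup_mult_1 value_at_eq
  by (simp add: shift_lookup_0[OF P_lookup[OF assms(1)]] shift_lookup_0[OF P_lookup[OF assms(2)]])

lemma partial_a_const: "partial_a \<gamma> i (const (const c)) = 0"
  and partial_a_var: "partial_a \<gamma> i (var j) = 0"
  and partial_a_var_a: "partial_a \<gamma> i (const (var l - const (\<gamma> l))) = (if i = l then 1 else 0)"
proof -
  show "partial_a \<gamma> i (const (const c)) = 0"
    by (simp add: partial_a_def lookup_const_0 shift_const lookup_const_1)
  show "partial_a \<gamma> i (var j) = 0" by (simp add: partial_a_def lookup_var_0 shift_zero)
  have "shift \<gamma> (var l - const (\<gamma> l)) = var l"
    using shift_add[of \<gamma> "var l - const (\<gamma> l)" "const (\<gamma> l)"] by (simp add: shift_var shift_const)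
  then show "partial_a \<gamma> i (const (var l - const (\<gamma> l))) = (if i = l then 1 else 0)"
    by (simp add: partial_a_def lookup_const_0 lookup_var_1)
qed

lemma partial_x_support: "p \<in> carrier (P_ring m k) \<Longrightarrow> k \<le> j \<Longrightarrow> partial_x \<gamma> p j = 0"
proof -
  assume p: "p \<in> carrier (P_ring m k)" and j: "k \<le> j"
  have "single j (Suc 0) \<notin> keys (specialize \<gamma> p)"
    using specialize_mem[OF p, of \<gamma>] j by (auto simp: KX_ring_def mpoly_carrier)
  then show ?thesis by (simp add: partial_x_def in_keys_iff)
qed

section \<open>Cokernels of subspaces\<close>

definition coord_space :: "nat \<Rightarrow> (nat \<Rightarrow> 'a::zero) set" where
  "coord_space n = {v. \<forall>i\<ge>n. v i = 0}"

text \<open>The map \<open>\<pi>\<close> presents \<open>K\<^sup>k/W\<close> as \<open>K\<^sup>e\<close>.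
  Vectors are sequences that vanish from the given index on, so that \<open>K\<^sup>k\<close> is contained in
  \<open>K\<^sup>k\<^sup>+\<^sup>1\<close>.\<close>
definition quotient_coordinates ::
  "nat \<Rightarrow> (nat \<Rightarrow> 'k::field) set \<Rightarrow> nat \<Rightarrow> ((nat \<Rightarrow> 'k) \<Rightarrow> nat \<Rightarrow> 'k) \<Rightarrow> bool" where
  "quotient_coordinates k W e \<pi> \<longleftrightarrow> (\<forall>v\<in>coord_space k. \<pi> v \<in> coord_space e)
    \<and> (\<forall>u\<in>coord_space k. \<forall>v\<in>coord_space k. \<pi> (\<lambda>i. u i + v i) = (\<lambda>i. \<pi> u i + \<pi> v i))
    \<and> (\<forall>c. \<forall>v\<in>coord_space k. \<pi> (\<lambda>i. c * v i) = (\<lambda>i. c * \<pi> v i))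
    \<and> (\<forall>w\<in>coord_space e. \<exists>v\<in>coord_space k. \<pi> v = w)
    \<and> (\<forall>v\<in>coord_space k. \<pi> v = (\<lambda>_. 0) \<longleftrightarrow> v \<in> W)"

text \<open>Induction on \<open>k\<close>. Either the last coordinate vanishes on \<open>W\<close>, and then
  it is an additional coordinate of the quotient, or \<open>W\<close> contains a vector \<open>u\<close> with
  last coordinate \<open>1\<close>, and subtracting a multiple of \<open>u\<close> clears the last coordinate
  of any vector without changing its class.\<close>
lemma cokernel_coordinates:
  fixes W :: "(nat \<Rightarrow> 'k::field) set" and k :: nat
  assumes "W \<subseteq> coord_space k" and "(\<lambda>_. 0) \<in> W"
    and "\<And>u v. u \<in> W \<Longrightarrow> v \<in> W \<Longrightarrow> (\<lambda>i. u i + v i) \<in> W"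
    and "\<And>c v. v \<in> W \<Longrightarrow> (\<lambda>i. c * v i) \<in> W"
  shows "\<exists>e \<pi>. quotient_coordinates k W e \<pi>"
  using assms
proof (induction k arbitrary: W)
  case 0
  have "coord_space 0 = {\<lambda>_. 0}" by (auto simp: coord_space_def)
  moreover have "W = {\<lambda>_. 0}" using 0(1,2) calculation by auto
  ultimately show ?case unfolding quotient_coordinates_def by (intro exI[of _ 0] exI[of _ "\<lambda>v. v"]) auto
next
  case (Suc k)
  define W0 where "W0 = {v \<in> W. v k = 0}"
  have coord_space_drop: "v \<in> coord_space n" if "v \<in> coord_space (Suc n)" "v n = 0" for v n
  proof -
    have "v i = 0" if "n \<le> i" for i using \<open>v \<in> coord_space (Suc n)\<close> \<open>v n = 0\<close> that by (cases "i = n") (auto simp: coord_space_def)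
    then show ?thesis by (simp add: coord_space_def)
  qed
  have "W0 \<subseteq> coord_space k" using Suc.prems(1) coord_space_drop by (auto simp: W0_def)
  then have "\<exists>e \<pi>. quotient_coordinates k W0 e \<pi>"
    by (rule Suc.IH) (use Suc.prems in \<open>auto simp: W0_def\<close>)
  then obtain e0 \<pi>0 where IH: "\<forall>v\<in>coord_space k. \<pi>0 v \<in> coord_space e0"
    "\<forall>u\<in>coord_space k. \<forall>v\<in>coord_space k. \<pi>0 (\<lambda>i. u i + v i) = (\<lambda>i. \<pi>0 u i + \<pi>0 v i)"
    "\<forall>c. \<forall>v\<in>coord_space k. \<pi>0 (\<lambda>i. c * v i) = (\<lambda>i. c * \<pi>0 v i)"
    "\<forall>w\<in>coord_space e0. \<exists>v\<in>coord_space k. \<pi>0 v = w"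
    "\<forall>v\<in>coord_space k. \<pi>0 v = (\<lambda>_. 0) \<longleftrightarrow> v \<in> W0"
    unfolding quotient_coordinates_def by (elim exE conjE) (rule that)
  note \<pi>0 = IH(1)[rule_format] IH(2)[rule_format] IH(3)[rule_format] IH(4)[rule_format] IH(5)[rule_format]
  show ?case
  proof (cases "\<forall>v\<in>W. v k = 0")
    case True
    define cut where "cut v = (v(k := 0))" for v :: "nat \<Rightarrow> 'k"
    define \<pi> where "\<pi> v = (\<pi>0 (cut v))(e0 := v k)" for v
    have cutV: "cut v \<in> coord_space k" if "v \<in> coord_space (Suc k)" for v
      by (rule coord_space_drop) (use that in \<open>auto simp: cut_def coord_space_def\<close>)
    have cut_add: "cut (\<lambda>i. u i + v i) = (\<lambda>i. cut u i + cut v i)" for u v by (auto simp: cut_def)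
    have cut_smult: "cut (\<lambda>i. c * v i) = (\<lambda>i. c * cut v i)" for c v by (auto simp: cut_def)
    have e0: "\<pi>0 v e0 = 0" if "v \<in> coord_space k" for v using \<pi>0(1)[OF that] by (auto simp: coord_space_def)
    show ?thesis unfolding quotient_coordinates_def
    proof (intro exI[of _ "Suc e0"] exI[of _ \<pi>] conjI ballI allI)
      show "\<pi> v \<in> coord_space (Suc e0)" if v: "v \<in> coord_space (Suc k)" for v
        using \<pi>0(1)[OF cutV[OF v]] by (auto simp: \<pi>_def coord_space_def)
      show "\<pi> (\<lambda>i. u i + v i) = (\<lambda>i. \<pi> u i + \<pi> v i)" if "u \<in> coord_space (Suc k)" "v \<in> coord_space (Suc k)" for u v
        using that by (auto simp: \<pi>_def cut_add \<pi>0(2) cutV)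
      show "\<pi> (\<lambda>i. c * v i) = (\<lambda>i. c * \<pi> v i)" if "v \<in> coord_space (Suc k)" for c v
        using that by (auto simp: \<pi>_def cut_smult \<pi>0(3) cutV)
      show "\<exists>v\<in>coord_space (Suc k). \<pi> v = w" if w: "w \<in> coord_space (Suc e0)" for w
      proof -
        have "w(e0 := 0) \<in> coord_space e0" by (rule coord_space_drop) (use w in \<open>auto simp: coord_space_def\<close>)
        from \<pi>0(4)[OF this] obtain v where v: "v \<in> coord_space k" "\<pi>0 v = w(e0 := 0)" by blast
        have "cut (v(k := w e0)) = v" using v(1) by (auto simp: cut_def coord_space_def)
        then have "\<pi> (v(k := w e0)) = w" using v(2) by (simp add: \<pi>_def)
        moreover have "v(k := w e0) \<in> coord_space (Suc k)" using v(1) by (auto simp: coord_space_def)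
        ultimately show ?thesis by blast
      qed
      show "\<pi> v = (\<lambda>_. 0) \<longleftrightarrow> v \<in> W" if v: "v \<in> coord_space (Suc k)" for v
      proof -
        have "\<pi> v = (\<lambda>_. 0) \<longleftrightarrow> v k = 0 \<and> \<pi>0 (cut v) = (\<lambda>_. 0)"
          using e0[OF cutV[OF v]] by (auto simp: \<pi>_def fun_eq_iff)
        also have "\<dots> \<longleftrightarrow> v k = 0 \<and> cut v \<in> W0" using \<pi>0(5)[OF cutV[OF v]] by simp
        also have "\<dots> \<longleftrightarrow> v k = 0 \<and> v \<in> W"
        proof -
          have "cut v = v" if "v k = 0" using that by (auto simp: cut_def)
          then show ?thesis by (auto simp: W0_def)
        qed
        also have "\<dots> \<longleftrightarrow> v \<in> W" using True by blast
        finally show ?thesis .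
      qed
    qed
  next
    case False
    then obtain u' where u': "u' \<in> W" "u' k \<noteq> 0" by blast
    define u where "u = (\<lambda>i. inverse (u' k) * u' i)"
    have u: "u \<in> W" "u k = 1" "u \<in> coord_space (Suc k)" using u' Suc.prems(1,4) by (auto simp: u_def)
    define red where "red v = (\<lambda>i. v i - v k * u i)" for v
    have redV: "red v \<in> coord_space k" if "v \<in> coord_space (Suc k)" for v
      by (rule coord_space_drop) (use that u in \<open>auto simp: red_def coord_space_def\<close>)
    have red_add: "red (\<lambda>i. u i + v i) = (\<lambda>i. red u i + red v i)" for u v
      by (auto simp: red_def algebra_simps)
    have red_smult: "red (\<lambda>i. c * v i) = (\<lambda>i. c * red v i)" for c v
      by (auto simp: red_def algebra_simps)
    have VV: "v \<in> coord_space (Suc k)" if "v \<in> coord_space k" for v using that by (auto simp: coord_space_def)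
    have red_id: "red v = v" if "v \<in> coord_space k" for v using that by (auto simp: red_def coord_space_def)
    show ?thesis unfolding quotient_coordinates_def
    proof (intro exI[of _ e0] exI[of _ "\<lambda>v. \<pi>0 (red v)"] conjI ballI allI)
      show "\<pi>0 (red v) \<in> coord_space e0" if "v \<in> coord_space (Suc k)" for v using \<pi>0(1) redV that by blast
      show "\<pi>0 (red (\<lambda>i. u i + v i)) = (\<lambda>i. \<pi>0 (red u) i + \<pi>0 (red v) i)"
        if "u \<in> coord_space (Suc k)" "v \<in> coord_space (Suc k)" for u v
        using that by (simp add: red_add \<pi>0(2) redV)
      show "\<pi>0 (red (\<lambda>i. c * v i)) = (\<lambda>i. c * \<pi>0 (red v) i)" if "v \<in> coord_space (Suc k)" for c v
        using that by (simp add: red_smult \<pi>0(3) redV)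
      show "\<exists>v\<in>coord_space (Suc k). \<pi>0 (red v) = w" if "w \<in> coord_space e0" for w
        using \<pi>0(4)[OF that] VV red_id by metis
      show "\<pi>0 (red v) = (\<lambda>_. 0) \<longleftrightarrow> v \<in> W" if v: "v \<in> coord_space (Suc k)" for v
      proof -
        have "\<pi>0 (red v) = (\<lambda>_. 0) \<longleftrightarrow> red v \<in> W" using \<pi>0(5)[OF redV[OF v]] u(2) by (auto simp: W0_def red_def)
        also have "\<dots> \<longleftrightarrow> v \<in> W"
        proof
          assume "red v \<in> W"
          from Suc.prems(3)[OF this Suc.prems(4)[OF u(1), of "v k"]] show "v \<in> W" by (simp add: red_def)
        next
          assume "v \<in> W"
          from Suc.prems(3)[OF this Suc.prems(4)[OF u(1), of "- v k"]] show "red v \<in> W" by (simp add: red_def)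
        qed
        finally show ?thesis .
      qed
    qed
  qed
qed

section \<open>The maximal ideal of the zero point\<close>

abbreviation scal :: "'k::field \<Rightarrow> 'k mpoly mpoly" where "scal c \<equiv> const (const c)"

definition gen_a :: "(nat \<Rightarrow> 'k::field) \<Rightarrow> nat \<Rightarrow> 'k mpoly mpoly" where
  "gen_a \<gamma> i = const (var i - const (\<gamma> i))"

lemma gen_a_mem: "i < m \<Longrightarrow> gen_a \<gamma> i \<in> carrier (P_ring m k)"
  unfolding gen_a_def by (intro P_mem A_closed A_mem)

lemma scal_mem: "scal c \<in> carrier (P_ring m k)"
  by (intro P_mem A_mem)

lemma gen_a_simps: "specialize \<gamma> (gen_a \<gamma> i) = 0" "value_at \<gamma> (gen_a \<gamma> i) = 0" "partial_x \<gamma> (gen_a \<gamma> i) j = 0"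
  "partial_a \<gamma> l (gen_a \<gamma> i) = (if l = i then 1 else 0)"
proof -
  show 1: "specialize \<gamma> (gen_a \<gamma> i) = 0"
    by (simp add: gen_a_def specialize_const eval_at_diff eval_at_var eval_at_const const_zero)
  show "value_at \<gamma> (gen_a \<gamma> i) = 0" "partial_x \<gamma> (gen_a \<gamma> i) j = 0" by (simp_all add: value_at_def partial_x_def 1)
  show "partial_a \<gamma> l (gen_a \<gamma> i) = (if l = i then 1 else 0)" unfolding gen_a_def by (rule partial_a_var_a)
qed

lemma P_idealD:
  assumes "ideal Q (P_ring m k)"
  shows "\<And>a. a \<in> Q \<Longrightarrow> a \<in> carrier (P_ring m k)"
    and "\<And>a b. a \<in> Q \<Longrightarrow> b \<in> Q \<Longrightarrow> a + b \<in> Q"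
    and "\<And>a b. a \<in> Q \<Longrightarrow> b \<in> Q \<Longrightarrow> a - b \<in> Q"
    and "\<And>a r. a \<in> Q \<Longrightarrow> r \<in> carrier (P_ring m k) \<Longrightarrow> r * a \<in> Q"
    and "0 \<in> Q"
proof -
  note Q = cring.ideal_memD[OF cring_P assms]
  show c: "\<And>a. a \<in> Q \<Longrightarrow> a \<in> carrier (P_ring m k)" by (rule Q(1))
  show "\<And>a b. a \<in> Q \<Longrightarrow> b \<in> Q \<Longrightarrow> a + b \<in> Q" using Q(2) by (simp add: P_simps)
  show "\<And>a b. a \<in> Q \<Longrightarrow> b \<in> Q \<Longrightarrow> a - b \<in> Q" using Q(3) P_minus[OF c] by metis
  show "\<And>a r. a \<in> Q \<Longrightarrow> r \<in> carrier (P_ring m k) \<Longrightarrow> r * a \<in> Q" using Q(4) by (simp add: P_simps)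
  show "0 \<in> Q" using Q(6) by (simp add: P_simps)
qed

lemma P_idealI:
  assumes "Q \<subseteq> carrier (P_ring m k)" "0 \<in> Q" "\<And>a b. a \<in> Q \<Longrightarrow> b \<in> Q \<Longrightarrow> a + b \<in> Q"
    and "\<And>a r. a \<in> Q \<Longrightarrow> r \<in> carrier (P_ring m k) \<Longrightarrow> r * a \<in> Q"
  shows "ideal Q (P_ring m k)"
  by (rule cring.ideal_criterion[OF cring_P]) (use assms in \<open>auto simp: P_simps\<close>)

lemma coefficient_congruence:
  assumes Q: "ideal Q (P_ring m k)" and gens: "\<And>i. i < m \<Longrightarrow> gen_a \<gamma> i \<in> Q"
    and c: "c \<in> carrier (A_ring m)"
  shows "const c - scal (eval_at \<gamma> c) \<in> Q"
  using c
proof (induction c rule: mem_A_induct)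
  case (const c)
  show ?case using P_idealD(5)[OF Q] by (simp add: eval_at_const)
next
  case (add f g)
  have eq: "const (f + g) - scal (eval_at \<gamma> (f + g)) = (const f - scal (eval_at \<gamma> f)) + (const g - scal (eval_at \<gamma> g))"
    by (simp add: eval_at_add const_add)
  show ?case unfolding eq by (rule P_idealD(2)[OF Q add.IH])
next
  case (var i f)
  have eq: "const (var i * f) - scal (eval_at \<gamma> (var i * f))
      = const f * gen_a \<gamma> i + scal (\<gamma> i) * (const f - scal (eval_at \<gamma> f))"
    by (simp add: eval_at_mult eval_at_var const_mult gen_a_def const_diff algebra_simps)
  show ?case unfolding eq
    by (intro P_idealD(2)[OF Q] P_idealD(4)[OF Q] gens var.IH var.hyps P_mem(1) scal_mem)
qed

text \<open>With \<open>K[X]\<close> embedded in \<open>P\<close> by \<open>pmap const\<close>, a polynomial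
  agrees with its specialization modulo the \<open>a\<^sub>i - \<gamma>\<^sub>i\<close>; so these generate the
  kernel of the specialization.\<close>
lemma specialize_congruence:
  assumes Q: "ideal Q (P_ring m k)" and gens: "\<And>i. i < m \<Longrightarrow> gen_a \<gamma> i \<in> Q"
    and p: "p \<in> carrier (P_ring m k)"
  shows "p - pmap const (specialize \<gamma> p) \<in> Q"
  using p
proof (induction p rule: mem_P_induct)
  case (const c)
  have "pmap const (const (eval_at \<gamma> c)) = scal (eval_at \<gamma> c)"
    unfolding const_def[of "eval_at \<gamma> c"] pmap_single[of const, OF const_zero] unfolding const_def ..
  then show ?case using coefficient_congruence[OF Q gens const] by (simp add: specialize_const)
next
  case (add f g)
  have eq: "f + g - pmap const (specialize \<gamma> (f + g))
      = (f - pmap const (specialize \<gamma> f)) + (g - pmap const (specialize \<gamma> g))"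
    by (simp add: specialize_add pmap_add const_zero const_add)
  show ?case unfolding eq by (rule P_idealD(2)[OF Q add.IH])
next
  case (var j f)
  have "pmap const (var j :: 'a mpoly) = var j"
    unfolding var_def pmap_single[of const, OF const_zero] const_one ..
  then have eq: "var j * f - pmap const (specialize \<gamma> (var j * f)) = var j * (f - pmap const (specialize \<gamma> f))"
    by (simp add: specialize_mult specialize_var pmap_mult const_zero const_add const_mult right_diff_distrib)
  show ?case unfolding eq by (rule P_idealD(4)[OF Q var.IH P_mem(2)[OF var.hyps(1)]])
qed

lemma mem_if_specialize_zero:
  assumes Q: "ideal Q (P_ring m k)" and gens: "\<And>i. i < m \<Longrightarrow> gen_a \<gamma> i \<in> Q"
    and p: "p \<in> carrier (P_ring m k)" "specialize \<gamma> p = 0"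
  shows "p \<in> Q"
  using specialize_congruence[OF Q gens p(1)] p(2) by (simp add: pmap_zero const_zero)

locale zero_point =
  fixes m k :: nat and \<gamma> :: "nat \<Rightarrow> 'k::field"
begin

sublocale P: cring "P_ring m k :: 'k mpoly mpoly ring" by (rule cring_P)

abbreviation "P \<equiv> P_ring m k :: 'k mpoly mpoly ring"
abbreviation "MZ \<equiv> zero_point_ideal m k \<gamma>"

lemma MZ_eq_Idl: "MZ = Idl\<^bsub>P\<^esub> (gen_a \<gamma> ` {..<m} \<union> var ` {..<k})"
  unfolding zero_point_ideal_def gen_a_def ..

lemma gens_carrier: "gen_a \<gamma> ` {..<m} \<union> var ` {..<k} \<subseteq> carrier P"
  using gen_a_mem P_mem(2) by auto

lemma MZ_ideal: "ideal MZ P"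
  unfolding MZ_eq_Idl by (rule P.genideal_ideal[OF gens_carrier])

lemma gen_in_MZ: "i < m \<Longrightarrow> gen_a \<gamma> i \<in> MZ" "j < k \<Longrightarrow> var j \<in> MZ"
  unfolding MZ_eq_Idl using P.genideal_self[OF gens_carrier] by auto

lemma MZ_least:
  assumes "ideal Q P" "\<And>i. i < m \<Longrightarrow> gen_a \<gamma> i \<in> Q" "\<And>j. j < k \<Longrightarrow> var j \<in> Q"
  shows "MZ \<subseteq> Q"
  unfolding MZ_eq_Idl by (rule P.genideal_minimal[OF assms(1)]) (use assms in auto)

text \<open>The residue field of the zero point is \<open>K\<close>.\<close>
lemma residue_MZ:
  assumes p: "p \<in> carrier P" shows "p - scal (value_at \<gamma> p) \<in> MZ"
  using p
proof (induction p rule: mem_P_induct)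
  case (const c)
  then show ?case using coefficient_congruence[OF MZ_ideal gen_in_MZ(1)] by (simp add: value_at_simps)
next
  case (add f g)
  have eq: "f + g - scal (value_at \<gamma> (f + g)) = (f - scal (value_at \<gamma> f)) + (g - scal (value_at \<gamma> g))"
    by (simp add: value_at_simps const_add)
  show ?case unfolding eq by (rule P_idealD(2)[OF MZ_ideal add.IH])
next
  case (var j f)
  have eq: "var j * f - scal (value_at \<gamma> (var j * f)) = f * var j"
    by (simp add: value_at_simps const_zero)
  show ?case unfolding eq by (rule P_idealD(4)[OF MZ_ideal gen_in_MZ(2)[OF var(1)] var(2)])
qed

lemma MZ_eq: "MZ = {p \<in> carrier P. value_at \<gamma> p = 0}"
proof
  show "MZ \<subseteq> {p \<in> carrier P. value_at \<gamma> p = 0}"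
  proof (rule MZ_least)
    show "ideal {p \<in> carrier P. value_at \<gamma> p = 0} P"
      by (rule P_idealI) (auto simp: value_at_simps P_closed)
  qed (auto simp: gen_a_mem gen_a_simps P_mem value_at_simps)
  show "{p \<in> carrier P. value_at \<gamma> p = 0} \<subseteq> MZ"
  proof
    fix p assume "p \<in> {p \<in> carrier P. value_at \<gamma> p = 0}"
    then show "p \<in> MZ" using residue_MZ[of p] by (simp add: const_zero)
  qed
qed

lemma MZ_prime: "primeideal MZ P"
proof (rule primeidealI[OF MZ_ideal P.is_cring])
  have "1 \<notin> MZ" by (simp add: MZ_eq value_at_simps)
  then show "carrier P \<noteq> MZ" using P.one_closed by (auto simp: P_simps)
  fix a b assume "a \<in> carrier P" "b \<in> carrier P" "a \<otimes>\<^bsub>P\<^esub> b \<in> MZ"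
  then show "a \<in> MZ \<or> b \<in> MZ" by (simp add: MZ_eq P_simps value_at_simps)
qed

definition linear_part :: "'k mpoly mpoly \<Rightarrow> 'k mpoly mpoly" where
  "linear_part p = (\<Sum>i<m. scal (partial_a \<gamma> i p) * gen_a \<gamma> i) + (\<Sum>j<k. scal (partial_x \<gamma> p j) * var j)"

abbreviation "MM \<equiv> ideal_prod P MZ MZ"

lemma MM_ideal: "ideal MM P"
  by (rule P.ideal_prod_is_ideal[OF MZ_ideal MZ_ideal])

lemma MM_sub: "MM \<subseteq> MZ"
  using P.ideal_prod_inter[OF MZ_ideal MZ_ideal] by blast

lemma MM_mult: "p \<in> MZ \<Longrightarrow> q \<in> MZ \<Longrightarrow> p * q \<in> MM"
  using ideal_prod.prod[of p MZ q MZ P] by (simp add: P_simps)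

lemma P_sum_mem: "(\<And>i. i \<in> X \<Longrightarrow> f i \<in> Q) \<Longrightarrow> ideal Q P \<Longrightarrow> sum f X \<in> Q"
  by (induction X rule: infinite_finite_induct) (auto simp: P_idealD)

lemma linear_combination_mem:
  "(\<Sum>i<m. scal (\<alpha> i) * gen_a \<gamma> i) + (\<Sum>j<k. scal (\<beta> j) * var j) \<in> MZ"
  by (intro P_idealD(2)[OF MZ_ideal] P_sum_mem MZ_ideal P_idealD(4)[OF MZ_ideal] scal_mem)
    (simp_all add: gen_in_MZ)

text \<open>The elements with this property form an ideal, because \<open>r\<close> is congruent to its
  value modulo the maximal ideal, and the generators \<open>a\<^sub>i - \<gamma>\<^sub>i\<close> and
  \<open>x\<^sub>j\<close> are equal to their linear parts.\<close>
lemma linear_part_congruence: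
  assumes p: "p \<in> MZ" shows "p - linear_part p \<in> MM"
proof -
  have "MZ \<subseteq> {p \<in> MZ. p - linear_part p \<in> MM}"
  proof (rule MZ_least)
    show "ideal {p \<in> MZ. p - linear_part p \<in> MM} P"
    proof (rule P_idealI)
      show "{p \<in> MZ. p - linear_part p \<in> MM} \<subseteq> carrier P" using P_idealD(1)[OF MZ_ideal] by blast
      have "linear_part 0 = 0" by (simp add: linear_part_def partial_a_zero partial_x_simps const_zero)
      then show "0 \<in> {p \<in> MZ. p - linear_part p \<in> MM}" using P_idealD(5)[OF MZ_ideal] P_idealD(5)[OF MM_ideal] by simp
      fix a assume "a \<in> {p \<in> MZ. p - linear_part p \<in> MM}"
      then have a: "a \<in> MZ" "a - linear_part a \<in> MM" by auto
      {
        fix b assume "b \<in> {p \<in> MZ. p - linear_part p \<in> MM}"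
        then have b: "b \<in> MZ" "b - linear_part b \<in> MM" by auto
        have "linear_part (a + b) = linear_part a + linear_part b"
          by (simp add: linear_part_def partial_a_add partial_x_simps const_add distrib_right sum.distrib)
        then have eq: "a + b - linear_part (a + b) = (a - linear_part a) + (b - linear_part b)" by simp
        have "a + b - linear_part (a + b) \<in> MM" unfolding eq by (rule P_idealD(2)[OF MM_ideal a(2) b(2)])
        then show "a + b \<in> {p \<in> MZ. p - linear_part p \<in> MM}"
          using P_idealD(2)[OF MZ_ideal a(1) b(1)] by blast
      next
        fix r assume r: "r \<in> carrier P"
        have ac: "a \<in> carrier P" "value_at \<gamma> a = 0" using a(1) by (auto simp: MZ_eq)
        have "linear_part (r * a) = scal (value_at \<gamma> r) * linear_part a"
          by (simp add: linear_part_def partial_a_mult[OF r ac(1)] partial_x_simps ac(2) const_mult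
              distrib_left sum_distrib_left mult.assoc)
        then have eq: "r * a - linear_part (r * a) = (r - scal (value_at \<gamma> r)) * a + scal (value_at \<gamma> r) * (a - linear_part a)"
          by (simp add: algebra_simps)
        have "r * a - linear_part (r * a) \<in> MM" unfolding eq
          by (rule P_idealD(2)[OF MM_ideal MM_mult[OF residue_MZ[OF r] a(1)] P_idealD(4)[OF MM_ideal a(2) scal_mem]])
        then show "r * a \<in> {p \<in> MZ. p - linear_part p \<in> MM}"
          using P_idealD(4)[OF MZ_ideal a(1) r] by blast
      }
    qed
    fix i assume i: "i < m"
    have "(\<Sum>j<k. scal (partial_x \<gamma> (gen_a \<gamma> i) j) * var j) = 0"
      by (rule sum.neutral) (simp add: gen_a_simps const_zero)
    moreover have "(\<Sum>l<m. scal (partial_a \<gamma> l (gen_a \<gamma> i)) * gen_a \<gamma> l) = (\<Sum>l<m. if l = i then gen_a \<gamma> i else 0)"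
      by (rule sum.cong) (auto simp: gen_a_simps const_zero const_one)
    ultimately have "linear_part (gen_a \<gamma> i) = (\<Sum>l<m. if l = i then gen_a \<gamma> i else 0)"
      by (simp add: linear_part_def)
    also have "\<dots> = gen_a \<gamma> i" using i by simp
    finally show "gen_a \<gamma> i \<in> {p \<in> MZ. p - linear_part p \<in> MM}"
      using gen_in_MZ(1)[OF i] P_idealD(5)[OF MM_ideal] by simp
  next
    fix j assume j: "j < k"
    have "(\<Sum>i<m. scal (partial_a \<gamma> i (var j)) * gen_a \<gamma> i) = 0"
      by (rule sum.neutral) (simp add: partial_a_var const_zero)
    moreover have "(\<Sum>l<k. scal (partial_x \<gamma> (var j) l) * var l) = (\<Sum>l<k. if l = j then var j else 0)"
      by (rule sum.cong) (auto simp: partial_x_simps const_zero const_one)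
    ultimately have "linear_part (var j) = (\<Sum>l<k. if l = j then var j else 0)"
      by (simp add: linear_part_def)
    also have "\<dots> = var j" using j by simp
    finally show "var j \<in> {p \<in> MZ. p - linear_part p \<in> MM}"
      using gen_in_MZ(2)[OF j] P_idealD(5)[OF MM_ideal] by simp
  qed
  then show ?thesis using p by blast
qed

text \<open>So the \<open>m + k\<close> partial derivatives are coordinates on the cotangent space of the
  affine space at the zero point.\<close>
lemma MM_iff:
  assumes p: "p \<in> MZ"
  shows "p \<in> MM \<longleftrightarrow> (\<forall>i<m. partial_a \<gamma> i p = 0) \<and> (\<forall>j<k. partial_x \<gamma> p j = 0)"
proof
  assume "p \<in> MM"
  then have "(\<forall>i. partial_a \<gamma> i p = 0) \<and> (\<forall>j. partial_x \<gamma> p j = 0)"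
  proof (induction rule: ideal_prod.induct)
    case (prod a b)
    then have "a \<in> carrier P" "b \<in> carrier P" "value_at \<gamma> a = 0" "value_at \<gamma> b = 0" by (auto simp: MZ_eq)
    then show ?case by (simp add: P_simps partial_a_mult partial_x_simps)
  next
    case (sum a b)
    then show ?case by (simp add: P_simps partial_a_add partial_x_simps)
  qed
  then show "(\<forall>i<m. partial_a \<gamma> i p = 0) \<and> (\<forall>j<k. partial_x \<gamma> p j = 0)" by blast
next
  assume "(\<forall>i<m. partial_a \<gamma> i p = 0) \<and> (\<forall>j<k. partial_x \<gamma> p j = 0)"
  then have "linear_part p = 0" by (simp add: linear_part_def const_zero)
  then show "p \<in> MM" using linear_part_congruence[OF p] by simp
qed

lemma partial_sum:
  "partial_a \<gamma> i (sum f X) = (\<Sum>x\<in>X. partial_a \<gamma> i (f x))" "partial_x \<gamma> (sum f X) j = (\<Sum>x\<in>X. partial_x \<gamma> (f x) j)"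
  by (simp_all add: additive_sum[of "partial_a \<gamma> i"] additive_sum[of "\<lambda>p. partial_x \<gamma> p j"]
      partial_a_zero partial_a_add partial_x_simps)

lemma partial_linear_combination:
  fixes \<alpha> \<beta> :: "nat \<Rightarrow> 'k"
  defines "p \<equiv> (\<Sum>i<m. scal (\<alpha> i) * gen_a \<gamma> i) + (\<Sum>j<k. scal (\<beta> j) * var j)"
  shows "i < m \<Longrightarrow> partial_a \<gamma> i p = \<alpha> i" "j < k \<Longrightarrow> partial_x \<gamma> p j = \<beta> j"
proof -
  assume i: "i < m"
  have "(\<Sum>j<k. partial_a \<gamma> i (scal (\<beta> j) * var j)) = 0"
    by (rule sum.neutral)
      (simp add: partial_a_mult[OF scal_mem[of _ m k] P_mem(2)] partial_a_const partial_a_var)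
  moreover have "(\<Sum>l<m. partial_a \<gamma> i (scal (\<alpha> l) * gen_a \<gamma> l)) = (\<Sum>l<m. if l = i then \<alpha> i else 0)"
    by (rule sum.cong)
      (auto simp: partial_a_mult[OF scal_mem[of _ m k] gen_a_mem] partial_a_const value_at_simps gen_a_simps eval_at_const)
  ultimately have "partial_a \<gamma> i p = (\<Sum>l<m. if l = i then \<alpha> i else 0)"
    by (simp add: p_def partial_a_add partial_sum)
  then show "partial_a \<gamma> i p = \<alpha> i" using i by simp
next
  assume j: "j < k"
  have "(\<Sum>i<m. partial_x \<gamma> (scal (\<alpha> i) * gen_a \<gamma> i) j) = 0"
    by (rule sum.neutral) (simp add: partial_x_simps gen_a_simps)
  moreover have "(\<Sum>l<k. partial_x \<gamma> (scal (\<beta> l) * var l) j) = (\<Sum>l<k. if l = j then \<beta> j else 0)"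
    by (rule sum.cong) (auto simp: partial_x_simps value_at_simps eval_at_const)
  ultimately have "partial_x \<gamma> p j = (\<Sum>l<k. if l = j then \<beta> j else 0)"
    by (simp add: p_def partial_x_simps(1) partial_sum)
  then show "partial_x \<gamma> p j = \<beta> j" using j by simp
qed

end

section \<open>The zero point and its fiber\<close>

lemma quotient_map:
  assumes R: "cring R" and I: "ideal I R"
  shows "cring (R Quot I)" "(\<lambda>r. I +>\<^bsub>R\<^esub> r) \<in> Ring.ring_hom R (R Quot I)"
    "(\<lambda>r. I +>\<^bsub>R\<^esub> r) ` carrier R = carrier (R Quot I)"
    "\<And>r. r \<in> carrier R \<Longrightarrow> I +>\<^bsub>R\<^esub> r = \<zero>\<^bsub>R Quot I\<^esub> \<longleftrightarrow> r \<in> I"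
proof -
  interpret cring R by fact
  interpret ideal I R by fact
  show "cring (R Quot I)" by (rule quotient_is_cring[OF R])
  show "(\<lambda>r. I +>\<^bsub>R\<^esub> r) \<in> Ring.ring_hom R (R Quot I)" by (rule rcos_ring_hom)
  show "(\<lambda>r. I +>\<^bsub>R\<^esub> r) ` carrier R = carrier (R Quot I)"
    by (auto simp: FactRing_def A_RCOSETS_def')
  show "I +>\<^bsub>R\<^esub> r = \<zero>\<^bsub>R Quot I\<^esub> \<longleftrightarrow> r \<in> I" if "r \<in> carrier R" for r
    using rcos_const_imp_mem[OF that] a_rcos_zero[OF I] by (auto simp: FactRing_def)
qed

locale positive_algebra = zero_point m k \<gamma> for m k and \<gamma> :: "nat \<Rightarrow> 'k::field" +
  fixes w :: "nat \<Rightarrow> nat" and I :: "'k mpoly mpoly set"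
  assumes w: "\<And>j. j < k \<Longrightarrow> 0 < w j" and positive: "defines_positive_algebra m k w I"
begin

lemma I_ideal: "ideal I P"
  using positive by (simp add: defines_positive_algebra_def homogeneous_ideal_def)

lemma weight_eq_0_iff:
  assumes "keys t \<subseteq> {..<k}" shows "weight w t = 0 \<longleftrightarrow> t = 0"
proof
  assume "weight w t = 0"
  then have zero: "\<forall>j\<in>keys t. w j * lookup t j = 0" by (simp add: weight_def)
  have False if j: "j \<in> keys t" for j
  proof -
    have "j < k" using assms j by blast
    then have "0 < w j" by (rule w)
    then show False using bspec[OF zero j] j by (simp add: in_keys_iff)
  qed
  then have "keys t = {}" by blast
  then show "t = 0" by simp
qed (simp add: weight_def)

text \<open>This is where positivity enters. Since all weights are positive, the homogeneous component of
  degree \<open>0\<close> of an element of \<open>I\<close> is its constant term, and it lies in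
  \<open>I \<inter> A = 0\<close>. Consequently the derivatives by the \<open>a\<^sub>i\<close> vanish on
  \<open>I\<close>.\<close>
lemma I_constant_term:
  assumes p: "p \<in> I" shows "lookup p 0 = 0"
proof -
  have pc: "p \<in> carrier P" by (rule P_idealD(1)[OF I_ideal p])
  have "hom_component w 0 p \<in> I" using positive p
    by (simp add: defines_positive_algebra_def homogeneous_ideal_def)
  moreover have "hom_component w 0 p = const (lookup p 0)"
  proof -
    have "weight w t = 0 \<longleftrightarrow> t = 0" if "t \<in> keys p" for t
      using pc that by (intro weight_eq_0_iff) (auto simp: P_ring_def mpoly_carrier)
    then have "{t \<in> keys p. weight w t = 0} = (if lookup p 0 = 0 then {} else {0})"
      by (auto simp: in_keys_iff)
    then show ?thesis by (simp add: hom_component_def const_def)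
  qed
  ultimately have "const (lookup p 0) \<in> I \<inter> const ` carrier (A_ring m)" using P_lookup[OF pc] by auto
  moreover have "I \<inter> const ` carrier (A_ring m) = {0}"
    using positive unfolding defines_positive_algebra_def by (rule conjunct2)
  ultimately have "const (lookup p 0) = 0" by blast
  then have "lookup (const (lookup p 0)) 0 = 0" by simp
  then show ?thesis by (simp add: lookup_const_0)
qed

lemma I_partial_a: "p \<in> I \<Longrightarrow> partial_a \<gamma> i p = 0"
  by (simp add: partial_a_def I_constant_term shift_zero)

lemma I_sub_MZ: "I \<subseteq> MZ"
  using P_idealD(1)[OF I_ideal] by (auto simp: MZ_eq value_at_eq I_constant_term eval_at_zero)

text \<open>The preimage of \<open>I\<^sub>\<Gamma>\<close>, so that \<open>P/J\<close> is the coordinate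
  ring of the fiber.\<close>
definition J :: "'k mpoly mpoly set" where
  "J = {r \<in> carrier P. specialize \<gamma> r \<in> fiber_ideal I \<gamma>}"

lemma J_iff: "r \<in> J \<longleftrightarrow> r \<in> carrier P \<and> (\<exists>q\<in>I. specialize \<gamma> r = specialize \<gamma> q)"
  by (auto simp: J_def fiber_ideal_def)

lemma J_sub_MZ: "J \<subseteq> MZ"
proof
  fix r assume "r \<in> J"
  then obtain q where "r \<in> carrier P" "q \<in> I" "specialize \<gamma> r = specialize \<gamma> q" by (auto simp: J_iff)
  then show "r \<in> MZ" using I_sub_MZ by (auto simp: MZ_eq value_at_def)
qed

lemma fiber_ideal_ideal: "ideal (fiber_ideal I \<gamma>) (KX_ring k)"
  unfolding fiber_ideal_def
  by (rule surjective_image_ideal[OF cring_P cring_KX specialize_hom specialize_surj I_ideal])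

text \<open>The ideal \<open>J\<close> is generated by \<open>I\<close> and the
  \<open>a\<^sub>i - \<gamma>\<^sub>i\<close>: elements with the same specialization differ by a combination
  of the latter.\<close>
lemma J_sub_ideal:
  assumes Q: "ideal Q P" and I: "I \<subseteq> Q" and gens: "\<And>i. i < m \<Longrightarrow> gen_a \<gamma> i \<in> Q"
  shows "J \<subseteq> Q"
proof
  fix r assume "r \<in> J"
  then obtain q where q: "r \<in> carrier P" "q \<in> I" "specialize \<gamma> r = specialize \<gamma> q" by (auto simp: J_iff)
  have qc: "q \<in> carrier P" by (rule P_idealD(1)[OF I_ideal q(2)])
  have "r - q \<in> Q"
    by (rule mem_if_specialize_zero[OF Q gens])
      (use q qc P_closed(3) in \<open>auto simp: specialize_diff\<close>)
  then have "(r - q) + q \<in> Q" using P_idealD(2)[OF Q] q(2) I by blast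
  then show "r \<in> Q" by simp
qed

text \<open>The passage from \<open>I\<close> to \<open>J\<close> adjoins the \<open>m\<close> elements
  \<open>a\<^sub>i - \<gamma>\<^sub>i\<close>, and each of them lowers the dimension by at most one.\<close>
lemma interval_dim_le: "interval_dim P I MZ \<le> interval_dim P J MZ + ereal (real m)"
proof -
  let ?X = "gen_a \<gamma> ` {..<m}"
  have "interval_dim P I MZ \<le> interval_dim P (I \<union> ?X) MZ + ereal (real (card ?X))"
    by (rule P.interval_dim_finite_union[OF noetherian_P MZ_prime I_sub_MZ]) (auto simp: gen_in_MZ)
  also have "\<dots> \<le> interval_dim P J MZ + ereal (real m)"
  proof (rule add_mono)
    show "ereal (real (card ?X)) \<le> ereal (real m)" using card_image_le[of "{..<m}" "gen_a \<gamma>"] by simp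
    have "ereal (real n) \<le> interval_dim P J MZ"
      if p: "prime_chain P n p" "I \<union> ?X \<subseteq> p 0" "p n \<subseteq> MZ" for n p
    proof (rule interval_dimI[OF p(1) _ p(3)])
      have "primeideal (p 0) P" using p(1) by (simp add: prime_chain_def)
      then show "J \<subseteq> p 0" using J_sub_ideal[OF P.primeD(1)] p(2) by blast
    qed
    then show "interval_dim P (I \<union> ?X) MZ \<le> interval_dim P J MZ"
      unfolding interval_dim_def[of P "I \<union> ?X"] by (auto intro!: Sup_least)
  qed
  finally show ?thesis .
qed

lemma interval_dim_nonneg: "X \<subseteq> MZ \<Longrightarrow> 0 \<le> interval_dim P X MZ"
  using interval_dimI[of P 0 "\<lambda>_. MZ" X MZ] MZ_prime by (simp add: prime_chain_def zero_ereal_def)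

lemma zero_model:
  "localization_model P (R_zero m k I \<gamma>)
     (\<lambda>r. loc_map (R_ring m k I) (zero_point_ideal_mod m k I \<gamma>) (I +>\<^bsub>P\<^esub> r)) I MZ"
proof -
  note q = quotient_map[OF cring_P I_ideal]
  have ker: "{r \<in> carrier P. I +>\<^bsub>P\<^esub> r = \<zero>\<^bsub>P Quot I\<^esub>} = I"
    using q(4) P_idealD(1)[OF I_ideal] by blast
  have "{r \<in> carrier P. I +>\<^bsub>P\<^esub> r = \<zero>\<^bsub>P Quot I\<^esub>} \<subseteq> MZ" unfolding ker by (rule I_sub_MZ)
  from localization_model_of_surjection[OF cring_P q(1,2,3) MZ_prime this]
  show ?thesis unfolding ker R_zero_def R_ring_def zero_point_ideal_mod_def .
qed

definition to_fiber :: "'k mpoly mpoly \<Rightarrow> 'k mpoly set" where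
  "to_fiber r = fiber_ideal I \<gamma> +>\<^bsub>KX_ring k\<^esub> specialize \<gamma> r"

lemma to_fiber:
  shows "cring (fiber_ring k I \<gamma>)" and "to_fiber \<in> Ring.ring_hom P (fiber_ring k I \<gamma>)"
    and "to_fiber ` carrier P = carrier (fiber_ring k I \<gamma>)"
    and "{r \<in> carrier P. to_fiber r = \<zero>\<^bsub>fiber_ring k I \<gamma>\<^esub>} = J"
    and "to_fiber ` MZ = fiber_origin k I \<gamma>"
    and "to_fiber (scal c) = fiber_scalar k I \<gamma> c"
proof -
  note q = quotient_map[OF cring_KX fiber_ideal_ideal, folded fiber_ring_def]
  show "cring (fiber_ring k I \<gamma>)" by (rule q(1))
  show "to_fiber \<in> Ring.ring_hom P (fiber_ring k I \<gamma>)"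
    using ring_hom_trans[OF specialize_hom q(2)] by (simp add: comp_def to_fiber_def[abs_def])
  show "to_fiber ` carrier P = carrier (fiber_ring k I \<gamma>)"
    unfolding to_fiber_def[abs_def] q(3)[symmetric] specialize_surj[of \<gamma> m k, symmetric] by (simp add: image_image)
  show "{r \<in> carrier P. to_fiber r = \<zero>\<^bsub>fiber_ring k I \<gamma>\<^esub>} = J"
    using q(4)[OF specialize_mem] by (auto simp: J_def to_fiber_def)
  show "to_fiber (scal c) = fiber_scalar k I \<gamma> c"
    by (simp add: to_fiber_def fiber_scalar_def specialize_const eval_at_const)
  let ?O = "Idl\<^bsub>KX_ring k\<^esub> (var ` {..<k}) :: 'k mpoly set"
  interpret KX: cring "KX_ring k :: 'k mpoly ring" by (rule cring_KX)
  have vars: "var ` {..<k} \<subseteq> carrier (KX_ring k :: 'k mpoly ring)"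
    by (auto simp: KX_ring_def intro!: var_mem coeff_ring_UNIV)
  note O = KX.ideal_memD[OF KX.genideal_ideal[OF vars]]
  have "specialize \<gamma> ` MZ = ?O"
  proof
    have "MZ \<subseteq> {p \<in> carrier P. specialize \<gamma> p \<in> ?O}"
    proof (rule MZ_least)
      show "ideal {p \<in> carrier P. specialize \<gamma> p \<in> ?O} P"
      proof (rule P_idealI)
        fix a r assume "a \<in> {p \<in> carrier P. specialize \<gamma> p \<in> ?O}" "r \<in> carrier P"
        then show "r * a \<in> {p \<in> carrier P. specialize \<gamma> p \<in> ?O}"
          using O(4)[of "specialize \<gamma> a" "specialize \<gamma> r"] specialize_mem[of r m k \<gamma>]
          by (simp add: specialize_mult KX_simps P_closed)
      next
        fix a b assume "a \<in> {p \<in> carrier P. specialize \<gamma> p \<in> ?O}" "b \<in> {p \<in> carrier P. specialize \<gamma> p \<in> ?O}"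
        then show "a + b \<in> {p \<in> carrier P. specialize \<gamma> p \<in> ?O}"
          using O(2)[of "specialize \<gamma> a" "specialize \<gamma> b"] by (simp add: specialize_add KX_simps P_closed)
      qed (use O(6) in \<open>auto simp: KX_simps specialize_zero P_closed\<close>)
      show "gen_a \<gamma> i \<in> {p \<in> carrier P. specialize \<gamma> p \<in> ?O}" if "i < m" for i
        using that O(6) by (simp add: gen_a_mem gen_a_simps KX_simps)
      show "var j \<in> {p \<in> carrier P. specialize \<gamma> p \<in> ?O}" if "j < k" for j
        using that KX.genideal_self[OF vars] by (auto simp: P_mem specialize_var)
    qed
    then show "specialize \<gamma> ` MZ \<subseteq> ?O" by blast
    have "ideal (specialize \<gamma> ` MZ) (KX_ring k)"
      by (rule surjective_image_ideal[OF cring_P cring_KX specialize_hom specialize_surj MZ_ideal])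
    then show "?O \<subseteq> specialize \<gamma> ` MZ"
    proof (rule KX.genideal_minimal)
      show "var ` {..<k} \<subseteq> specialize \<gamma> ` MZ"
      proof clarify
        fix j assume "j < k"
        then have "specialize \<gamma> (var j) \<in> specialize \<gamma> ` MZ" using gen_in_MZ(2) by blast
        then show "var j \<in> specialize \<gamma> ` MZ" by (simp add: specialize_var)
      qed
    qed
  qed
  then show "to_fiber ` MZ = fiber_origin k I \<gamma>"
    unfolding to_fiber_def[abs_def] fiber_origin_def by (metis image_image)
qed

lemma fiber_model:
  "localization_model P (R_fiber k I \<gamma>)
     (\<lambda>r. loc_map (fiber_ring k I \<gamma>) (fiber_origin k I \<gamma>) (to_fiber r)) J MZ"
proof -
  have "{r \<in> carrier P. to_fiber r = \<zero>\<^bsub>fiber_ring k I \<gamma>\<^esub>} \<subseteq> MZ"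
    unfolding to_fiber(4) by (rule J_sub_MZ)
  from localization_model_of_surjection[OF cring_P to_fiber(1-3) MZ_prime this]
  show ?thesis unfolding to_fiber(4,5) R_fiber_def .
qed

lemma krull_dim_zero: "krull_dim (R_zero m k I \<gamma>) = interval_dim P I MZ"
  by (rule localization_model.krull_dim_eq[OF zero_model])

lemma krull_dim_fiber: "krull_dim (R_fiber k I \<gamma>) = interval_dim P J MZ"
  by (rule localization_model.krull_dim_eq[OF fiber_model])

lemma scal_hom: "scal c \<in> carrier P" "scal 0 = \<zero>\<^bsub>P\<^esub>" "scal 1 = \<one>\<^bsub>P\<^esub>" "scal (c * d) = scal c \<otimes>\<^bsub>P\<^esub> scal d"
  by (simp_all add: scal_mem P_simps const_zero const_one const_mult)

lemma residue_scal: "r \<in> carrier P \<Longrightarrow> \<exists>c. r \<ominus>\<^bsub>P\<^esub> scal c \<in> MZ"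
  using residue_MZ P_minus[OF scal_mem] by metis

lemma partial_smult:
  assumes "p \<in> MZ"
  shows "partial_a \<gamma> i (scal c * p) = c * partial_a \<gamma> i p" "partial_x \<gamma> (scal c * p) j = c * partial_x \<gamma> p j"
  using partial_a_mult[OF scal_mem P_idealD(1)[OF MZ_ideal assms], of \<gamma> i c]
  by (simp_all add: partial_a_const partial_x_simps value_at_simps eval_at_const)

text \<open>If \<open>Y\<close> spans the cotangent space of the fiber, then by Nakayama's lemma
  \<open>MZ\<close> is the only prime between \<open>J \<union> Y\<close> and \<open>MZ\<close>. So adjoining
  \<open>Y\<close> reduces the dimension of the fiber to zero.\<close>
lemma fiber_dim_le_generators:
  assumes Y: "finite Y" "Y \<subseteq> MZ"
    and gen: "\<And>p. p \<in> MZ \<Longrightarrow> \<exists>y\<in>Idl\<^bsub>P\<^esub> Y. \<exists>j\<in>J. p - y - j \<in> MM"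
  shows "interval_dim P J MZ \<le> ereal (real (card Y))"
proof -
  have YP: "Y \<subseteq> carrier P" using Y(2) P_idealD(1)[OF MZ_ideal] by blast
  have full: "p = MZ" if p: "primeideal p P" "J \<union> Y \<subseteq> p" "p \<subseteq> MZ" for p
  proof
    show "p \<subseteq> MZ" by fact
    note pI = P.primeD(1)[OF p(1)]
    show "MZ \<subseteq> p"
    proof (rule P.nakayama_saturated[OF noetherian_P MZ_prime P.saturated_prime[OF p(1,3)] MZ_ideal])
      fix q assume q: "q \<in> MZ"
      obtain y j where yj: "y \<in> Idl\<^bsub>P\<^esub> Y" "j \<in> J" "q - y - j \<in> MM" using gen[OF q] by blast
      have "Idl\<^bsub>P\<^esub> Y \<subseteq> p" by (rule P.genideal_minimal[OF pI]) (use p in auto)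
      then have yjp: "y + j \<in> p" using P_idealD(2)[OF pI] yj p(2) by blast
      have "1 * q = (y + j) + (q - y - j)" by simp
      moreover have "1 \<in> carrier P - MZ" using P.primeD(2)[OF MZ_prime] P.one_closed by (simp add: P_simps)
      ultimately show "\<exists>s\<in>carrier P - MZ. \<exists>u\<in>p. \<exists>v\<in>MM. s \<otimes>\<^bsub>P\<^esub> q = u \<oplus>\<^bsub>P\<^esub> v"
        unfolding P_simps using yjp yj(3) by blast
    qed
  qed
  have "interval_dim P (J \<union> Y) MZ \<le> 0"
    unfolding interval_dim_def
  proof (rule Sup_least, clarify)
    fix n p assume p: "prime_chain P n p" "J \<union> Y \<subseteq> p 0" "p n \<subseteq> MZ"
    have "n = 0"
    proof (rule ccontr)
      assume "n \<noteq> 0"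
      then have 1: "p 0 \<subset> p 1" using p(1) by (simp add: prime_chain_def)
      have "p 1 \<subseteq> MZ" "p 0 \<subseteq> MZ" using prime_chain_mono[OF p(1), of 1 n] prime_chain_mono[OF p(1), of 0 n] \<open>n \<noteq> 0\<close> p(3) by auto
      moreover have "primeideal (p 0) P" using p(1) by (simp add: prime_chain_def)
      ultimately show False using full[of "p 0"] p(2) 1 by blast
    qed
    then show "ereal (real n) \<le> 0" by (simp add: zero_ereal_def)
  qed
  then have "interval_dim P (J \<union> Y) MZ + ereal (real (card Y)) \<le> ereal (real (card Y))"
    using add_right_mono[of "interval_dim P (J \<union> Y) MZ" 0 "ereal (real (card Y))"] by simp
  then show ?thesis
    using P.interval_dim_finite_union[OF noetherian_P MZ_prime J_sub_MZ Y] by (rule order_trans[rotated])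
qed

text \<open>Let \<open>W \<subseteq> K\<^sup>k\<close> consist of the \<open>x\<close>-derivatives of the
  elements of \<open>I\<close>, or equivalently of \<open>I\<^sub>\<Gamma>\<close>, and let \<open>e\<close>
  be the dimension of \<open>K\<^sup>k/W\<close>. As the \<open>a\<close>-derivatives vanish on
  \<open>I\<close>, the cotangent space at the zero point is \<open>K\<^sup>m \<times> K\<^sup>k/W\<close>. On
  the fiber, the relations \<open>a\<^sub>i = \<gamma>\<^sub>i\<close> remove the factor
  \<open>K\<^sup>m\<close>. Lifting a basis of the remaining space gives \<open>e\<close> elements as in
  \<open>fiber_dim_le_generators\<close>.\<close>
theorem cotangent_dimensions:
  "\<exists>e. cot_dim (R_zero_scalar m k I \<gamma>) (R_zero m k I \<gamma>) (max_ideal (R_zero m k I \<gamma>)) = m + e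
     \<and> cot_dim (fiber_scalar k I \<gamma>) (fiber_ring k I \<gamma>) (fiber_origin k I \<gamma>) = e
     \<and> cot_dim (R_fiber_scalar k I \<gamma>) (R_fiber k I \<gamma>) (max_ideal (R_fiber k I \<gamma>)) = e
     \<and> interval_dim P J MZ \<le> ereal (real e)"
proof -
  define W where "W = partial_x \<gamma> ` I"
  have xsupp: "partial_x \<gamma> p \<in> coord_space k" if "p \<in> carrier P" for p
    using partial_x_support[OF that] by (simp add: coord_space_def)
  have Isupp: "partial_x \<gamma> p \<in> coord_space k" if "p \<in> I" for p
    using xsupp P_idealD(1)[OF I_ideal that] .
  have "\<exists>e \<pi>. quotient_coordinates k W e \<pi>"
  proof (rule cokernel_coordinates)
    show "W \<subseteq> coord_space k" using Isupp by (auto simp: W_def)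
    have "partial_x \<gamma> 0 = (\<lambda>_. 0)" by (simp add: fun_eq_iff partial_x_simps)
    then show "(\<lambda>_. 0) \<in> W" unfolding W_def using P_idealD(5)[OF I_ideal] by (metis imageI)
    fix u v assume "u \<in> W" "v \<in> W"
    then obtain p q where pq: "p \<in> I" "q \<in> I" "u = partial_x \<gamma> p" "v = partial_x \<gamma> q" by (auto simp: W_def)
    then have "(\<lambda>i. u i + v i) = partial_x \<gamma> (p + q)" by (simp add: fun_eq_iff partial_x_simps)
    then show "(\<lambda>i. u i + v i) \<in> W" unfolding W_def using P_idealD(2)[OF I_ideal pq(1,2)] by blast
  next
    fix c v assume "v \<in> W"
    then obtain p where p: "p \<in> I" "v = partial_x \<gamma> p" by (auto simp: W_def)
    then have "(\<lambda>i. c * v i) = partial_x \<gamma> (scal c * p)" using I_sub_MZ by (auto simp: fun_eq_iff partial_smult)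
    then show "(\<lambda>i. c * v i) \<in> W" unfolding W_def using P_idealD(4)[OF I_ideal p(1) scal_mem] by blast
  qed
  then obtain e \<pi> where \<pi>: "\<forall>v\<in>coord_space k. \<pi> v \<in> coord_space e"
    "\<forall>u\<in>coord_space k. \<forall>v\<in>coord_space k. \<pi> (\<lambda>i. u i + v i) = (\<lambda>i. \<pi> u i + \<pi> v i)"
    "\<forall>c. \<forall>v\<in>coord_space k. \<pi> (\<lambda>i. c * v i) = (\<lambda>i. c * \<pi> v i)"
    "\<forall>w\<in>coord_space e. \<exists>v\<in>coord_space k. \<pi> v = w"
    "\<forall>v\<in>coord_space k. \<pi> v = (\<lambda>_. 0) \<longleftrightarrow> v \<in> W"
    unfolding quotient_coordinates_def by (elim exE conjE) (rule that)
  define F where "F p = \<pi> (partial_x \<gamma> p)" for p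
  have F_supp: "F p i = 0" if "p \<in> carrier P" "e \<le> i" for p i
    using bspec[OF \<pi>(1) xsupp[OF that(1)]] that(2) by (simp add: F_def coord_space_def)
  have F_add: "F (p + q) i = F p i + F q i" if "p \<in> carrier P" "q \<in> carrier P" for p q i
  proof -
    have "partial_x \<gamma> (p + q) = (\<lambda>i. partial_x \<gamma> p i + partial_x \<gamma> q i)" by (simp add: fun_eq_iff partial_x_simps)
    then show ?thesis using bspec[OF bspec[OF \<pi>(2) xsupp[OF that(1)]] xsupp[OF that(2)]] by (simp add: F_def)
  qed
  have F_smult: "F (scal c * p) i = c * F p i" if p: "p \<in> MZ" for c p i
  proof -
    have "partial_x \<gamma> (scal c * p) = (\<lambda>i. c * partial_x \<gamma> p i)" by (simp add: fun_eq_iff partial_smult[OF p])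
    then show ?thesis using bspec[OF spec[OF \<pi>(3)] xsupp[OF P_idealD(1)[OF MZ_ideal p]], of c] by (simp add: F_def)
  qed
  have F_zero_iff: "(\<forall>i<e. F p i = 0) \<longleftrightarrow> (\<exists>q\<in>I. partial_x \<gamma> p = partial_x \<gamma> q)" if p: "p \<in> carrier P" for p
  proof -
    have "(\<forall>i<e. F p i = 0) \<longleftrightarrow> F p = (\<lambda>_. 0)" using F_supp[OF p] by (auto simp: fun_eq_iff) (metis not_le)
    also have "\<dots> \<longleftrightarrow> partial_x \<gamma> p \<in> W" using bspec[OF \<pi>(5) xsupp[OF p]] by (simp add: F_def)
    finally show ?thesis by (auto simp: W_def)
  qed
  have surj: "\<exists>p\<in>MZ. (\<forall>i<m. partial_a \<gamma> i p = \<alpha> i) \<and> (\<forall>i<e. F p i = \<beta> i)" for \<alpha> \<beta>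
  proof -
    have "(\<lambda>i. if i < e then \<beta> i else 0) \<in> coord_space e" by (simp add: coord_space_def)
    then obtain v where v: "v \<in> coord_space k" "\<pi> v = (\<lambda>i. if i < e then \<beta> i else 0)" using \<pi>(4) by blast
    define p where "p = (\<Sum>i<m. scal (\<alpha> i) * gen_a \<gamma> i) + (\<Sum>j<k. scal (v j) * var j)"
    have p: "p \<in> MZ" unfolding p_def by (rule linear_combination_mem)
    have "partial_x \<gamma> p = v"
    proof
      fix j show "partial_x \<gamma> p j = v j"
        using partial_linear_combination(2)[of j \<alpha> v] partial_x_support[OF P_idealD(1)[OF MZ_ideal p], of j] v(1)
        by (cases "j < k") (auto simp: p_def coord_space_def)
    qed
    then show ?thesis using p partial_linear_combination(1)[of _ \<alpha> v] v(2)
      by (intro bexI[of _ p]) (auto simp: F_def p_def)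
  qed
  \<comment> \<open>Coordinates on the cotangent spaces of the zero point and of the fiber.\<close>
  define fz where "fz p = vec (m + e) (\<lambda>l. if l < m then partial_a \<gamma> l p else F p (l - m))" for p
  define ff where "ff p = vec e (F p)" for p
  note MZc = P_idealD(1)[OF MZ_ideal]
  have fz_zero: "fz p = 0\<^sub>v (m + e) \<longleftrightarrow> (\<forall>i<m. partial_a \<gamma> i p = 0) \<and> (\<forall>i<e. F p i = 0)" for p
  proof
    assume eq: "fz p = 0\<^sub>v (m + e)"
    have *: "(if l < m then partial_a \<gamma> l p else F p (l - m)) = 0" if l: "l < m + e" for l
    proof -
      have "fz p $ l = 0" using l by (simp add: eq)
      then show ?thesis using l by (simp add: fz_def)
    qed
    show "(\<forall>i<m. partial_a \<gamma> i p = 0) \<and> (\<forall>i<e. F p i = 0)"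
    proof (intro conjI allI impI)
      show "partial_a \<gamma> i p = 0" if "i < m" for i using *[of i] that by simp
      show "F p i = 0" if "i < e" for i using *[of "m + i"] that by simp
    qed
  qed (auto simp: fz_def)
  have ff_zero: "ff p = 0\<^sub>v e \<longleftrightarrow> (\<forall>i<e. F p i = 0)" for p
  proof
    assume eq: "ff p = 0\<^sub>v e"
    have "ff p $ l = 0" if "l < e" for l using that by (simp add: eq)
    then show "\<forall>i<e. F p i = 0" by (simp add: ff_def)
  qed (auto simp: ff_def)
  have ker_zero: "fz p = 0\<^sub>v (m + e) \<longleftrightarrow> p \<in> MM <+>\<^bsub>P\<^esub> I" if p: "p \<in> MZ" for p
  proof
    assume "fz p = 0\<^sub>v (m + e)"
    then have a: "\<forall>i<m. partial_a \<gamma> i p = 0" and x: "\<forall>i<e. F p i = 0" by (simp_all add: fz_zero)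
    from x obtain q where q: "q \<in> I" "partial_x \<gamma> p = partial_x \<gamma> q" using F_zero_iff[OF MZc[OF p]] by blast
    have "p - q \<in> MZ" using P_idealD(3)[OF MZ_ideal p] q(1) I_sub_MZ by blast
    then have "p - q \<in> MM" using MM_iff a q I_partial_a[OF q(1)] by (simp add: partial_a_diff partial_x_simps)
    moreover have "p = (p - q) \<oplus>\<^bsub>P\<^esub> q" by (simp add: P_simps)
    ultimately show "p \<in> MM <+>\<^bsub>P\<^esub> I" unfolding set_add_iff using q(1) by blast
  next
    assume "p \<in> MM <+>\<^bsub>P\<^esub> I"
    then obtain u q where uq: "u \<in> MM" "q \<in> I" "p = u + q" unfolding set_add_iff by (auto simp: P_simps)
    have u: "u \<in> MZ" using MM_sub uq by blast
    have u0: "\<forall>i<m. partial_a \<gamma> i u = 0" "\<forall>j<k. partial_x \<gamma> u j = 0" using MM_iff[OF u] uq(1) by auto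
    have "partial_x \<gamma> p j = partial_x \<gamma> q j" for j
      using u0(2) partial_x_support[OF MZc[OF u], of j] by (cases "j < k") (auto simp: uq(3) partial_x_simps)
    then have "\<forall>i<e. F p i = 0" using F_zero_iff[OF MZc[OF p]] uq(2) by (auto simp: fun_eq_iff)
    then show "fz p = 0\<^sub>v (m + e)" using u0(1) I_partial_a[OF uq(2)] by (simp add: fz_zero uq(3) partial_a_add)
  qed
  have decompose: "\<exists>j\<in>J. p - j \<in> MM" if p: "p \<in> MZ" and x: "\<forall>i<e. F p i = 0" for p
  proof -
    from x obtain q where q: "q \<in> I" "partial_x \<gamma> p = partial_x \<gamma> q" using F_zero_iff[OF MZc[OF p]] by blast
    \<comment> \<open>The element \<open>r\<close> of \<open>J\<close> has the same
      \<open>a\<close>-derivatives as \<open>p\<close> and no \<open>x\<close>-derivatives.\<close>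
    define r where "r = (\<Sum>i<m. scal (partial_a \<gamma> i p) * gen_a \<gamma> i) + (\<Sum>j<k. scal ((\<lambda>_. 0) j) * var j)"
    have r: "r \<in> MZ" unfolding r_def by (rule linear_combination_mem)
    have rJ: "specialize \<gamma> r = 0"
      by (simp add: r_def const_zero additive_sum[of "specialize \<gamma>"] specialize_zero specialize_add specialize_mult gen_a_simps)
    have qZ: "q \<in> MZ" using q(1) I_sub_MZ by blast
    have qr: "q + r \<in> J" unfolding J_iff
      using q(1) rJ P_closed(6)[OF MZc[OF qZ] MZc[OF r]] by (auto simp: specialize_add)
    have "p - (q + r) \<in> MZ" by (rule P_idealD(3)[OF MZ_ideal p P_idealD(2)[OF MZ_ideal qZ r]])
    moreover have "partial_a \<gamma> i (p - (q + r)) = 0" if "i < m" for i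
      using partial_linear_combination(1)[OF that, of "\<lambda>i. partial_a \<gamma> i p" "\<lambda>_. 0"] I_partial_a[OF q(1)]
      unfolding r_def by (simp only: partial_a_diff partial_a_add) simp
    moreover have "partial_x \<gamma> (p - (q + r)) j = 0" for j
      using q(2) rJ by (simp add: partial_x_simps) (simp add: partial_x_def)
    ultimately have "p - (q + r) \<in> MM" using MM_iff by blast
    then show ?thesis using qr by blast
  qed
  have ker_fiber: "ff p = 0\<^sub>v e \<longleftrightarrow> p \<in> MM <+>\<^bsub>P\<^esub> J" if p: "p \<in> MZ" for p
  proof
    assume "ff p = 0\<^sub>v e"
    then obtain j where j: "j \<in> J" "p - j \<in> MM" using decompose[OF p] by (auto simp: ff_zero)
    have "p = (p - j) \<oplus>\<^bsub>P\<^esub> j" by (simp add: P_simps)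
    then show "p \<in> MM <+>\<^bsub>P\<^esub> J" unfolding set_add_iff using j by blast
  next
    assume "p \<in> MM <+>\<^bsub>P\<^esub> J"
    then obtain u r where ur: "u \<in> MM" "r \<in> J" "p = u + r" unfolding set_add_iff by (auto simp: P_simps)
    obtain q where q: "q \<in> I" "specialize \<gamma> r = specialize \<gamma> q" using ur(2) by (auto simp: J_iff)
    have u: "u \<in> MZ" using MM_sub ur by blast
    have "\<forall>j<k. partial_x \<gamma> u j = 0" using MM_iff[OF u] ur(1) by auto
    then have "partial_x \<gamma> u j = 0" for j
      using partial_x_support[OF MZc[OF u], of j] by (cases "j < k") auto
    then have "partial_x \<gamma> p = partial_x \<gamma> q"
      using q(2) by (simp add: fun_eq_iff ur(3) partial_x_simps) (simp add: partial_x_def)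
    then show "ff p = 0\<^sub>v e" using F_zero_iff[OF MZc[OF p]] q(1) by (auto simp: ff_zero)
  qed
  have fz: "fz p \<in> carrier_vec (m + e)" "ff p \<in> carrier_vec e" for p by (simp_all add: fz_def ff_def)
  have fz_add: "fz (p \<oplus>\<^bsub>P\<^esub> q) = fz p + fz q" "ff (p \<oplus>\<^bsub>P\<^esub> q) = ff p + ff q" if "p \<in> MZ" "q \<in> MZ" for p q
    by (auto simp: fz_def ff_def P_simps partial_a_add F_add[OF MZc[OF that(1)] MZc[OF that(2)]])
  have fz_smult: "fz (scal c \<otimes>\<^bsub>P\<^esub> p) = c \<cdot>\<^sub>v fz p" "ff (scal c \<otimes>\<^bsub>P\<^esub> p) = c \<cdot>\<^sub>v ff p" if "p \<in> MZ" for c p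
    by (auto simp: fz_def ff_def P_simps partial_smult[OF that] F_smult[OF that])
  have fz_surj: "\<exists>p\<in>MZ. fz p = v" if "v \<in> carrier_vec (m + e)" for v
  proof -
    obtain p where p: "p \<in> MZ" "\<forall>i<m. partial_a \<gamma> i p = v $ i" "\<forall>i<e. F p i = v $ (m + i)"
      using surj[of "\<lambda>i. v $ i" "\<lambda>i. v $ (m + i)"] by blast
    have "fz p = v" by (rule eq_vecI) (use p that in \<open>auto simp: fz_def\<close>)
    then show ?thesis using p(1) by blast
  qed
  have ff_surj: "\<exists>p\<in>MZ. ff p = v" if "v \<in> carrier_vec e" for v
  proof -
    obtain p where p: "p \<in> MZ" "\<forall>i<e. F p i = v $ i" using surj[of "\<lambda>_. 0" "\<lambda>i. v $ i"] by blast
    have "ff p = v" by (rule eq_vecI) (use p that in \<open>auto simp: ff_def\<close>)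
    then show ?thesis using p(1) by blast
  qed
  have 1: "cot_dim (R_zero_scalar m k I \<gamma>) (R_zero m k I \<gamma>) (max_ideal (R_zero m k I \<gamma>)) = m + e"
    using localization_model.cot_dim_max_ideal[OF zero_model scal_hom(1-4) residue_scal, of fz "m + e"]
      fz(1) fz_add(1) fz_smult(1) fz_surj ker_zero
    by (simp add: R_zero_scalar_def[abs_def] R_scalar_def)
  have 2: "cot_dim (R_fiber_scalar k I \<gamma>) (R_fiber k I \<gamma>) (max_ideal (R_fiber k I \<gamma>)) = e"
    using localization_model.cot_dim_max_ideal[OF fiber_model scal_hom(1-4) residue_scal, of ff e]
      fz(2) fz_add(2) fz_smult(2) ff_surj ker_fiber
    by (simp add: R_fiber_scalar_def[abs_def] to_fiber(6))
  have 3: "cot_dim (fiber_scalar k I \<gamma>) (fiber_ring k I \<gamma>) (fiber_origin k I \<gamma>) = e"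
    using cot_dim_surjection[OF cring_P to_fiber(1-3) MZ_ideal scal_hom(1), of ff e]
      fz(2) fz_add(2) fz_smult(2) ff_surj ker_fiber
    by (simp add: to_fiber(4,5,6))
  have 4: "interval_dim P J MZ \<le> ereal (real e)"
  proof -
    have "\<exists>y. \<forall>i<e. y i \<in> MZ \<and> ff (y i) = unit_vec e i"
      using ff_surj[of "unit_vec e _"] by (intro choice allI) auto
    then obtain y where y: "\<And>i. i < e \<Longrightarrow> y i \<in> MZ" "\<And>i. i < e \<Longrightarrow> ff (y i) = unit_vec e i" by blast
    have F_y: "F (y i) l = (if l = i then 1 else 0)" if "i < e" "l < e" for i l
    proof -
      have "F (y i) l = ff (y i) $ l" using that by (simp add: ff_def)
      then show ?thesis using that by (simp add: y(2))
    qed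
    have YM: "y ` {..<e} \<subseteq> MZ" using y(1) by auto
    then have YP: "y ` {..<e} \<subseteq> carrier P" using MZc by blast
    have "interval_dim P J MZ \<le> ereal (real (card (y ` {..<e})))"
    proof (rule fiber_dim_le_generators[OF _ YM])
      fix p assume p: "p \<in> MZ"
      define s where "s = (\<Sum>i<e. scal (F p i) * y i)"
      have sI: "s \<in> Idl\<^bsub>P\<^esub> (y ` {..<e})" unfolding s_def
        by (intro P_sum_mem P_idealD(4)[OF P.genideal_ideal[OF YP]] scal_mem P.genideal_ideal[OF YP])
          (use P.genideal_self[OF YP] in auto)
      have sM: "s \<in> MZ" unfolding s_def
        by (intro P_sum_mem P_idealD(4)[OF MZ_ideal] scal_mem MZ_ideal) (simp add: y)
      have F_sum: "F (\<Sum>i\<in>X. scal (F p i) * y i) l = (\<Sum>i\<in>X. F p i * F (y i) l)" if "X \<subseteq> {..<e}" "finite X" for X l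
        using that(2,1)
      proof (induction X rule: finite_induct)
        case empty
        have "partial_x \<gamma> (scal 0 * 0) = partial_x \<gamma> 0" by simp
        then show ?case using F_smult[OF P_idealD(5)[OF MZ_ideal], of 0] by simp
      next
        case (insert i X)
        have "(\<Sum>i\<in>X. scal (F p i) * y i) \<in> MZ"
          by (intro P_sum_mem P_idealD(4)[OF MZ_ideal] scal_mem MZ_ideal) (use insert y in auto)
        moreover have "scal (F p i) * y i \<in> MZ" using P_idealD(4)[OF MZ_ideal _ scal_mem] y insert by auto
        ultimately show ?case using insert y by (simp add: F_add MZc F_smult)
      qed
      have "F s l = F p l" if "l < e" for l
      proof -
        have "F s l = (\<Sum>i<e. F p i * F (y i) l)" unfolding s_def by (rule F_sum) auto
        also have "\<dots> = (\<Sum>i<e. if i = l then F p l else 0)" by (rule sum.cong) (use F_y that in auto)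
        finally show ?thesis using that by simp
      qed
      moreover have "F p l = F (p - s) l + F s l" for l
        using F_add[OF MZc[OF P_idealD(3)[OF MZ_ideal p sM]] MZc[OF sM], of l] by simp
      ultimately have "\<forall>i<e. F (p - s) i = 0" by (metis add_cancel_left_left)
      then show "\<exists>y\<in>Idl\<^bsub>P\<^esub> (y ` {..<e}). \<exists>j\<in>J. p - y - j \<in> MM"
        using decompose[OF P_idealD(3)[OF MZ_ideal p sM]] sI by blast
    qed simp
    also have "\<dots> \<le> ereal (real e)" using card_image_le[of "{..<e}" y] by simp
    finally show ?thesis .
  qed
  show ?thesis using 1 2 3 4 by blast
qed

end

theorem proposition4p3:
  fixes m k :: nat
    and w :: "nat \<Rightarrow> nat"
    and I :: "'k::field mpoly mpoly set"
    and \<gamma> :: "nat \<Rightarrow> 'k"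
  assumes "\<And>j. j < k \<Longrightarrow> 0 < w j"
    and "defines_positive_algebra m k w I"
  shows
    "let d_zero = krull_dim (R_zero m k I \<gamma>);
         d_fiber = krull_dim (R_fiber k I \<gamma>);
         cot_zero = ereal (real (cot_dim (R_zero_scalar m k I \<gamma>) (R_zero m k I \<gamma>)
                                   (max_ideal (R_zero m k I \<gamma>))));
         cot_fiber = ereal (real (cot_dim (fiber_scalar k I \<gamma>) (fiber_ring k I \<gamma>)
                                   (fiber_origin k I \<gamma>)));
         ecod_zero = ecod (R_zero_scalar m k I \<gamma>) (R_zero m k I \<gamma>);
         ecod_fiber = ecod (R_fiber_scalar k I \<gamma>) (R_fiber k I \<gamma>)
     in (d_zero - ereal (real m) \<le> d_fiber \<and>
         d_fiber = cot_fiber - ecod_fiber \<and>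
         cot_fiber - ecod_fiber = cot_zero - ereal (real m) - ecod_fiber \<and>
         cot_zero - ereal (real m) - ecod_fiber
           = d_zero + ecod_zero - ereal (real m) - ecod_fiber) \<and>
        (0 \<le> ecod_fiber \<and> ecod_fiber \<le> ecod_zero)"
proof -
  interpret positive_algebra m k \<gamma> w I by unfold_locales (use assms in auto)
  obtain e where e: "cot_dim (R_zero_scalar m k I \<gamma>) (R_zero m k I \<gamma>) (max_ideal (R_zero m k I \<gamma>)) = m + e"
    "cot_dim (fiber_scalar k I \<gamma>) (fiber_ring k I \<gamma>) (fiber_origin k I \<gamma>) = e"
    "cot_dim (R_fiber_scalar k I \<gamma>) (R_fiber k I \<gamma>) (max_ideal (R_fiber k I \<gamma>)) = e"
    "krull_dim (R_fiber k I \<gamma>) \<le> ereal (real e)"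
    using cotangent_dimensions unfolding krull_dim_fiber by blast
  have le: "krull_dim (R_zero m k I \<gamma>) \<le> krull_dim (R_fiber k I \<gamma>) + ereal (real m)"
    unfolding krull_dim_fiber krull_dim_zero by (rule interval_dim_le)
  have nonneg: "0 \<le> krull_dim (R_zero m k I \<gamma>)" "0 \<le> krull_dim (R_fiber k I \<gamma>)"
    unfolding krull_dim_fiber krull_dim_zero by (intro interval_dim_nonneg I_sub_MZ J_sub_MZ)+
  \<comment> \<open>Both dimensions are finite, so the claims reduce to real arithmetic.\<close>
  obtain df where df: "krull_dim (R_fiber k I \<gamma>) = ereal df"
    using nonneg(2) e(4) by (cases "krull_dim (R_fiber k I \<gamma>)") auto
  obtain dz where dz: "krull_dim (R_zero m k I \<gamma>) = ereal dz"
    using nonneg(1) le unfolding df by (cases "krull_dim (R_zero m k I \<gamma>)") auto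
  show ?thesis
    using e(4) le unfolding Let_def ecod_def e df dz by (simp add: zero_ereal_def)
qed

end
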